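(* Let $\mathbf{a}=(0,1)$. For $\epsilon>0$ and $\mathbf{p}=(0,p)$, let $D_1,D_2$ (depending on $\epsilon$) be the two disks and let $u$ (depending on $\epsilon,\mathbf{p}$) be the solution of the dipole-emitter problem, both described in the context. Then there exists a positive constant $A$ such that, for all sufficiently small $\epsilon>0$ and all $\mathbf{p}=(0,p)$ with $|\mathbf{p}|<1/2$, $$|\nabla u(\mathbf{x})|\lesssim\frac{1}{|\mathbf{x}-\mathbf{p}|^2}\exp\left(-A\,\frac{|\mathbf{x}-\mathbf{p}|}{\sqrt{\epsilon}\,|\mathbf{x}-\mathbf{p}|+|p\,\mathbf{x}+(0,\epsilon)|}\right)$$ for all $\mathbf{x}=(x_1,x_2)\in B_{1/2}\setminus\overline{D_1\cup D_2}$ with $\mathbf{x}\ne\mathbf{p}$, where the constant implicit in $\lesssim$ is independent of $\epsilon$, $\mathbf{p}$ and $\mathbf{x}$.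
   Context: Notation: $B_r(\mathbf{c})$ is the open disk in $\mathbb{R}^2$ of radius $r$ centered at $\mathbf{c}$, and $B_r=B_r(\mathbf{0})$. For $\epsilon>0$, $$D_j=B_1\big((-1)^j(1+\epsilon/2),0\big),\quad j=1,2,$$ so $\mathrm{dist}(D_1,D_2)=\epsilon$. The emitter location is $\mathbf{p}=(0,p)$ on the $x_2$-axis. $\delta_{\mathbf{p}}$ is the Dirac mass at $\mathbf{p}$. The dipole-emitter problem (with unit dipole direction $\mathbf{a}$) is: find $u$ such that $$\begin{cases}\Delta u=\mathbf{a}\cdot\nabla\delta_{\mathbf{p}} & \text{in }\mathbb{R}^2\setminus\overline{D_1\cup D_2}\ \text{(in the sense of distributions)},\\ u=c_j & \text{on }\partial D_j,\ j=1,2,\\ \int_{\partial D_j}\partial_\nu u\,ds=0, & j=1,2,\\ u(\mathbf{x})=O(|\mathbf{x}|^{-1}) & \text{as }|\mathbf{x}|\to\infty,\end{cases}$$ where the constants $c_1,c_2$ are not prescribed but are part of the unknowns (determined by the problem), and $\nu$ is the unit normal on $\partial D_1\cup\partial D_2$ pointing inward to $D_1\cup D_2$. This problem has a unique solution $u$. $\alpha\lesssim\beta$ means $\alpha\le C\beta$ for a positive constant $C$ independent of (sufficiently small) $\epsilon$. *)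

theory Defs
  imports "HOL-Analysis.Analysis" "HOL-Library.Landau_Symbols"
begin

section \<open>Smooth functions and distributions on the plane\<close>

definition dderiv :: "'a::euclidean_space \<Rightarrow> ('a \<Rightarrow> real) \<Rightarrow> 'a \<Rightarrow> real" where
  "dderiv a f x = frechet_derivative f (at x) a"

fun C_k :: "nat \<Rightarrow> ('a::euclidean_space \<Rightarrow> real) \<Rightarrow> bool" where
  "C_k 0 f \<longleftrightarrow> continuous_on UNIV f"
| "C_k (Suc k) f \<longleftrightarrow> (\<forall>x. f differentiable (at x)) \<and> (\<forall>b\<in>Basis. C_k k (dderiv b f))"

definition test_function :: "'a::euclidean_space set \<Rightarrow> ('a \<Rightarrow> real) \<Rightarrow> bool" where
  "test_function \<Omega> \<phi> \<longleftrightarrow> (\<forall>k. C_k k \<phi>) \<and>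
     compact (closure {x. \<phi> x \<noteq> 0}) \<and> closure {x. \<phi> x \<noteq> 0} \<subseteq> \<Omega>"

text \<open>
  A distribution is represented by its action on test functions; values at other functions
  are irrelevant, since distributions are only compared by \<open>distr_eq\<close>.
\<close>

type_synonym 'a distr = "('a \<Rightarrow> real) \<Rightarrow> real"

definition distr_eq :: "'a::euclidean_space set \<Rightarrow> 'a distr \<Rightarrow> 'a distr \<Rightarrow> bool" where
  "distr_eq \<Omega> S T \<longleftrightarrow> (\<forall>\<phi>. test_function \<Omega> \<phi> \<longrightarrow> S \<phi> = T \<phi>)"

definition dirac :: "'a \<Rightarrow> 'a distr" where
  "dirac p \<phi> = \<phi> p"

definition distr_of :: "'a::euclidean_space set \<Rightarrow> ('a \<Rightarrow> real) \<Rightarrow> 'a distr" where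
  "distr_of \<Omega> u \<phi> = (LINT x:\<Omega>|lborel. u x * \<phi> x)"

definition distr_dderiv :: "'a::euclidean_space \<Rightarrow> 'a distr \<Rightarrow> 'a distr" where
  "distr_dderiv a T \<phi> = - T (dderiv a \<phi>)"

definition distr_laplacian :: "'a::euclidean_space distr \<Rightarrow> 'a distr" where
  "distr_laplacian T \<phi> = (\<Sum>b\<in>Basis. distr_dderiv b (distr_dderiv b T) \<phi>)"

definition locally_integrable_on :: "('a::euclidean_space \<Rightarrow> real) \<Rightarrow> 'a set \<Rightarrow> bool" where
  "locally_integrable_on u \<Omega> \<longleftrightarrow> (\<forall>K. compact K \<longrightarrow> K \<subseteq> \<Omega> \<longrightarrow> set_integrable lborel K u)"

section \<open>The dipole-emitter problem\<close>

definition disk_center :: "real \<Rightarrow> nat \<Rightarrow> real \<times> real" where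
  "disk_center \<epsilon> j = ((-1) ^ j * (1 + \<epsilon> / 2), 0)"

definition disk :: "real \<Rightarrow> nat \<Rightarrow> (real \<times> real) set" where
  "disk \<epsilon> j = ball (disk_center \<epsilon> j) 1"

definition exterior_domain :: "real \<Rightarrow> (real \<times> real) set" where
  "exterior_domain \<epsilon> = UNIV - closure (disk \<epsilon> 1 \<union> disk \<epsilon> 2)"

text \<open>
  At a boundary point \<open>x\<close> of the \<open>j\<close>-th disk, the unit normal pointing into the disk is
  \<open>disk_center \<epsilon> j - x\<close> (the radius is 1). The normal derivative is one-sided, taken from
  the exterior, so that it does not depend on the values of \<open>u\<close> inside the disk.
\<close>

definition has_normal_derivative ::
    "(real \<times> real \<Rightarrow> real) \<Rightarrow> real \<Rightarrow> nat \<Rightarrow> real \<times> real \<Rightarrow> real \<Rightarrow> bool" where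
  "has_normal_derivative u \<epsilon> j x d \<longleftrightarrow>
     ((\<lambda>t. u (x + t *\<^sub>R (disk_center \<epsilon> j - x))) has_real_derivative d) (at 0 within {..0})"

text \<open>
  The function \<open>u\<close> is total, but its values inside the disks and at the emitter \<open>p\<close> play
  no role. Continuity up to the boundary gives the Dirichlet condition its pointwise
  meaning. The flux integral is with respect to arc length, via the unit-speed
  parametrisation of the circle.
\<close>

definition dipole_solution ::
    "real \<Rightarrow> real \<times> real \<Rightarrow> real \<times> real \<Rightarrow> (real \<times> real \<Rightarrow> real) \<Rightarrow> bool" where
  "dipole_solution \<epsilon> a p u \<longleftrightarrow>
     locally_integrable_on u (exterior_domain \<epsilon>) \<and>
     continuous_on (UNIV - (disk \<epsilon> 1 \<union> disk \<epsilon> 2) - {p}) u \<and>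
     distr_eq (exterior_domain \<epsilon>)
       (distr_laplacian (distr_of (exterior_domain \<epsilon>) u)) (distr_dderiv a (dirac p)) \<and>
     (\<forall>j\<in>{1, 2}. \<exists>c. \<forall>x\<in>frontier (disk \<epsilon> j). u x = c) \<and>
     (\<forall>j\<in>{1, 2}. \<exists>g. (\<forall>x\<in>frontier (disk \<epsilon> j). has_normal_derivative u \<epsilon> j x (g x)) \<and>
        ((\<lambda>\<theta>. g (disk_center \<epsilon> j + (cos \<theta>, sin \<theta>))) has_integral 0) {0..2 * pi}) \<and>
     u \<in> O[at_infinity](\<lambda>x. 1 / norm x)"

end

theory Submission
  imports Defs "HOL-Complex_Analysis.Complex_Analysis"
begin

text \<open>
  Bipolar coordinates \<open>\<zeta> = Ln ((\<alpha> + z) / (\<alpha> - z))\<close> map the exterior of the disks onto a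
  \<open>2 pi \<i>\<close>-periodic strip of half-width \<open>h \<sim> sqrt \<epsilon>\<close>, and the emitter is a dipole pointing along the strip.
  In the strip, the potential that vanishes on both sides is the imaginary part of the image sum
  \<open>\<Sum>n. k / sin (k (\<zeta> - \<zeta>\<^sub>p - 2 pi \<i> n))\<close> with \<open>k = pi / (2 h)\<close>, whose derivative decays like
  \<open>exp (- k \<bar>\<zeta> - \<zeta>\<^sub>p\<bar> / 2)\<close>. Rewriting this in terms of \<open>z\<close> gives the bound.

  That an arbitrary solution is this potential up to a constant is shown without regularity
  theory: testing the equation with radial functions yields a mean value property away from the
  emitter and the singular part at the emitter; a maximum principle with a logarithmic barrier at the
  emitter and at infinity then identifies the solution up to \<open>A + B Re \<zeta>\<close>, and the flux condition gives \<open>B = 0\<close>.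
\<close>

section \<open>Smooth functions\<close>

definition smooth :: "('a::euclidean_space \<Rightarrow> real) \<Rightarrow> bool" where
  "smooth f \<longleftrightarrow> (\<forall>k. C_k k f)"

lemma dderiv_eqI: "(f has_derivative f') (at x) \<Longrightarrow> dderiv a f x = f' a"
  unfolding dderiv_def by (metis frechet_derivative_at)

lemma dderiv_eqI': "(\<And>x. (f has_derivative f' x) (at x)) \<Longrightarrow> dderiv a f = (\<lambda>x. f' x a)"
  using dderiv_eqI by blast

lemma C_k_has_derivative:
  assumes "C_k (Suc k) f"
  shows "(f has_derivative (\<lambda>h. dderiv h f x)) (at x)"
  using assms unfolding dderiv_def by (metis C_k.simps(2) frechet_derivative_works)

lemma C_k_Suc_imp: "C_k (Suc k) f \<Longrightarrow> C_k k f"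
proof (induction k arbitrary: f)
  case 0
  then show ?case
    by (simp add: continuous_at_imp_continuous_on differentiable_imp_continuous_within)
next
  case (Suc k)
  then show ?case by (metis C_k.simps(2))
qed

lemma C_k_continuous: "C_k k f \<Longrightarrow> continuous_on UNIV f"
proof (induction k)
  case (Suc k)
  then show ?case using C_k_Suc_imp by blast
qed simp

lemma C_k_coinduct:
  assumes "f \<in> S"
    and "\<And>f. f \<in> S \<Longrightarrow> (\<forall>x. f differentiable (at x)) \<and> (\<forall>b\<in>Basis. dderiv b f \<in> S)"
  shows "C_k k f"
  using assms(1)
proof (induction k arbitrary: f)
  case 0
  then show ?case using assms(2)[of f]
    by (auto intro: continuous_at_imp_continuous_on differentiable_imp_continuous_within)
next
  case (Suc k)
  then show ?case using assms(2)[of f] by auto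
qed

lemma C_k_const: "C_k k (\<lambda>x::'a::euclidean_space. c)"
proof (rule C_k_coinduct[where S = "range (\<lambda>c x. c)"])
  show "(\<forall>x. f differentiable at x) \<and> (\<forall>b\<in>Basis. dderiv b f \<in> range (\<lambda>c x. c))"
    if fS: "f \<in> range (\<lambda>c (x::'a). c)" for f :: "'a \<Rightarrow> real"
  proof -
    obtain c where f: "f = (\<lambda>x. c)" using fS by (rule rangeE)
    have "dderiv b f = (\<lambda>x. 0)" for b
      unfolding f using dderiv_eqI[OF has_derivative_const] by auto
    then show ?thesis using f by auto
  qed
qed auto

lemma C_k_inner: "C_k k (\<lambda>x::'a::euclidean_space. inner x v)"
proof (cases k)
  case 0
  then show ?thesis by (auto intro!: continuous_intros)
next
  case (Suc n)
  have d: "((\<lambda>x. inner x v) has_derivative (\<lambda>h. inner h v)) (at x)" for x :: 'a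
    by (auto intro!: derivative_eq_intros)
  show ?thesis unfolding Suc C_k.simps
    using d dderiv_eqI'[OF d] by (auto simp: differentiable_def C_k_const)
qed

lemma C_k_add: "C_k k f \<Longrightarrow> C_k k g \<Longrightarrow> C_k k (\<lambda>x. f x + g x)"
proof (induction k arbitrary: f g)
  case 0
  then show ?case by (auto intro!: continuous_intros)
next
  case (Suc k)
  have d: "((\<lambda>x. f x + g x) has_derivative (\<lambda>h. dderiv h f x + dderiv h g x)) (at x)" for x
    by (intro derivative_intros C_k_has_derivative[OF Suc.prems(1)] C_k_has_derivative[OF Suc.prems(2)])
  show ?case
    using d dderiv_eqI'[OF d] Suc by (auto simp: differentiable_def intro!: Suc.IH)
qed

lemma C_k_mult: "C_k k f \<Longrightarrow> C_k k g \<Longrightarrow> C_k k (\<lambda>x. f x * g x)"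
proof (induction k arbitrary: f g)
  case 0
  then show ?case by (auto intro!: continuous_intros)
next
  case (Suc k)
  have d: "((\<lambda>x. f x * g x) has_derivative (\<lambda>h. f x * dderiv h g x + dderiv h f x * g x)) (at x)" for x
    by (intro derivative_intros C_k_has_derivative[OF Suc.prems(1)] C_k_has_derivative[OF Suc.prems(2)])
  show ?case
    using d dderiv_eqI'[OF d] Suc C_k_Suc_imp[OF Suc.prems(1)] C_k_Suc_imp[OF Suc.prems(2)]
    by (auto simp: differentiable_def intro!: Suc.IH C_k_add)
qed

lemma C_k_has_real_derivative:
  fixes f :: "real \<Rightarrow> real"
  assumes "C_k (Suc k) f"
  shows "(f has_real_derivative dderiv 1 f x) (at x)"
  unfolding has_field_derivative_def
proof (rule has_derivative_eq_rhs[OF C_k_has_derivative[OF assms]], rule ext)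
  have "linear (\<lambda>h. dderiv h f x)"
    using C_k_has_derivative[OF assms] has_derivative_linear by blast
  from linear_scale[OF this, of _ 1] show "dderiv h f x = dderiv 1 f x * h" for h
    by (metis mult.commute mult.right_neutral real_scaleR_def)
qed

lemma C_k_compose:
  fixes g :: "real \<Rightarrow> real"
  shows "C_k k g \<Longrightarrow> C_k k f \<Longrightarrow> C_k k (\<lambda>x. g (f x))"
proof (induction k arbitrary: g f)
  case 0
  then show ?case by (auto intro!: continuous_on_compose2[of UNIV g])
next
  case (Suc k)
  have g: "(g has_derivative (\<lambda>h. h * dderiv 1 g x)) (at x)" for x
    by (rule has_derivative_eq_rhs[OF C_k_has_real_derivative[OF Suc.prems(1), unfolded has_field_derivative_def]])
      (rule ext, rule mult.commute)
  have d: "((\<lambda>x. g (f x)) has_derivative (\<lambda>h. dderiv h f x * dderiv 1 g (f x))) (at x)" for x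
    by (rule has_derivative_compose[OF C_k_has_derivative[OF Suc.prems(2)] g])
  have e: "dderiv b (\<lambda>x. g (f x)) = (\<lambda>x. dderiv b f x * dderiv 1 g (f x))" for b
    by (rule dderiv_eqI'[OF d])
  have "C_k k (\<lambda>x. dderiv b f x * dderiv 1 g (f x))" if "b \<in> Basis" for b
    using that Suc.prems
    by (intro C_k_mult Suc.IH[of "dderiv 1 g" f] C_k_Suc_imp[OF Suc.prems(2)]) simp_all
  then show ?case using d unfolding C_k.simps e differentiable_def by blast
qed

lemma smooth_const: "smooth (\<lambda>x::'a::euclidean_space. c)"
  and smooth_inner: "smooth (\<lambda>x::'a::euclidean_space. inner x v)"
  by (auto simp: smooth_def C_k_const C_k_inner)

lemma smooth_id: "smooth (\<lambda>x::real. x)"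
  using smooth_inner[of "1::real"] by (simp add: inner_real_def)

lemma smooth_add: "smooth f \<Longrightarrow> smooth g \<Longrightarrow> smooth (\<lambda>x. f x + g x)"
  and smooth_mult: "smooth f \<Longrightarrow> smooth g \<Longrightarrow> smooth (\<lambda>x. f x * g x)"
  by (auto simp: smooth_def C_k_add C_k_mult)

lemma smooth_diff: "smooth f \<Longrightarrow> smooth g \<Longrightarrow> smooth (\<lambda>x. f x - g x)"
  using smooth_add[of f "\<lambda>x. (-1) * g x"] smooth_mult[OF smooth_const, of g "-1"] by simp

lemma smooth_compose:
  fixes g :: "real \<Rightarrow> real"
  shows "smooth g \<Longrightarrow> smooth f \<Longrightarrow> smooth (\<lambda>x. g (f x))"
  by (auto simp: smooth_def C_k_compose)

lemma smooth_continuous: "smooth f \<Longrightarrow> continuous_on UNIV f"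
  using C_k.simps(1) smooth_def by blast

lemma C_k_Suc_realI:
  fixes f :: "real \<Rightarrow> real"
  assumes "\<And>x. (f has_real_derivative f' x) (at x)" "C_k k f'"
  shows "C_k (Suc k) f"
proof -
  have d: "(f has_derivative (\<lambda>h. f' x * h)) (at x)" for x
    using assms(1) by (simp add: has_field_derivative_def)
  show ?thesis using d dderiv_eqI'[OF d] assms(2) by (auto simp: differentiable_def)
qed

lemma smooth_realI:
  fixes f :: "real \<Rightarrow> real"
  assumes "\<And>x. (f has_real_derivative f' x) (at x)" "smooth f'"
  shows "smooth f"
  unfolding smooth_def
proof
  fix k
  have "C_k k f'" using assms(2) by (simp add: smooth_def)
  from C_k_Suc_realI[OF assms(1) this] show "C_k k f" by (rule C_k_Suc_imp)
qed

lemma smooth_has_real_derivative: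
  fixes f :: "real \<Rightarrow> real"
  assumes "smooth f"
  shows "(f has_real_derivative dderiv 1 f x) (at x)"
  using assms by (intro C_k_has_real_derivative[of 0]) (simp only: smooth_def)

lemma smooth_dderiv: "smooth f \<Longrightarrow> b \<in> Basis \<Longrightarrow> smooth (dderiv b f)"
  unfolding smooth_def using C_k.simps(2) by blast

lemma eventually_nhds_less: "s < c \<Longrightarrow> \<forall>\<^sub>F t in nhds s. t < (c::real)"
  using eventually_nhds_in_open[of "{..<c}" s] by simp

lemma C_k_divide_id:
  fixes f :: "real \<Rightarrow> real"
  assumes c: "0 < c"
  shows "C_k k f \<Longrightarrow> (\<And>s. s \<le> c \<Longrightarrow> f s = 0) \<Longrightarrow> C_k k (\<lambda>s. f s / s)"
proof (induction k arbitrary: f)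
  case (0 f)
  have "isCont (\<lambda>s. f s / s) s" for s
  proof (cases "s < c")
    case True
    have "\<forall>\<^sub>F t in nhds s. f t / t = 0"
      using eventually_nhds_less[OF True] by (rule eventually_mono) (simp add: 0(2))
    then show ?thesis using isCont_cong[of "\<lambda>s. f s / s" "\<lambda>_. 0" s] by simp
  next
    case False
    then have "isCont f s" "s \<noteq> 0" using 0(1) c by (simp_all add: continuous_on_eq_continuous_at)
    then show ?thesis by (intro continuous_intros)
  qed
  then show ?case by (simp add: continuous_at_imp_continuous_on)
next
  case (Suc k f)
  define f' where "f' = dderiv 1 f"
  have f': "(f has_real_derivative f' x) (at x)" "C_k k f'" for x
    using C_k_has_real_derivative[OF Suc.prems(1)] Suc.prems(1) by (simp_all add: f'_def)
  have f'0: "f' s = 0" if "s < c" for s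
  proof -
    have "\<forall>\<^sub>F t in nhds s. f t = 0"
      using eventually_nhds_less[OF that] by (rule eventually_mono) (simp add: Suc.prems(2))
    then have "(f has_real_derivative 0) (at s)"
      using DERIV_cong_ev[of s s f "\<lambda>_. 0" 0 0] by simp
    then show ?thesis using f'(1) DERIV_unique by blast
  qed
  have cont: "continuous_on UNIV f'" using f'(2) by (rule C_k_continuous)
  have f'c: "f' s = 0" if "s \<le> c" for s
  proof -
    have "closed {s. f' s = 0}"
      using continuous_closed_preimage_constant[OF cont closed_UNIV, of 0] by simp
    moreover have "{..<c} \<subseteq> {s. f' s = 0}" using f'0 by auto
    ultimately have "closure {..<c} \<subseteq> {s. f' s = 0}" by (rule closure_minimal[rotated])
    then show ?thesis using that by auto
  qed
  have D: "((\<lambda>s. f s / s) has_real_derivative (f' s - f s / s) / s) (at s)" for s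
  proof (cases "s < c")
    case True
    have "\<forall>\<^sub>F t in nhds s. f t / t = 0"
      using eventually_nhds_less[OF True] by (rule eventually_mono) (simp add: Suc.prems(2))
    then have "((\<lambda>s. f s / s) has_real_derivative 0) (at s)"
      using DERIV_cong_ev[of s s "\<lambda>s. f s / s" "\<lambda>_. 0" 0 0] by simp
    moreover have "f' s = 0" "f s = 0" using True f'0 Suc.prems(2)[of s] by (blast, linarith)
    ultimately show ?thesis by simp
  next
    case False
    then have s: "s \<noteq> 0" using c by linarith
    have "((\<lambda>s. f s / s) has_real_derivative (f' s * s - f s * 1) / (s * s)) (at s)"
      by (intro DERIV_divide f'(1) DERIV_ident s)
    moreover have "(f' s * s - f s * 1) / (s * s) = (f' s - f s / s) / s"
      using s by (simp add: field_simps)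
    ultimately show ?thesis by simp
  qed
  have "C_k k (\<lambda>s. f s / s)" by (rule Suc.IH[OF C_k_Suc_imp[OF Suc.prems(1)] Suc.prems(2)])
  then have "C_k k (\<lambda>s. f' s + -1 * (f s / s))"
    by (rule C_k_add[OF f'(2) C_k_mult[OF C_k_const]])
  then have C: "C_k k (\<lambda>s. f' s - f s / s)" by (simp only: mult_minus1 diff_conv_add_uminus)
  have "C_k k (\<lambda>s. (f' s - f s / s) / s)"
  proof (rule Suc.IH[OF C])
    show "f' s - f s / s = 0" if "s \<le> c" for s
      using f'c[OF that] Suc.prems(2)[OF that] by simp
  qed
  then show ?case by (rule C_k_Suc_realI[OF D])
qed

lemma smooth_divide_id:
  fixes f :: "real \<Rightarrow> real"
  assumes "smooth f" "0 < c" "\<And>s. s \<le> c \<Longrightarrow> f s = 0"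
  shows "smooth (\<lambda>s. f s / s)"
  unfolding smooth_def
proof
  show "C_k k (\<lambda>s. f s / s)" for k
    by (rule C_k_divide_id[OF assms(2) _ assms(3)]) (use assms(1) in \<open>simp_all only: smooth_def\<close>)
qed

definition flat_exp :: "real poly \<Rightarrow> real \<Rightarrow> real" where
  "flat_exp p t = (if t > 0 then poly p (1 / t) * exp (- (1 / t)) else 0)"

lemma poly_times_exp_neg_tendsto_0: "((\<lambda>x::real. poly p x * exp (- x)) \<longlongrightarrow> 0) at_top"
proof -
  have "((\<lambda>x. \<Sum>i\<le>degree p. coeff p i * (x ^ i / exp x)) \<longlongrightarrow> (\<Sum>i\<le>degree p. coeff p i * 0)) at_top"
    by (intro tendsto_sum tendsto_mult tendsto_const tendsto_power_div_exp_0)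
  then show ?thesis
    by (simp add: poly_altdef sum_distrib_right exp_minus divide_inverse mult.assoc)
qed

lemma flat_exp_has_derivative:
  "(flat_exp p has_real_derivative flat_exp (monom 1 2 * (p - pderiv p)) t) (at t)"
proof (cases "t > 0")
  case True
  have "((\<lambda>t. poly p (1 / t) * exp (- (1 / t))) has_real_derivative
      flat_exp (monom 1 2 * (p - pderiv p)) t) (at t)"
    using True
    by (auto intro!: derivative_eq_intros poly_DERIV DERIV_chain2[OF poly_DERIV]
        simp: flat_exp_def poly_monom power2_eq_square divide_simps) (simp add: algebra_simps)
  moreover have ev: "\<forall>\<^sub>F s in nhds t. flat_exp p s = poly p (1 / s) * exp (- (1 / s))"
    using eventually_nhds_in_open[of "{0<..}" t] True
    by (auto simp: flat_exp_def elim!: eventually_mono)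
  ultimately show ?thesis by (simp only: DERIV_cong_ev[OF refl ev refl])
next
  case nonpos: False
  show ?thesis
  proof (cases "t < 0")
    case True
    have "\<forall>\<^sub>F s in nhds t. flat_exp p s = 0"
      using eventually_nhds_in_open[of "{..<0}" t] True
      by (auto simp: flat_exp_def elim!: eventually_mono)
    then have "(flat_exp p has_real_derivative 0) (at t)"
      using DERIV_cong_ev[of t t "flat_exp p" "\<lambda>_. 0" 0 0] by simp
    then show ?thesis using True by (simp add: flat_exp_def)
  next
    case False
    then have t: "t = 0" using nonpos by simp
    have "((\<lambda>x. poly (p * [:0, 1:]) x * exp (- x)) \<longlongrightarrow> 0) at_top"
      by (rule poly_times_exp_neg_tendsto_0)
    from filterlim_compose[OF this filterlim_inverse_at_top_right]
    have lim: "((\<lambda>h. poly p (inverse h) * inverse h * exp (- inverse h)) \<longlongrightarrow> 0) (at_right 0)"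
      by (simp add: mult_ac)
    have ev: "\<forall>\<^sub>F h in at_right 0. (flat_exp p h - flat_exp p 0) / (h - 0)
        = poly p (inverse h) * inverse h * exp (- inverse h)"
      by (auto simp: eventually_at_filter flat_exp_def divide_inverse mult_ac)
    have r: "((\<lambda>h. (flat_exp p h - flat_exp p 0) / (h - 0)) \<longlongrightarrow> 0) (at_right 0)"
      by (rule iffD2[OF tendsto_cong[OF ev] lim])
    have "\<forall>\<^sub>F h in at_left 0. (flat_exp p h - flat_exp p 0) / (h - 0) = 0"
      by (auto simp: eventually_at_filter flat_exp_def)
    then have l: "((\<lambda>h. (flat_exp p h - flat_exp p 0) / (h - 0)) \<longlongrightarrow> 0) (at_left 0)"
      by (simp add: tendsto_eventually)
    have "(flat_exp p has_real_derivative 0) (at 0)"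
      unfolding has_field_derivative_iff using r l by (rule filterlim_split_at_real[rotated])
    then show ?thesis by (simp add: t flat_exp_def)
  qed
qed

lemma smooth_flat_exp: "smooth (flat_exp p)"
  unfolding smooth_def
proof
  fix k
  show "C_k k (flat_exp p)"
  proof (rule C_k_coinduct[of _ "range flat_exp"])
    fix f :: "real \<Rightarrow> real"
    assume "f \<in> range flat_exp"
    then obtain q where f: "f = flat_exp q" by blast
    have d: "(f has_derivative (\<lambda>h. flat_exp (monom 1 2 * (q - pderiv q)) x * h)) (at x)" for x
      unfolding f by (rule flat_exp_has_derivative[unfolded has_field_derivative_def])
    have "dderiv 1 f = flat_exp (monom 1 2 * (q - pderiv q))"
      using dderiv_eqI'[OF d, of 1] by simp
    then show "(\<forall>x. f differentiable at x) \<and> (\<forall>b\<in>Basis. dderiv b f \<in> range flat_exp)"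
      using d unfolding differentiable_def by (metis Basis_real_def rangeI singletonD)
  qed simp
qed

lemma ex_smooth_bump:
  "\<exists>b :: real \<Rightarrow> real. smooth b \<and> (\<forall>t. 0 \<le> b t) \<and> (\<forall>t. t \<le> 1/2 \<or> 1 \<le> t \<longrightarrow> b t = 0) \<and> 0 < b (3/4)"
proof -
  define b where "b t = flat_exp 1 (- (1/2) + 1 * t) * flat_exp 1 (1 + -1 * t)" for t
  have lin: "smooth (\<lambda>t::real. c + d * t)" for c d
    by (intro smooth_mult smooth_add smooth_const smooth_id)
  have "smooth b" unfolding b_def
    by (rule smooth_mult; rule smooth_compose[OF smooth_flat_exp lin])
  moreover have "0 \<le> b t" "t \<le> 1/2 \<or> 1 \<le> t \<longrightarrow> b t = 0" "0 < b (3/4)" for t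
    by (auto simp: b_def flat_exp_def)
  ultimately show ?thesis by blast
qed

lemma ex_antiderivative:
  fixes f :: "real \<Rightarrow> real"
  assumes "continuous_on UNIV f"
  shows "\<exists>F. (\<forall>x. (F has_real_derivative f x) (at x)) \<and> F a = 0"
proof -
  obtain F where F: "\<forall>x. -\<infinity> < ereal x \<longrightarrow> ereal x < \<infinity> \<longrightarrow> (F has_vector_derivative f x) (at x)"
    using einterval_antiderivative[of "-\<infinity>" "\<infinity>" f] assms
    by (auto simp: continuous_on_eq_continuous_at)
  then have "(F has_real_derivative f x) (at x)" for x
    by (simp add: has_real_derivative_iff_has_vector_derivative)
  then have "((\<lambda>x. F x - F a) has_real_derivative f x) (at x)" for x
    by (auto intro!: derivative_eq_intros)
  then show ?thesis by (intro exI[of _ "\<lambda>x. F x - F a"]) auto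
qed

section \<open>Averages over annuli\<close>

lemma lborel_integral_affine:
  fixes f :: "'a::euclidean_space \<Rightarrow> real"
  assumes "c \<noteq> 0" and [measurable]: "f \<in> borel_measurable borel"
  shows "(LINT x|lborel. f x) = \<bar>c\<bar> ^ DIM('a) * (LINT x|lborel. f (t + c *\<^sub>R x))"
proof -
  have "(LINT x|lborel. f x)
      = (LINT x|density (distr lborel borel (\<lambda>x. t + c *\<^sub>R x)) (\<lambda>_. ennreal (\<bar>c\<bar> ^ DIM('a))). f x)"
    using lborel_affine[OF assms(1), of t] by (simp add: ennreal_power)
  also have "\<dots> = (LINT x|distr lborel borel (\<lambda>x. t + c *\<^sub>R x). \<bar>c\<bar> ^ DIM('a) *\<^sub>R f x)"
    by (rule integral_density) auto
  also have "\<dots> = (LINT x|lborel. \<bar>c\<bar> ^ DIM('a) *\<^sub>R f (t + c *\<^sub>R x))"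
    by (rule integral_distr) auto
  finally show ?thesis by simp
qed

lemma borel_measurable_quarter_turn:
  "(\<lambda>y :: real \<times> real. (- snd y, fst y)) \<in> borel_measurable borel"
  by (intro borel_measurable_continuous_onI continuous_intros)

lemma lborel_distr_quarter_turn:
  "distr lborel borel (\<lambda>y :: real \<times> real. (- snd y, fst y)) = lborel"
proof (rule lborel_eqI[symmetric])
  fix l u :: "real \<times> real"
  assume le: "\<And>b. b \<in> Basis \<Longrightarrow> l \<bullet> b \<le> u \<bullet> b"
  have le': "fst l \<le> fst u" "snd l \<le> snd u"
    using le[of "(1, 0)"] le[of "(0, 1)"] by (auto simp: Basis_prod_def inner_prod_def)
  have B: "Basis = {(1, 0), (0, 1) :: real \<times> real}" by (auto simp: Basis_prod_def)
  have eq: "(\<lambda>y :: real \<times> real. (- snd y, fst y)) -` box l u = box (snd l, - fst u) (snd u, - fst l)"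
    by (auto simp: box_def B inner_prod_def)
  have "emeasure (distr lborel borel (\<lambda>y :: real \<times> real. (- snd y, fst y))) (box l u)
      = emeasure lborel (box (snd l, - fst u) (snd u, - fst l))"
    using borel_measurable_quarter_turn by (subst emeasure_distr) (auto simp: eq)
  also have "\<dots> = ennreal (\<Prod>b\<in>Basis. ((snd u, - fst l) - (snd l, - fst u)) \<bullet> b)"
    using le' by (intro emeasure_lborel_box) (auto simp: B inner_prod_def)
  also have "(\<Prod>b\<in>Basis. ((snd u, - fst l) - (snd l, - fst u)) \<bullet> b) = (\<Prod>b\<in>Basis. (u - l) \<bullet> b)"
    by (simp add: B inner_prod_def mult.commute)
  finally show "emeasure (distr lborel borel (\<lambda>y :: real \<times> real. (- snd y, fst y))) (box l u)
      = ennreal (\<Prod>b\<in>Basis. (u - l) \<bullet> b)" .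
qed simp

lemma integral_quarter_turn:
  fixes f :: "real \<times> real \<Rightarrow> real"
  assumes [measurable]: "f \<in> borel_measurable borel"
  shows "(LINT y|lborel. f (- snd y, fst y)) = (LINT y|lborel. f y)"
proof -
  have "(LINT y|lborel. f y) = (LINT y|distr lborel borel (\<lambda>y :: real \<times> real. (- snd y, fst y)). f y)"
    by (simp only: lborel_distr_quarter_turn)
  also have "\<dots> = (LINT y|lborel. f (- snd y, fst y))"
    by (rule integral_distr) (use borel_measurable_quarter_turn in auto)
  finally show ?thesis by simp
qed

lemma integrable_continuous_support:
  fixes f :: "'a::euclidean_space \<Rightarrow> real"
  assumes "continuous_on UNIV f" "\<And>y. y \<notin> cball x d \<Longrightarrow> f y = 0"
  shows "integrable lborel f"
proof -
  have "set_integrable lborel (cball x d) f"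
    unfolding set_integrable_def
    by (intro borel_integrable_compact compact_cball continuous_on_subset[OF assms(1)]) simp
  moreover have "(\<lambda>y. indicat_real (cball x d) y *\<^sub>R f y) = f"
  proof
    show "indicat_real (cball x d) y *\<^sub>R f y = f y" for y
      using assms(2)[of y] by (cases "y \<in> cball x d") auto
  qed
  ultimately show ?thesis by (simp only: set_integrable_def)
qed

lemma integrable_mult_continuous_support:
  fixes u f :: "'a::euclidean_space \<Rightarrow> real"
  assumes u: "set_integrable lborel (cball x d) u" and f: "continuous_on UNIV f"
    and z: "\<And>y. y \<notin> cball x d \<Longrightarrow> f y = 0"
  shows "integrable lborel (\<lambda>y. u y * f y)"
proof -
  have "compact (f ` cball x d)"
    using f continuous_on_subset by (intro compact_continuous_image) auto
  then obtain B where B: "\<And>y. y \<in> cball x d \<Longrightarrow> \<bar>f y\<bar> \<le> B"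
    using compact_imp_bounded bounded_iff by (metis imageI real_norm_def)
  have [measurable]: "f \<in> borel_measurable borel"
    using f by (rule borel_measurable_continuous_onI)
  let ?v = "\<lambda>y. indicat_real (cball x d) y *\<^sub>R u y"
  have v: "integrable lborel ?v" using u by (simp add: set_integrable_def)
  then have [measurable]: "?v \<in> borel_measurable lborel" by simp
  have "integrable lborel (\<lambda>y. ?v y * f y)"
  proof (rule Bochner_Integration.integrable_bound[of _ "\<lambda>y. B * ?v y"])
    show "AE y in lborel. norm (?v y * f y) \<le> norm (B * ?v y)"
    proof (rule AE_I2)
      fix y
      show "norm (?v y * f y) \<le> norm (B * ?v y)"
      proof (cases "y \<in> cball x d")
        case True
        have "\<bar>f y\<bar> * \<bar>u y\<bar> \<le> \<bar>B\<bar> * \<bar>u y\<bar>"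
          using B[OF True] by (intro mult_right_mono) auto
        then show ?thesis using True by (simp add: abs_mult mult.commute)
      qed simp
    qed
  qed (use v in \<open>auto\<close>)
  moreover have "(\<lambda>y. ?v y * f y) = (\<lambda>y. u y * f y)"
  proof
    show "?v y * f y = u y * f y" for y
      using z[of y] by (cases "y \<in> cball x d") auto
  qed
  ultimately show ?thesis by (simp only:)
qed

locale radial_profile =
  fixes b m :: "real \<Rightarrow> real" and M :: real
  assumes smooth_b: "smooth b" and b_nonneg: "0 \<le> b t"
    and b_zero: "t \<le> 1/2 \<or> 1 \<le> t \<Longrightarrow> b t = 0" and b_pos: "0 < b (3/4)"
    and m_deriv: "(m has_real_derivative b t) (at t)"
    and m_left: "t \<le> 1/2 \<Longrightarrow> m t = 0" and m_right: "1 \<le> t \<Longrightarrow> m t = M"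
    and M_pos: "0 < M"

lemma ex_radial_profile: "\<exists>b m M. radial_profile b m M"
proof -
  obtain b :: "real \<Rightarrow> real" where b: "smooth b" "\<And>t. 0 \<le> b t"
      "\<And>t. t \<le> 1/2 \<or> 1 \<le> t \<Longrightarrow> b t = 0" "0 < b (3/4)"
    using ex_smooth_bump by blast
  obtain m where m: "\<And>t. (m has_real_derivative b t) (at t)" "m (1/2) = 0"
    using ex_antiderivative[OF smooth_continuous[OF b(1)], of "1/2"] by blast
  have cont: "continuous_on S m" for S
    using m(1) by (meson DERIV_isCont continuous_at_imp_continuous_on)
  have const: "m t = m s" if "s < t" "\<And>x. s < x \<Longrightarrow> x < t \<Longrightarrow> b x = 0" for s t
    using that m(1) by (intro DERIV_isconst_end[OF that(1) cont]) metis
  have mono: "m s \<le> m t" if "s \<le> t" for s t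
    using that m(1) b(2) by (intro DERIV_nonneg_imp_nondecreasing[of s t m]) auto
  have "m 1 \<noteq> 0"
  proof
    assume "m 1 = 0"
    then have "m t = 0" if "1/2 \<le> t" "t \<le> 1" for t
      using mono[OF that(1)] mono[OF that(2)] m(2) by simp
    then have "m (3/4) = m y" if "\<bar>3/4 - y\<bar> < 1/4" for y
      using that by (auto simp: abs_if split: if_splits)
    then have "b (3/4) = 0"
      using DERIV_local_const[OF m(1)[of "3/4"], of "1/4"] by auto
    then show False using b(4) by simp
  qed
  then have "0 < m 1" using mono[of "1/2" 1] m(2) by simp
  moreover have "m t = 0" if "t \<le> 1/2" for t
  proof (cases "t = 1/2")
    case True
    show ?thesis unfolding True by (rule m(2))
  next
    case False
    then have "m (1/2) = m t" using that b(3) by (intro const) auto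
    then show ?thesis by (simp only: m(2))
  qed
  moreover have "m t = m 1" if "1 \<le> t" for t
    using const[of 1 t] b(3) that by (cases "1 < t") auto
  ultimately have "radial_profile b m (m 1)"
    unfolding radial_profile_def using b m by blast
  then show ?thesis by blast
qed

context radial_profile
begin

definition ker :: "real \<Rightarrow> real \<Rightarrow> real" where
  "ker d s = b (s / d\<^sup>2) / d\<^sup>2"

definition mass :: real where
  "mass = (LINT y|lborel. b ((norm (y :: real \<times> real))\<^sup>2))"

lemma continuous_b: "continuous_on S b"
  using smooth_continuous[OF smooth_b] continuous_on_subset by blast

lemma ker_nonneg: "0 \<le> ker d s"
  by (simp add: ker_def b_nonneg)

lemma ker_nonzero:
  assumes "0 < d" "ker d s \<noteq> 0"
  shows "d\<^sup>2 / 2 \<le> s" "s \<le> d\<^sup>2"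
proof -
  have "\<not> (s / d\<^sup>2 \<le> 1/2 \<or> 1 \<le> s / d\<^sup>2)"
    using assms b_zero[of "s / d\<^sup>2"] by (auto simp: ker_def)
  then show "d\<^sup>2 / 2 \<le> s" "s \<le> d\<^sup>2" using assms(1) by (auto simp: field_simps)
qed

lemma continuous_ker: "continuous_on S f \<Longrightarrow> continuous_on S (\<lambda>y. ker d (f y))"
  unfolding ker_def
  by (cases "d = 0") (auto intro!: continuous_intros continuous_on_compose2[OF continuous_b[of UNIV]])

lemma ker_outside:
  fixes x :: "'a::real_normed_vector"
  assumes "0 < d" "y \<notin> cball x d"
  shows "ker d ((norm (y - x))\<^sup>2) = 0"
proof (rule ccontr)
  assume "ker d ((norm (y - x))\<^sup>2) \<noteq> 0"
  from ker_nonzero(2)[OF assms(1) this] have "norm (y - x) \<le> d"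
    using assms(1) by (simp add: power2_le_iff_abs_le)
  then show False using assms(2) by (simp add: dist_norm norm_minus_commute)
qed

lemma integrable_mult_ker:
  fixes u :: "'a::euclidean_space \<Rightarrow> real"
  assumes "0 < d" "set_integrable lborel (cball x d) u"
  shows "integrable lborel (\<lambda>y. u y * ker d ((norm (y - x))\<^sup>2))"
  using assms
  by (intro integrable_mult_continuous_support[OF assms(2)] continuous_ker ker_outside)
    (auto intro!: continuous_intros)

lemma integrable_continuous_mult_ker:
  fixes u :: "'a::euclidean_space \<Rightarrow> real"
  assumes "0 < d" "continuous_on UNIV u"
  shows "integrable lborel (\<lambda>y. u y * ker d ((norm (y - x))\<^sup>2))"
proof (rule integrable_mult_ker[OF assms(1)])
  show "set_integrable lborel (cball x d) u"
    unfolding set_integrable_def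
    by (intro borel_integrable_compact compact_cball continuous_on_subset[OF assms(2)]) simp
qed

lemma integral_shift:
  fixes f :: "real \<times> real \<Rightarrow> real"
  assumes "f \<in> borel_measurable borel"
  shows "(LINT y|lborel. f y) = (LINT y|lborel. f (x + y))"
  using lborel_integral_affine[of 1 f x] assms by simp

lemma ker_integral:
  fixes x :: "real \<times> real"
  assumes "0 < d"
  shows "(LINT y|lborel. ker d ((norm (y - x))\<^sup>2)) = mass"
proof -
  have meas: "(\<lambda>y :: real \<times> real. ker d ((norm (y - x))\<^sup>2)) \<in> borel_measurable borel"
    by (intro borel_measurable_continuous_onI continuous_ker continuous_intros)
  have "(LINT y|lborel. ker d ((norm (y - x))\<^sup>2))
      = \<bar>d\<bar> ^ DIM(real \<times> real) * (LINT y|lborel. ker d ((norm (x + d *\<^sub>R y - x))\<^sup>2))"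
    by (rule lborel_integral_affine) (use assms meas in auto)
  also have "(\<lambda>y :: real \<times> real. ker d ((norm (x + d *\<^sub>R y - x))\<^sup>2)) = (\<lambda>y. b ((norm y)\<^sup>2) / d\<^sup>2)"
    using assms by (auto simp: ker_def power_mult_distrib)
  finally show ?thesis using assms by (simp add: mass_def power2_eq_square)
qed

lemma mass_pos: "0 < mass"
proof -
  let ?f = "\<lambda>y :: real \<times> real. b ((norm y)\<^sup>2)"
  have cont: "continuous_on UNIV ?f"
    by (intro continuous_on_compose2[OF continuous_b[of UNIV]] continuous_intros) auto
  have int: "integrable lborel ?f"
  proof (rule integrable_continuous_support[OF cont])
    fix y :: "real \<times> real" assume "y \<notin> cball 0 1"
    then have "1 \<le> (norm y)\<^sup>2" by (simp add: one_le_power)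
    then show "b ((norm y)\<^sup>2) = 0" using b_zero by simp
  qed
  have "0 \<le> mass" unfolding mass_def by (intro integral_nonneg_AE) (simp add: b_nonneg)
  moreover have "mass \<noteq> 0"
  proof
    assume "mass = 0"
    then have "AE y in lborel. ?f y = 0"
      using integral_nonneg_eq_0_iff_AE[OF int] b_nonneg by (simp add: mass_def)
    then have ae: "AE y in lborel. y \<notin> {y. ?f y \<noteq> 0}" by simp
    have op: "open {y. ?f y \<noteq> 0}"
      using open_Collect_neq[OF cont continuous_on_const] by simp
    have "{y. ?f y \<noteq> 0} \<in> null_sets lborel"
      using AE_iff_null_sets[of "{y. ?f y \<noteq> 0}" lborel] ae op by simp
    then have "negligible {y. ?f y \<noteq> 0}"
      unfolding negligible_iff_null_sets by (rule null_sets_completionI)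
    then have "{y. ?f y \<noteq> 0} = {}"
      using open_not_negligible[OF op] by metis
    moreover have "(sqrt (3/4), 0) \<in> {y. ?f y \<noteq> 0}"
      using b_pos by (simp add: norm_prod_def)
    ultimately show False by blast
  qed
  ultimately show ?thesis by simp
qed

lemma quadratic_integrals_zero:
  fixes \<alpha> \<beta> \<gamma> \<delta> :: real
  assumes d: "0 < d"
  shows "(LINT y|lborel. (\<alpha> * fst y + \<beta> * snd y + \<gamma> * ((fst y)\<^sup>2 - (snd y)\<^sup>2) + \<delta> * (fst y * snd y))
           * ker d ((norm (y :: real \<times> real))\<^sup>2)) = 0"
proof -
  define k where "k = (\<lambda>y :: real \<times> real. ker d ((norm y)\<^sup>2))"
  have ck: "continuous_on UNIV k" unfolding k_def by (intro continuous_ker continuous_intros)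
  have kJ: "k (- snd y, fst y) = k y" for y by (simp add: k_def norm_prod_def add.commute)
  define L Q where "L = (\<lambda>y :: real \<times> real. \<alpha> * fst y + \<beta> * snd y)"
    and "Q = (\<lambda>y :: real \<times> real. \<gamma> * ((fst y)\<^sup>2 - (snd y)\<^sup>2) + \<delta> * (fst y * snd y))"
  have cL: "continuous_on UNIV L" and cQ: "continuous_on UNIV Q"
    unfolding L_def Q_def by (auto intro!: continuous_intros)
  have mL: "(\<lambda>y. L y * k y) \<in> borel_measurable borel" and mQ: "(\<lambda>y. Q y * k y) \<in> borel_measurable borel"
    using cL cQ ck by (auto intro!: borel_measurable_continuous_onI continuous_intros)
  have mL': "(\<lambda>y. L (- snd y, fst y) * k y) \<in> borel_measurable borel"
    unfolding L_def using ck by (auto intro!: borel_measurable_continuous_onI continuous_intros)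
  have "(LINT y|lborel. Q y * k y) = (LINT y|lborel. Q (- snd y, fst y) * k (- snd y, fst y))"
    using integral_quarter_turn[OF mQ] by simp
  also have "\<dots> = (LINT y|lborel. - (Q y * k y))"
    by (rule Bochner_Integration.integral_cong) (auto simp: kJ, simp add: Q_def algebra_simps)
  finally have Q0: "(LINT y|lborel. Q y * k y) = 0" by simp
  have "(LINT y|lborel. L y * k y) = (LINT y|lborel. L (- snd y, fst y) * k y)"
    using integral_quarter_turn[OF mL] by (simp add: kJ)
  also have "\<dots> = (LINT y|lborel. L (- fst y, - snd y) * k (- snd y, fst y))"
    using integral_quarter_turn[OF mL'] by simp
  also have "\<dots> = (LINT y|lborel. - (L y * k y))"
    by (rule Bochner_Integration.integral_cong) (auto simp: kJ, simp add: L_def algebra_simps)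
  finally have L0: "(LINT y|lborel. L y * k y) = 0" by simp
  have iL: "integrable lborel (\<lambda>y. L y * k y)" and iQ: "integrable lborel (\<lambda>y. Q y * k y)"
    using integrable_continuous_mult_ker[OF d cL, of 0] integrable_continuous_mult_ker[OF d cQ, of 0]
    by (simp_all add: k_def)
  have "(LINT y|lborel. (\<alpha> * fst y + \<beta> * snd y + \<gamma> * ((fst y)\<^sup>2 - (snd y)\<^sup>2) + \<delta> * (fst y * snd y)) * ker d ((norm y)\<^sup>2))
      = (LINT y|lborel. L y * k y + Q y * k y)"
    by (rule Bochner_Integration.integral_cong) (auto simp: L_def Q_def k_def algebra_simps)
  also have "\<dots> = 0" using iL iQ L0 Q0 by simp
  finally show ?thesis .
qed

definition mean_value :: "(real \<times> real \<Rightarrow> real) \<Rightarrow> real \<times> real \<Rightarrow> bool" where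
  "mean_value u x \<longleftrightarrow> (\<exists>r>0. \<forall>d. 0 < d \<and> d < r \<longrightarrow>
     integrable lborel (\<lambda>y. u y * ker d ((norm (y - x))\<^sup>2)) \<and>
     mass * u x = (LINT y|lborel. u y * ker d ((norm (y - x))\<^sup>2)))"

lemma mean_value_uminus: "mean_value u x \<Longrightarrow> mean_value (\<lambda>y. - u y) x"
  unfolding mean_value_def by simp

text \<open>
  The kernel lives on an annulus, so it sees the term \<open>- \<kappa> (norm y)\<^sup>2\<close> at the order \<open>d\<^sup>2\<close>,
  which beats the cubic remainder.
\<close>

lemma no_touching:
  fixes u W :: "real \<times> real \<Rightarrow> real"
  assumes mv: "mean_value u x" and \<kappa>: "0 < \<kappa>" and r: "0 < r"
    and le: "\<And>y. dist y x < r \<Longrightarrow> u y - W y + \<kappa> * (norm y)\<^sup>2 \<le> u x - W x + \<kappa> * (norm x)\<^sup>2"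
    and W: "\<And>h. norm h < r \<Longrightarrow> \<bar>W (x + h) - W x - (\<alpha> * fst h + \<beta> * snd h
        + \<gamma> * ((fst h)\<^sup>2 - (snd h)\<^sup>2) + \<delta> * (fst h * snd h))\<bar> \<le> C * norm h ^ 3"
  shows False
proof -
  obtain r' where r': "0 < r'" "\<And>d. 0 < d \<Longrightarrow> d < r' \<Longrightarrow>
      integrable lborel (\<lambda>y. u y * ker d ((norm (y - x))\<^sup>2)) \<and>
      mass * u x = (LINT y|lborel. u y * ker d ((norm (y - x))\<^sup>2))"
    using mv unfolding mean_value_def by blast
  define C' where "C' = \<bar>C\<bar> + 1"
  define d where "d = Min {r / 2, r' / 2, \<kappa> / (4 * C')}"
  have C': "0 < C'" "C \<le> C'" by (auto simp: C'_def)
  have d: "0 < d" "d < r" "d < r'" "d \<le> \<kappa> / (4 * C')"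
    using r r' \<kappa> C' by (auto simp: d_def min_less_iff_disj)
  define P where "P = (\<lambda>h :: real \<times> real. (\<alpha> - 2 * \<kappa> * fst x) * fst h + (\<beta> - 2 * \<kappa> * snd x) * snd h
        + \<gamma> * ((fst h)\<^sup>2 - (snd h)\<^sup>2) + \<delta> * (fst h * snd h))"
  define k where "k = (\<lambda>h :: real \<times> real. ker d ((norm h)\<^sup>2))"
  have contP: "continuous_on UNIV P" unfolding P_def by (intro continuous_intros)
  define E where "E = C' * d ^ 3 - \<kappa> * d\<^sup>2 / 2"
  have up: "u (x + h) * k h \<le> (u x + E) * k h + P h * k h" for h
  proof (cases "k h = 0")
    case False
    then have h: "d\<^sup>2 / 2 \<le> (norm h)\<^sup>2" "(norm h)\<^sup>2 \<le> d\<^sup>2"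
      using ker_nonzero[OF d(1)] by (auto simp: k_def)
    then have nd: "norm h \<le> d" using d(1) by (simp add: power2_le_iff_abs_le)
    then have nr: "norm h < r" using d(2) by simp
    have sq: "(norm (x + h))\<^sup>2 = (norm x)\<^sup>2 + 2 * (fst x * fst h + snd x * snd h) + (norm h)\<^sup>2"
      unfolding power2_norm_eq_inner by (simp add: inner_prod_def algebra_simps)
    have "C * norm h ^ 3 \<le> C' * d ^ 3"
      using C' nd by (intro mult_mono power_mono) auto
    moreover have "\<kappa> * (d\<^sup>2 / 2) \<le> \<kappa> * (norm h)\<^sup>2" using h(1) \<kappa> by (intro mult_left_mono) auto
    moreover have "u (x + h) - W (x + h) + \<kappa> * (norm (x + h))\<^sup>2 \<le> u x - W x + \<kappa> * (norm x)\<^sup>2"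
      using le[of "x + h"] nr by (simp add: dist_norm)
    moreover have "W (x + h) - W x \<le> \<alpha> * fst h + \<beta> * snd h
        + \<gamma> * ((fst h)\<^sup>2 - (snd h)\<^sup>2) + \<delta> * (fst h * snd h) + C * norm h ^ 3"
      using W[OF nr] by linarith
    ultimately have "u (x + h) \<le> u x + E + P h"
      unfolding sq E_def P_def by (simp add: algebra_simps)
    then have "u (x + h) * k h \<le> (u x + E + P h) * k h"
      using ker_nonneg by (intro mult_right_mono) (auto simp: k_def)
    then show ?thesis by (simp add: algebra_simps)
  qed simp
  have iu: "integrable lborel (\<lambda>y. u y * ker d ((norm (y - x))\<^sup>2))"
    and mu: "mass * u x = (LINT y|lborel. u y * ker d ((norm (y - x))\<^sup>2))"
    using r'(2)[OF d(1,3)] by auto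
  have meas: "(\<lambda>y. u y * ker d ((norm (y - x))\<^sup>2)) \<in> borel_measurable borel"
    using iu by (auto dest: borel_measurable_integrable)
  have iu': "integrable lborel (\<lambda>h. u (x + h) * k h)"
  proof -
    have "integrable (distr lborel borel ((+) x)) (\<lambda>y. u y * ker d ((norm (y - x))\<^sup>2))"
      unfolding lborel_distr_plus by (rule iu)
    then have "integrable lborel (\<lambda>h. u (x + h) * ker d ((norm (x + h - x))\<^sup>2))"
      by (subst (asm) integrable_distr_eq) (use meas in auto)
    then show ?thesis by (simp add: k_def)
  qed
  have mu': "mass * u x = (LINT h|lborel. u (x + h) * k h)"
    using mu integral_shift[OF meas, of x] by (simp add: k_def)
  have ik: "integrable lborel (\<lambda>h. (u x + E) * k h)" and iP: "integrable lborel (\<lambda>h. P h * k h)"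
    using integrable_continuous_mult_ker[OF d(1) continuous_on_const, of "u x + E" 0]
      integrable_continuous_mult_ker[OF d(1) contP, of 0] by (simp_all add: k_def)
  have "mass * u x \<le> (LINT h|lborel. (u x + E) * k h + P h * k h)"
    unfolding mu' using up iu' ik iP by (intro integral_mono) auto
  also have "\<dots> = (LINT h|lborel. (u x + E) * k h) + (LINT h|lborel. P h * k h)"
    using ik iP by simp
  also have "(LINT h|lborel. P h * k h) = 0"
    unfolding P_def k_def by (rule quadratic_integrals_zero[OF d(1)])
  also have "(LINT h|lborel. (u x + E) * k h) = (u x + E) * mass"
    using ker_integral[OF d(1), of 0] by (simp add: k_def)
  finally have "0 \<le> mass * E" by (simp add: algebra_simps)
  then have "0 \<le> E" using mass_pos by (simp add: zero_le_mult_iff)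
  moreover have "C' * d ^ 3 \<le> \<kappa> / 4 * d\<^sup>2"
  proof -
    have "C' * d \<le> \<kappa> / 4" using d(4) C' by (simp add: field_simps)
    then have "C' * d * d\<^sup>2 \<le> \<kappa> / 4 * d\<^sup>2" by (intro mult_right_mono) auto
    then show ?thesis by (simp add: power2_eq_square power3_eq_cube mult.assoc)
  qed
  moreover have "0 < \<kappa> * d\<^sup>2" using \<kappa> d(1) by simp
  ultimately show False by (simp add: E_def)
qed

end

section \<open>Averages of weak solutions\<close>

lemma Basis_real_prod: "Basis = {(1, 0), (0, 1) :: real \<times> real}"
  by (auto simp: Basis_prod_def)

lemma smooth_norm_square: "smooth (\<lambda>y :: real \<times> real. (norm (y - x))\<^sup>2)"
proof -
  have s: "smooth (\<lambda>y :: real \<times> real. inner y v - c)" for v c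
    by (rule smooth_diff[OF smooth_inner smooth_const])
  have "(\<lambda>y :: real \<times> real. (norm (y - x))\<^sup>2)
      = (\<lambda>y. (inner y (1, 0) - fst x) * (inner y (1, 0) - fst x)
          + (inner y (0, 1) - snd x) * (inner y (0, 1) - snd x))"
    unfolding power2_norm_eq_inner by (auto simp: inner_prod_def)
  then show ?thesis by (simp only:) (intro smooth_add smooth_mult s)
qed

context radial_profile
begin

lemma m_scaled_deriv:
  assumes "0 < d"
  shows "((\<lambda>s. m (s / d\<^sup>2)) has_real_derivative ker d s) (at s)"
proof -
  have "((\<lambda>s. s / d\<^sup>2) has_real_derivative 1 / d\<^sup>2) (at s)"
    by (intro DERIV_cdivide DERIV_ident)
  from DERIV_chain2[OF m_deriv this] show ?thesis by (simp add: ker_def)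
qed

lemma smooth_m_scaled:
  assumes "0 < d"
  shows "smooth (\<lambda>s. m (s / d\<^sup>2))"
proof -
  have "smooth (\<lambda>s::real. s * (1 / d\<^sup>2))" by (intro smooth_mult smooth_id smooth_const)
  then have "smooth (\<lambda>s. m (s * (1 / d\<^sup>2)))"
    by (rule smooth_compose[OF smooth_realI[OF m_deriv smooth_b]])
  then show ?thesis by simp
qed

text \<open>
  The Laplacian of \<open>G ((norm (y - x))\<^sup>2)\<close> is \<open>4 (s G')'\<close> at \<open>s = (norm (y - x))\<^sup>2\<close>, so \<open>4 s G' = m (s / d\<^sup>2) - m (s / d'\<^sup>2)\<close>
  produces the difference of the two kernels.
\<close>

lemma ex_radial_test_function:
  assumes d: "0 < d'" "d' \<le> d"
  shows "\<exists>G \<gamma>. smooth G \<and> smooth \<gamma> \<and> (\<forall>s. (G has_real_derivative \<gamma> s) (at s)) \<and>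
    (\<forall>s\<ge>d\<^sup>2. G s = 0) \<and> (\<forall>s. 4 * s * \<gamma> s = m (s / d\<^sup>2) - m (s / d'\<^sup>2))"
proof -
  define f where "f = (\<lambda>s. (m (s / d\<^sup>2) - m (s / d'\<^sup>2)) * (1/4))"
  have d0: "0 < d" using d by simp
  have le: "d'\<^sup>2 \<le> d\<^sup>2" using d by (intro power_mono) auto
  have sf: "smooth f" unfolding f_def
    by (intro smooth_mult smooth_diff smooth_m_scaled smooth_const d d0)
  have f0: "f s = 0" if "s \<le> d'\<^sup>2 / 2" for s
  proof -
    have "s \<le> d\<^sup>2 / 2" using that le by linarith
    then have "s / d\<^sup>2 \<le> 1/2" "s / d'\<^sup>2 \<le> 1/2" using that d d0 by (simp_all add: field_simps)
    then show ?thesis by (simp add: f_def m_left)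
  qed
  define \<gamma> where "\<gamma> = (\<lambda>s. f s / s)"
  have s\<gamma>: "smooth \<gamma>" unfolding \<gamma>_def
    by (rule smooth_divide_id[OF sf, of "d'\<^sup>2 / 2"]) (use d f0 in auto)
  obtain G where G: "\<And>s. (G has_real_derivative \<gamma> s) (at s)" "G (d\<^sup>2) = 0"
    using ex_antiderivative[OF smooth_continuous[OF s\<gamma>], of "d\<^sup>2"] by blast
  have \<gamma>0: "\<gamma> s = 0" if "d\<^sup>2 \<le> s" for s
  proof -
    have "d'\<^sup>2 \<le> s" using that le by linarith
    then have "1 \<le> s / d\<^sup>2" "1 \<le> s / d'\<^sup>2" using that d d0 by (simp_all add: field_simps)
    then show ?thesis by (simp add: \<gamma>_def f_def m_right)
  qed
  have G0: "G s = 0" if "d\<^sup>2 \<le> s" for s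
  proof (cases "d\<^sup>2 < s")
    case True
    have "continuous_on {d\<^sup>2..s} G"
      using G(1) by (meson DERIV_isCont continuous_at_imp_continuous_on)
    then have "G s = G (d\<^sup>2)"
      using True G(1) \<gamma>0 by (intro DERIV_isconst_end) (auto, metis less_eq_real_def)
    then show ?thesis by (simp only: G(2))
  qed (use that G(2) in auto)
  have "4 * s * \<gamma> s = m (s / d\<^sup>2) - m (s / d'\<^sup>2)" for s
  proof (cases "s = 0")
    case True
    then show ?thesis by simp
  next
    case False
    then have "4 * s * \<gamma> s = 4 * f s" by (simp add: \<gamma>_def)
    then show ?thesis by (simp add: f_def)
  qed
  then show ?thesis using smooth_realI[OF G(1) s\<gamma>] s\<gamma> G(1) G0 by blast
qed

lemma weak_identity:
  fixes u :: "real \<times> real \<Rightarrow> real"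
  assumes li: "locally_integrable_on u \<Omega>"
    and eq: "distr_eq \<Omega> (distr_laplacian (distr_of \<Omega> u)) (distr_dderiv a (dirac p))"
    and cb: "cball x d \<subseteq> \<Omega>" and d: "0 < d'" "d' \<le> d" and px: "p \<noteq> x"
  shows "(LINT y|lborel. u y * ker d ((norm (y - x))\<^sup>2)) - (LINT y|lborel. u y * ker d' ((norm (y - x))\<^sup>2))
    = - (a \<bullet> (p - x)) * (m ((norm (p - x))\<^sup>2 / d\<^sup>2) - m ((norm (p - x))\<^sup>2 / d'\<^sup>2)) / (2 * (norm (p - x))\<^sup>2)"
proof -
  obtain G \<gamma> where G: "smooth G" "smooth \<gamma>" "\<And>s. (G has_real_derivative \<gamma> s) (at s)"
      "\<And>s. d\<^sup>2 \<le> s \<Longrightarrow> G s = 0" "\<And>s. 4 * s * \<gamma> s = m (s / d\<^sup>2) - m (s / d'\<^sup>2)"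
    using ex_radial_test_function[OF d] by blast
  have d0: "0 < d" using d by simp
  have le: "d'\<^sup>2 \<le> d\<^sup>2" using d by (intro power_mono) auto
  define \<gamma>' where "\<gamma>' = dderiv 1 \<gamma>"
  have \<gamma>': "(\<gamma> has_real_derivative \<gamma>' s) (at s)" for s
    unfolding \<gamma>'_def by (rule smooth_has_real_derivative[OF G(2)])
  have id': "4 * \<gamma> s + 4 * s * \<gamma>' s = ker d s - ker d' s" for s
  proof (rule DERIV_unique)
    show "((\<lambda>s. m (s / d\<^sup>2) - m (s / d'\<^sup>2)) has_real_derivative ker d s - ker d' s) (at s)"
      by (intro DERIV_diff m_scaled_deriv d d0)
    have "((\<lambda>s. 4 * s * \<gamma> s) has_real_derivative 4 * \<gamma> s + 4 * s * \<gamma>' s) (at s)"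
      by (auto intro!: derivative_eq_intros \<gamma>')
    then show "((\<lambda>s. m (s / d\<^sup>2) - m (s / d'\<^sup>2)) has_real_derivative 4 * \<gamma> s + 4 * s * \<gamma>' s) (at s)"
      unfolding G(5) .
  qed
  define q where "q = (\<lambda>y :: real \<times> real. (norm (y - x))\<^sup>2)"
  define \<psi> where "\<psi> = (\<lambda>y. G (q y))"
  have qd: "(q has_derivative (\<lambda>h. 2 * (h \<bullet> (y - x)))) (at y)" for y
    unfolding q_def power2_norm_eq_inner
    by (auto intro!: derivative_eq_intros simp: inner_commute)
  have comp: "((\<lambda>y. f (q y)) has_derivative (\<lambda>h. f' * (2 * (h \<bullet> (y - x))))) (at y)"
    if "(f has_real_derivative f') (at (q y))" for f f' y
    using has_derivative_compose[OF qd that[unfolded has_field_derivative_def]] .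
  have D1: "dderiv h \<psi> = (\<lambda>y. \<gamma> (q y) * (2 * (h \<bullet> (y - x))))" for h
    unfolding \<psi>_def by (rule dderiv_eqI'[OF comp[OF G(3)]])
  have D2: "dderiv h (dderiv h \<psi>) = (\<lambda>y. 2 * (h \<bullet> h) * \<gamma> (q y) + 4 * (h \<bullet> (y - x))\<^sup>2 * \<gamma>' (q y))" for h
  proof -
    have "((\<lambda>y. \<gamma> (q y) * (2 * (h \<bullet> (y - x)))) has_derivative
        (\<lambda>v. \<gamma> (q y) * (2 * (h \<bullet> v)) + (\<gamma>' (q y) * (2 * (v \<bullet> (y - x)))) * (2 * (h \<bullet> (y - x))))) (at y)" for y
      by (rule has_derivative_mult[OF comp[OF \<gamma>']]) (auto intro!: derivative_eq_intros)
    from dderiv_eqI'[OF this, of h]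
    show ?thesis unfolding D1 by (simp add: power2_eq_square mult_ac)
  qed
  have s\<psi>: "smooth \<psi>" unfolding \<psi>_def q_def by (rule smooth_compose[OF G(1) smooth_norm_square])
  have out: "d\<^sup>2 < q y" if "y \<notin> cball x d" for y
    using that d0 by (auto simp: q_def dist_norm norm_minus_commute intro!: power_strict_mono)
  have sub: "closure {y. \<psi> y \<noteq> 0} \<subseteq> cball x d"
  proof (rule closure_minimal)
    show "{y. \<psi> y \<noteq> 0} \<subseteq> cball x d"
      using out G(4) unfolding \<psi>_def by (metis (mono_tags, lifting) less_imp_le mem_Collect_eq subsetI)
  qed simp
  have test: "test_function \<Omega> \<psi>"
    unfolding test_function_def
  proof (intro conjI)
    show "\<forall>k. C_k k \<psi>" using s\<psi> unfolding smooth_def .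
    show "compact (closure {y. \<psi> y \<noteq> 0})"
      using sub by (meson bounded_cball bounded_subset closed_closure compact_eq_bounded_closed)
    show "closure {y. \<psi> y \<noteq> 0} \<subseteq> \<Omega>" using sub cb by simp
  qed
  define \<phi> where "\<phi> = (\<lambda>h. dderiv h (dderiv h \<psi>))"
  have \<phi>0: "\<phi> h y = 0" if "y \<notin> cball x d" for h y
  proof -
    have s: "d\<^sup>2 < q y" using out[OF that] .
    then have s': "0 < q y" using d0 by (meson less_trans zero_less_power)
    have "d'\<^sup>2 \<le> q y" using s le by linarith
    then have "1 \<le> q y / d\<^sup>2" "1 \<le> q y / d'\<^sup>2" using s d d0 by (simp_all add: field_simps)
    then have "4 * q y * \<gamma> (q y) = 0" unfolding G(5) by (simp add: m_right)
    then have g: "\<gamma> (q y) = 0" using s' by simp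
    have "ker d (q y) = 0" "ker d' (q y) = 0"
      using ker_nonzero(2)[OF d0, of "q y"] ker_nonzero(2)[OF d(1), of "q y"] s le by linarith+
    then have "4 * q y * \<gamma>' (q y) = 0" using id'[of "q y"] g by simp
    then have "\<gamma>' (q y) = 0" using s' by simp
    then show ?thesis by (simp add: \<phi>_def D2 g)
  qed
  have c\<phi>: "continuous_on UNIV (\<phi> h)" if "h \<in> Basis" for h
    unfolding \<phi>_def by (intro smooth_continuous smooth_dderiv s\<psi> that)
  have iu: "set_integrable lborel (cball x d) u"
    using li cb by (simp add: locally_integrable_on_def)
  have int: "integrable lborel (\<lambda>y. u y * \<phi> h y)" if "h \<in> Basis" for h
    by (rule integrable_mult_continuous_support[OF iu c\<phi>[OF that] \<phi>0])
  have ind: "distr_of \<Omega> u (\<phi> h) = (LINT y|lborel. u y * \<phi> h y)" for h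
    unfolding distr_of_def set_lebesgue_integral_def
  proof (rule Bochner_Integration.integral_cong[OF refl])
    show "indicat_real \<Omega> y *\<^sub>R (u y * \<phi> h y) = u y * \<phi> h y" for y
      using \<phi>0[of y h] cb by (cases "y \<in> cball x d") auto
  qed
  have "distr_laplacian (distr_of \<Omega> u) \<psi> = distr_dderiv a (dirac p) \<psi>"
    using eq test unfolding distr_eq_def by blast
  then have "(\<Sum>h\<in>Basis. distr_of \<Omega> u (\<phi> h)) = - dderiv a \<psi> p"
    by (simp add: distr_laplacian_def distr_dderiv_def dirac_def \<phi>_def)
  moreover have "(\<Sum>h\<in>Basis. distr_of \<Omega> u (\<phi> h)) = (LINT y|lborel. u y * \<phi> (1, 0) y + u y * \<phi> (0, 1) y)"
    unfolding ind using int[of "(1, 0)"] int[of "(0, 1)"] by (simp add: Basis_real_prod)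
  moreover have "\<dots> = (LINT y|lborel. u y * ker d (q y) - u y * ker d' (q y))"
  proof (rule Bochner_Integration.integral_cong[OF refl])
    fix y
    have qy: "q y = (fst (y - x))\<^sup>2 + (snd (y - x))\<^sup>2"
      unfolding q_def power2_norm_eq_inner by (simp add: inner_prod_def power2_eq_square)
    have "\<phi> (1, 0) y + \<phi> (0, 1) y = 4 * \<gamma> (q y) + 4 * ((fst (y - x))\<^sup>2 + (snd (y - x))\<^sup>2) * \<gamma>' (q y)"
      by (simp add: \<phi>_def D2 inner_prod_def algebra_simps)
    also have "\<dots> = ker d (q y) - ker d' (q y)" using id'[of "q y"] unfolding qy[symmetric] .
    finally show "u y * \<phi> (1, 0) y + u y * \<phi> (0, 1) y = u y * ker d (q y) - u y * ker d' (q y)"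
      by (metis distrib_left right_diff_distrib)
  qed
  moreover have "\<dots> = (LINT y|lborel. u y * ker d (q y)) - (LINT y|lborel. u y * ker d' (q y))"
  proof (rule Bochner_Integration.integral_diff)
    show "integrable lborel (\<lambda>y. u y * ker d (q y))"
      unfolding q_def by (rule integrable_mult_ker[OF d0 iu])
    have "set_integrable lborel (cball x d') u"
      by (rule set_integrable_subset[OF iu]) (use d in \<open>auto simp: cball_subset_cball_iff\<close>)
    then show "integrable lborel (\<lambda>y. u y * ker d' (q y))"
      unfolding q_def by (rule integrable_mult_ker[OF d(1)])
  qed
  ultimately have "(LINT y|lborel. u y * ker d (q y)) - (LINT y|lborel. u y * ker d' (q y))
      = - (\<gamma> (q p) * (2 * (a \<bullet> (p - x))))"
    unfolding D1 by linarith
  also have "\<dots> = - (a \<bullet> (p - x)) * (4 * q p * \<gamma> (q p)) / (2 * q p)"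
    using px by (simp add: q_def)
  finally show ?thesis unfolding G(5) unfolding q_def .
qed

lemma representation:
  fixes u :: "real \<times> real \<Rightarrow> real"
  assumes li: "locally_integrable_on u \<Omega>"
    and eq: "distr_eq \<Omega> (distr_laplacian (distr_of \<Omega> u)) (distr_dderiv a (dirac p))"
    and cb: "cball x d \<subseteq> \<Omega>" and d: "0 < d" and px: "p \<noteq> x" and cont: "isCont u x"
  shows "mass * u x = (LINT y|lborel. u y * ker d ((norm (y - x))\<^sup>2))
    + (a \<bullet> (x - p)) * (M - m ((norm (x - p))\<^sup>2 / d\<^sup>2)) / (2 * (norm (x - p))\<^sup>2)" (is "_ = ?R")
proof (rule ccontr)
  assume ne: "mass * u x \<noteq> ?R"
  define e where "e = \<bar>?R - mass * u x\<bar> / (2 * mass)"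
  have e: "0 < e" using ne mass_pos by (simp add: e_def)
  obtain r where r: "0 < r" "\<And>y. dist y x < r \<Longrightarrow> dist (u y) (u x) < e"
    using cont e unfolding continuous_at_eps_delta by blast
  define \<delta> where "\<delta> = Min {d, r / 2, norm (x - p)}"
  have \<delta>: "0 < \<delta>" "\<delta> \<le> d" "\<delta> < r" "\<delta> \<le> norm (x - p)"
    using d r px by (auto simp: \<delta>_def min_less_iff_disj)
  let ?K = "\<lambda>y. ker \<delta> ((norm (y - x))\<^sup>2)"
  have "1 \<le> (norm (x - p))\<^sup>2 / \<delta>\<^sup>2" using \<delta> by (simp add: power_mono)
  then have mM: "m ((norm (x - p))\<^sup>2 / \<delta>\<^sup>2) = M" by (rule m_right)
  have sgn: "- (a \<bullet> (p - x)) * (t - M) / c = - ((a \<bullet> (x - p)) * (M - t) / c)" for t c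
    by (simp add: inner_diff_right algebra_simps minus_divide_left[symmetric] del: minus_divide_left)
      (simp add: algebra_simps diff_divide_distrib add_divide_distrib)
  have IR: "(LINT y|lborel. u y * ?K y) = ?R"
    using weak_identity[OF li eq cb \<delta>(1,2) px]
    unfolding norm_minus_commute[of p x] mM sgn by linarith
  have iu: "set_integrable lborel (cball x \<delta>) u"
  proof -
    have "cball x \<delta> \<subseteq> \<Omega>" using cb \<delta>(2) by (meson order_trans subset_cball)
    then show ?thesis using li by (simp add: locally_integrable_on_def)
  qed
  have i1: "integrable lborel (\<lambda>y. u y * ?K y)" by (rule integrable_mult_ker[OF \<delta>(1) iu])
  have i2: "integrable lborel (\<lambda>y. c * ?K y)" for c
    by (rule integrable_continuous_mult_ker[OF \<delta>(1) continuous_on_const])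
  have bd: "\<bar>u y * ?K y - u x * ?K y\<bar> \<le> e * ?K y" for y
  proof (cases "?K y = 0")
    case False
    then have "(norm (y - x))\<^sup>2 \<le> \<delta>\<^sup>2" using ker_nonzero(2)[OF \<delta>(1)] by blast
    then have "norm (y - x) \<le> \<delta>" using \<delta>(1) by (simp add: power2_le_iff_abs_le)
    then have "\<bar>u y - u x\<bar> \<le> e" using r(2)[of y] \<delta>(3) by (simp add: dist_norm)
    then have "\<bar>u y - u x\<bar> * ?K y \<le> e * ?K y" by (intro mult_right_mono ker_nonneg)
    then show ?thesis by (simp add: left_diff_distrib[symmetric] abs_mult ker_nonneg)
  qed simp
  have "\<bar>(LINT y|lborel. u y * ?K y) - mass * u x\<bar> = \<bar>LINT y|lborel. u y * ?K y - u x * ?K y\<bar>"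
    using i1 i2[of "u x"] ker_integral[OF \<delta>(1), of x] by (simp add: mult.commute)
  also have "\<dots> \<le> (LINT y|lborel. e * ?K y)"
    by (rule order_trans[OF integral_abs_bound integral_mono]) (use i1 i2 bd in auto)
  also have "\<dots> = e * mass" using ker_integral[OF \<delta>(1), of x] by simp
  also have "\<dots> = \<bar>?R - mass * u x\<bar> / 2" using mass_pos by (simp add: e_def)
  finally have "\<bar>?R - mass * u x\<bar> \<le> \<bar>?R - mass * u x\<bar> / 2" unfolding IR .
  moreover have "t = 0" if "\<bar>t\<bar> \<le> \<bar>t\<bar> / 2" for t :: real using that by linarith
  ultimately have "?R - mass * u x = 0" by blast
  then show False using ne by simp
qed

lemma mean_value_solution:
  fixes u :: "real \<times> real \<Rightarrow> real"
  assumes li: "locally_integrable_on u \<Omega>"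
    and eq: "distr_eq \<Omega> (distr_laplacian (distr_of \<Omega> u)) (distr_dderiv a (dirac p))"
    and \<Omega>: "open \<Omega>" "x \<in> \<Omega>" and px: "p \<noteq> x" and cont: "isCont u x"
  shows "mean_value u x"
proof -
  obtain r where r: "0 < r" "cball x r \<subseteq> \<Omega>" using \<Omega> open_contains_cball by blast
  show ?thesis unfolding mean_value_def
  proof (intro exI[of _ "min r (norm (x - p))"] conjI allI impI)
    show "0 < min r (norm (x - p))" using r px by simp
    fix d assume d: "0 < d \<and> d < min r (norm (x - p))"
    have cb: "cball x d \<subseteq> \<Omega>" using r d by (meson less_imp_le min_less_iff_conj order_trans subset_cball)
    then have iu: "set_integrable lborel (cball x d) u" using li by (simp add: locally_integrable_on_def)
    show "integrable lborel (\<lambda>y. u y * ker d ((norm (y - x))\<^sup>2))"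
      using d by (intro integrable_mult_ker iu) auto
    have "1 \<le> (norm (x - p))\<^sup>2 / d\<^sup>2" using d by (simp add: power_mono)
    then show "mass * u x = (LINT y|lborel. u y * ker d ((norm (y - x))\<^sup>2))"
      using representation[OF li eq cb _ px cont] d by (simp add: m_right)
  qed
qed

lemma singular_part:
  fixes u :: "real \<times> real \<Rightarrow> real"
  assumes li: "locally_integrable_on u \<Omega>"
    and eq: "distr_eq \<Omega> (distr_laplacian (distr_of \<Omega> u)) (distr_dderiv a (dirac p))"
    and \<Omega>: "open \<Omega>" "p \<in> \<Omega>" and cont: "\<And>x. x \<in> \<Omega> \<Longrightarrow> x \<noteq> p \<Longrightarrow> isCont u x"
  shows "\<exists>r>0. \<exists>B. \<forall>x. 0 < dist x p \<and> dist x p < r \<longrightarrow>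
    \<bar>u x - M / (2 * mass) * (a \<bullet> (x - p)) / (norm (x - p))\<^sup>2\<bar> \<le> B"
proof -
  obtain R where R: "0 < R" "cball p R \<subseteq> \<Omega>" using \<Omega> open_contains_cball by blast
  define d where "d = R / 2"
  have d: "0 < d" using R by (simp add: d_def)
  have ip: "set_integrable lborel (cball p R) u" using li R by (simp add: locally_integrable_on_def)
  define I where "I = (LINT y:cball p R|lborel. \<bar>u y\<bar>)"
  have iI: "integrable lborel (\<lambda>y. indicat_real (cball p R) y * \<bar>u y\<bar>)"
    using set_integrable_abs[OF ip] by (simp add: set_integrable_def)
  obtain Bb where Bb: "\<And>t. b t \<le> Bb"
  proof -
    have "compact (b ` {0..1})" by (intro compact_continuous_image continuous_b) auto
    then obtain B where B: "\<And>t. t \<in> {0..1} \<Longrightarrow> \<bar>b t\<bar> \<le> B"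
      using compact_imp_bounded bounded_iff by (metis imageI real_norm_def)
    have "b t \<le> \<bar>B\<bar>" for t
    proof (cases "t \<in> {0..1}")
      case True
      then show ?thesis using B[of t] by linarith
    next
      case False
      then have "b t = 0" using b_zero[of t] by auto
      then show ?thesis by simp
    qed
    then show ?thesis using that by blast
  qed
  define B where "B = I * (Bb / d\<^sup>2) / mass"
  have "\<bar>u x - M / (2 * mass) * (a \<bullet> (x - p)) / (norm (x - p))\<^sup>2\<bar> \<le> B" if x: "0 < dist x p" "dist x p < d / 2" for x
  proof -
    have xp: "p \<noteq> x" using x by auto
    have sub: "cball x d \<subseteq> cball p R"
      using x d by (intro cball_subset_cball_iff[THEN iffD2]) (auto simp: d_def)
    have cb: "cball x d \<subseteq> \<Omega>" using sub R by blast
    have xO: "x \<in> \<Omega>" using cb d by auto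
    have ix: "set_integrable lborel (cball x d) u" using li cb by (simp add: locally_integrable_on_def)
    have "(norm (x - p))\<^sup>2 \<le> (d / 2)\<^sup>2" using x d by (intro power_mono) (auto simp: dist_norm)
    then have "(norm (x - p))\<^sup>2 / d\<^sup>2 \<le> (d / 2)\<^sup>2 / d\<^sup>2" by (rule divide_right_mono) simp
    also have "\<dots> \<le> 1/2" using d by (simp add: power_divide)
    finally have "(norm (x - p))\<^sup>2 / d\<^sup>2 \<le> 1/2" .
    then have m0: "m ((norm (x - p))\<^sup>2 / d\<^sup>2) = 0" by (rule m_left)
    let ?J = "LINT y|lborel. u y * ker d ((norm (y - x))\<^sup>2)"
    have rep: "mass * u x = ?J + (a \<bullet> (x - p)) * M / (2 * (norm (x - p))\<^sup>2)"
      using representation[OF li eq cb d xp cont[OF xO]] xp m0 by simp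
    have J: "\<bar>?J\<bar> \<le> I * (Bb / d\<^sup>2)"
    proof -
      have "\<bar>?J\<bar> \<le> (LINT y|lborel. (indicat_real (cball p R) y * \<bar>u y\<bar>) * (Bb / d\<^sup>2))"
      proof (rule order_trans[OF integral_abs_bound integral_mono])
        show "integrable lborel (\<lambda>y. \<bar>u y * ker d ((norm (y - x))\<^sup>2)\<bar>)"
          by (intro integrable_abs integrable_mult_ker d ix)
        show "integrable lborel (\<lambda>y. (indicat_real (cball p R) y * \<bar>u y\<bar>) * (Bb / d\<^sup>2))"
          by (intro integrable_mult_left iI)
        fix y
        have kb: "ker d s \<le> Bb / d\<^sup>2" for s
          unfolding ker_def using Bb by (intro divide_right_mono) auto
        show "\<bar>u y * ker d ((norm (y - x))\<^sup>2)\<bar> \<le> (indicat_real (cball p R) y * \<bar>u y\<bar>) * (Bb / d\<^sup>2)"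
        proof (cases "y \<in> cball x d")
          case True
          then have "y \<in> cball p R" using sub by blast
          moreover have "\<bar>u y\<bar> * ker d ((norm (y - x))\<^sup>2) \<le> \<bar>u y\<bar> * (Bb / d\<^sup>2)"
            by (intro mult_left_mono kb) auto
          ultimately show ?thesis by (simp add: abs_mult ker_nonneg)
        next
          case False
          have "0 \<le> Bb" using Bb[of 0] b_nonneg[of 0] by linarith
          then show ?thesis using ker_outside[OF d False] by simp
        qed
      qed
      also have "\<dots> = I * (Bb / d\<^sup>2)" by (simp add: I_def set_lebesgue_integral_def)
      finally show ?thesis .
    qed
    have "u x - M / (2 * mass) * (a \<bullet> (x - p)) / (norm (x - p))\<^sup>2 = ?J / mass"
    proof -
      have "u x = (mass * u x) / mass" using mass_pos by simp
      also have "\<dots> = ?J / mass + M / (2 * mass) * (a \<bullet> (x - p)) / (norm (x - p))\<^sup>2"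
        unfolding rep using mass_pos xp by (simp add: field_simps)
      finally show ?thesis by simp
    qed
    then show ?thesis unfolding B_def using divide_right_mono[OF J, of mass] mass_pos by (simp only: abs_divide abs_of_pos less_imp_le)
  qed
  then show ?thesis using d by (intro exI[of _ "d / 2"]) auto
qed

end

section \<open>A maximum principle\<close>

definition cpx :: "real \<times> real \<Rightarrow> complex" where
  "cpx x = Complex (fst x) (snd x)"

lemma Re_cpx [simp]: "Re (cpx x) = fst x" and Im_cpx [simp]: "Im (cpx x) = snd x"
  by (simp_all add: cpx_def)

lemma cpx_add: "cpx (x + y) = cpx x + cpx y"
  and cpx_diff: "cpx (x - y) = cpx x - cpx y"
  and cpx_scaleR: "cpx (r *\<^sub>R x) = of_real r * cpx x"
  by (simp_all add: complex_eq_iff)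

lemma norm_cpx [simp]: "norm (cpx x) = norm x"
  by (simp add: cmod_def norm_prod_def)

lemma dist_cpx [simp]: "dist (cpx x) (cpx y) = dist x y"
  unfolding dist_norm cpx_diff[symmetric] by simp

lemma cpx_eq_iff [simp]: "cpx x = cpx y \<longleftrightarrow> x = y"
  by (auto simp: complex_eq_iff prod_eq_iff)

lemma continuous_on_cpx [continuous_intros]: "continuous_on S cpx"
  by (rule continuous_onI) (metis dist_cpx less_imp_le)

lemma continuous_on_cpx_compose:
  assumes "continuous_on T f" "\<And>x. x \<in> S \<Longrightarrow> cpx x \<in> T"
  shows "continuous_on S (\<lambda>x. f (cpx x))"
  by (rule continuous_on_compose2[OF assms(1) continuous_on_cpx]) (use assms(2) in auto)

definition harm_at :: "(real \<times> real \<Rightarrow> real) \<Rightarrow> real \<times> real \<Rightarrow> bool" where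
  "harm_at W x \<longleftrightarrow> (\<exists>f r. 0 < r \<and> f holomorphic_on ball (cpx x) r \<and>
     (\<forall>y. dist y x < r \<longrightarrow> W y = Re (f (cpx y))))"

lemma harm_at_Re:
  assumes "open S" "f holomorphic_on S" "cpx x \<in> S"
  shows "harm_at (\<lambda>y. Re (f (cpx y))) x"
proof -
  obtain r where "0 < r" "ball (cpx x) r \<subseteq> S" using assms open_contains_ball by blast
  then show ?thesis unfolding harm_at_def using assms(2) holomorphic_on_subset by blast
qed

lemma harm_at_add:
  assumes "harm_at V x" "harm_at W x"
  shows "harm_at (\<lambda>y. V y + W y) x"
proof -
  obtain f r where f: "0 < r" "f holomorphic_on ball (cpx x) r" "\<And>y. dist y x < r \<Longrightarrow> V y = Re (f (cpx y))"
    using assms(1) unfolding harm_at_def by blast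
  obtain g s where g: "0 < s" "g holomorphic_on ball (cpx x) s" "\<And>y. dist y x < s \<Longrightarrow> W y = Re (g (cpx y))"
    using assms(2) unfolding harm_at_def by blast
  have "(\<lambda>z. f z + g z) holomorphic_on ball (cpx x) (min r s)"
    by (intro holomorphic_intros holomorphic_on_subset[OF f(2)] holomorphic_on_subset[OF g(2)]) auto
  then show ?thesis unfolding harm_at_def
    using f g by (intro exI[of _ "\<lambda>z. f z + g z"] exI[of _ "min r s"]) auto
qed

lemma harm_at_cmult:
  assumes "harm_at W x"
  shows "harm_at (\<lambda>y. c * W y) x"
proof -
  obtain f r where f: "0 < r" "f holomorphic_on ball (cpx x) r" "\<And>y. dist y x < r \<Longrightarrow> W y = Re (f (cpx y))"
    using assms(1) unfolding harm_at_def by blast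
  have "(\<lambda>z. of_real c * f z) holomorphic_on ball (cpx x) r" by (intro holomorphic_intros f)
  then show ?thesis unfolding harm_at_def
    using f by (intro exI[of _ "\<lambda>z. of_real c * f z"] exI[of _ r]) auto
qed

lemma harm_at_const: "harm_at (\<lambda>y. c) x"
  using harm_at_Re[OF open_UNIV holomorphic_on_const[of "of_real c"]] by simp

lemma harm_at_ln_norm:
  assumes "open S" "g holomorphic_on S" "cpx x \<in> S" "g (cpx x) \<noteq> 0"
  shows "harm_at (\<lambda>y. ln (norm (g (cpx y)))) x"
proof -
  define g0 where "g0 = g (cpx x)"
  have g0: "g0 \<noteq> 0" using assms(4) by (simp add: g0_def)
  have "continuous_on S (\<lambda>z. g z / g0)"
    using g0 by (intro continuous_intros holomorphic_on_imp_continuous_on[OF assms(2)]) auto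
  moreover have "open (- \<real>\<^sub>\<le>\<^sub>0 :: complex set)" by (simp add: open_Compl)
  ultimately have "open (S \<inter> (\<lambda>z. g z / g0) -` (- \<real>\<^sub>\<le>\<^sub>0))"
    using assms(1) by (simp add: continuous_on_open_vimage Int_commute)
  moreover have "cpx x \<in> S \<inter> (\<lambda>z. g z / g0) -` (- \<real>\<^sub>\<le>\<^sub>0)"
    using assms(3) g0 by (simp add: g0_def)
  ultimately obtain r where r: "0 < r" "ball (cpx x) r \<subseteq> S \<inter> (\<lambda>z. g z / g0) -` (- \<real>\<^sub>\<le>\<^sub>0)"
    using open_contains_ball by blast
  define f where "f = (\<lambda>z. Ln (g z / g0) + of_real (ln (norm g0)))"
  have "f holomorphic_on ball (cpx x) r"
    unfolding f_def
    by (intro holomorphic_intros holomorphic_on_subset[OF assms(2)]) (use r g0 in auto)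
  moreover have "ln (norm (g (cpx y))) = Re (f (cpx y))" if "dist y x < r" for y
  proof -
    have "cpx y \<in> ball (cpx x) r" using that by (simp add: dist_commute)
    from subsetD[OF r(2) this] have "g (cpx y) / g0 \<notin> \<real>\<^sub>\<le>\<^sub>0" by simp
    then have "g (cpx y) \<noteq> 0" by auto
    then show ?thesis using g0 by (simp add: f_def norm_divide ln_div)
  qed
  ultimately show ?thesis unfolding harm_at_def using r(1) by blast
qed

lemma harm_at_Taylor:
  assumes "harm_at W x"
  shows "\<exists>r>0. \<exists>\<alpha> \<beta> \<gamma> \<delta> C. \<forall>h. norm h < r \<longrightarrow>
    \<bar>W (x + h) - W x - (\<alpha> * fst h + \<beta> * snd h + \<gamma> * ((fst h)\<^sup>2 - (snd h)\<^sup>2) + \<delta> * (fst h * snd h))\<bar>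
      \<le> C * norm h ^ 3"
proof -
  obtain f r where f: "0 < r" "f holomorphic_on ball (cpx x) r" "\<And>y. dist y x < r \<Longrightarrow> W y = Re (f (cpx y))"
    using assms(1) unfolding harm_at_def by blast
  define z where "z = cpx x"
  define D where "D = (\<lambda>n. (deriv ^^ n) f)"
  have hol: "D n holomorphic_on ball z r" for n
    unfolding D_def z_def by (rule holomorphic_higher_deriv[OF f(2) open_ball])
  have der: "(D n has_field_derivative D (Suc n) w) (at w within ball z (r/2))" if "w \<in> ball z (r/2)" for n w
  proof -
    have "w \<in> ball z r" using that f(1) by auto
    from holomorphic_derivI[OF hol open_ball this, of n UNIV]
    show ?thesis by (simp add: D_def has_field_derivative_at_within)
  qed
  have "continuous_on (cball z (r/2)) (D 3)"
    by (rule continuous_on_subset[OF holomorphic_on_imp_continuous_on[OF hol]]) (use f(1) in auto)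
  then have "compact (D 3 ` cball z (r/2))" by (intro compact_continuous_image) auto
  then obtain B where B: "\<And>w. w \<in> cball z (r/2) \<Longrightarrow> norm (D 3 w) \<le> B"
    using compact_imp_bounded bounded_iff by (metis imageI)
  have "\<bar>W (x + h) - W x - (Re (D 1 z) * fst h + (- Im (D 1 z)) * snd h
        + Re (D 2 z) / 2 * ((fst h)\<^sup>2 - (snd h)\<^sup>2) + (- Im (D 2 z)) * (fst h * snd h))\<bar> \<le> B / 2 * norm h ^ 3"
    if h: "norm h < r / 2" for h
  proof -
    have wb: "cpx (x + h) \<in> ball z (r/2)" using h by (simp add: z_def dist_norm[of x])
    have zb: "z \<in> ball z (r/2)" using f(1) by simp
    have "cmod (D 0 (cpx (x + h)) - (\<Sum>i\<le>2. D i z * (cpx (x + h) - z) ^ i / fact i))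
        \<le> B * cmod (cpx (x + h) - z) ^ Suc 2 / fact 2"
    proof (rule complex_Taylor[of "ball z (r/2)"])
      show "cmod (D (Suc 2) w) \<le> B" if "w \<in> ball z (r/2)" for w
        using B[of w] that by (simp add: numeral_3_eq_3 numeral_2_eq_2)
    qed (use zb wb der in auto)
    moreover have "(\<Sum>i\<le>2. D i z * (cpx (x + h) - z) ^ i / fact i)
        = f z + D 1 z * cpx h + D 2 z * (cpx h)\<^sup>2 / 2"
      by (simp add: numeral_2_eq_2 cpx_add z_def D_def)
    ultimately have le: "cmod (f (cpx (x + h)) - (f z + D 1 z * cpx h + D 2 z * (cpx h)\<^sup>2 / 2)) \<le> B / 2 * norm h ^ 3"
      by (simp add: D_def cpx_add z_def numeral_3_eq_3 numeral_2_eq_2)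
    have "Re (f (cpx (x + h)) - (f z + D 1 z * cpx h + D 2 z * (cpx h)\<^sup>2 / 2))
        = W (x + h) - W x - (Re (D 1 z) * fst h + (- Im (D 1 z)) * snd h
        + Re (D 2 z) / 2 * ((fst h)\<^sup>2 - (snd h)\<^sup>2) + (- Im (D 2 z)) * (fst h * snd h))"
      using f(1) h f(3)[of x] f(3)[of "x + h"]
      by (simp add: dist_norm z_def Re_power2 Im_power2 algebra_simps add_divide_distrib diff_divide_distrib)
    then show ?thesis using abs_Re_le_cmod order_trans[OF _ le] by metis
  qed
  then show ?thesis using f(1) half_gt_zero by blast
qed

context radial_profile
begin

lemma maximum_principle:
  fixes u W :: "real \<times> real \<Rightarrow> real"
  assumes K: "compact K" and u: "continuous_on K u" and W: "continuous_on K W"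
    and U: "open U" "U \<subseteq> K"
    and mv: "\<And>x. x \<in> U \<Longrightarrow> mean_value u x" and harm: "\<And>x. x \<in> U \<Longrightarrow> harm_at W x"
    and bd: "\<And>x. x \<in> K - U \<Longrightarrow> u x \<le> W x" and x0: "x0 \<in> K"
  shows "u x0 \<le> W x0"
proof (rule ccontr)
  assume neg: "\<not> u x0 \<le> W x0"
  define \<tau> where "\<tau> = (u x0 - W x0) / 2"
  have \<tau>: "0 < \<tau>" using neg by (simp add: \<tau>_def)
  obtain R where R: "\<And>x. x \<in> K \<Longrightarrow> norm x \<le> R" using K compact_imp_bounded bounded_iff by metis
  define \<kappa> where "\<kappa> = \<tau> / (R\<^sup>2 + 1)"
  have R1: "0 < R\<^sup>2 + 1" by (simp add: add_nonneg_pos)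
  have \<kappa>: "0 < \<kappa>" using \<tau> R1 by (simp add: \<kappa>_def)
  have \<kappa>R: "\<kappa> * (norm x)\<^sup>2 \<le> \<tau>" if "x \<in> K" for x
  proof -
    have "(norm x)\<^sup>2 \<le> R\<^sup>2" using R[OF that] by (intro power_mono) auto
    then have "\<kappa> * (norm x)\<^sup>2 \<le> \<kappa> * (R\<^sup>2 + 1)" using \<kappa> by (intro mult_left_mono) auto
    then show ?thesis using R1 by (simp add: \<kappa>_def)
  qed
  define H where "H = (\<lambda>x. u x - W x + \<kappa> * (norm x)\<^sup>2)"
  have "continuous_on K H" unfolding H_def by (intro continuous_intros u W)
  then obtain x1 where x1: "x1 \<in> K" "\<And>x. x \<in> K \<Longrightarrow> H x \<le> H x1"
    using continuous_attains_sup[OF K, of H] x0 by blast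
  have "2 * \<tau> \<le> H x0" using \<kappa> by (simp add: H_def \<tau>_def)
  then have H1: "2 * \<tau> \<le> H x1" using x1(2)[OF x0] by linarith
  have "x1 \<in> U"
  proof (rule ccontr)
    assume "x1 \<notin> U"
    then have "H x1 \<le> \<kappa> * (norm x1)\<^sup>2" using bd[of x1] x1(1) by (simp add: H_def)
    then show False using H1 \<tau> \<kappa>R[OF x1(1)] by linarith
  qed
  then obtain s where s: "0 < s" "ball x1 s \<subseteq> U" using U(1) open_contains_ball by blast
  obtain r \<alpha> \<beta> \<gamma> \<delta> C where r: "0 < r" "\<And>h. norm h < r \<Longrightarrow>
      \<bar>W (x1 + h) - W x1 - (\<alpha> * fst h + \<beta> * snd h + \<gamma> * ((fst h)\<^sup>2 - (snd h)\<^sup>2) + \<delta> * (fst h * snd h))\<bar>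
      \<le> C * norm h ^ 3"
    using harm_at_Taylor[OF harm[OF \<open>x1 \<in> U\<close>]] by metis
  show False
  proof (rule no_touching[OF mv[OF \<open>x1 \<in> U\<close>] \<kappa>, of "min r s" W])
    show "u y - W y + \<kappa> * (norm y)\<^sup>2 \<le> u x1 - W x1 + \<kappa> * (norm x1)\<^sup>2" if "dist y x1 < min r s" for y
    proof -
      have "y \<in> ball x1 s" using that by (simp add: dist_commute)
      then have "y \<in> K" using s(2) U(2) by blast
      then show ?thesis using x1(2) by (simp add: H_def)
    qed
    show "\<bar>W (x1 + h) - W x1 - (\<alpha> * fst h + \<beta> * snd h + \<gamma> * ((fst h)\<^sup>2 - (snd h)\<^sup>2) + \<delta> * (fst h * snd h))\<bar>
      \<le> C * norm h ^ 3" if "norm h < min r s" for h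
      using r(2)[of h] that by simp
  qed (use r s in auto)
qed

end

section \<open>A periodic sum of cosecants\<close>

lemma sinh_ge_square:
  fixes t :: real
  assumes "0 \<le> t"
  shows "t\<^sup>2 / 4 \<le> sinh t" "t \<le> sinh t"
proof -
  have e: "1 + t + t\<^sup>2 / 2 \<le> exp t" using exp_lower_Taylor_quadratic[OF assms] .
  have "exp (- t) \<le> 1" using assms by simp
  moreover have "t\<^sup>2 / 4 \<le> (a - s) / 2" if "1 + t + t\<^sup>2 / 2 \<le> a" "s \<le> 1" for a s :: real
    using that assms by (simp add: field_simps)
  ultimately show "t\<^sup>2 / 4 \<le> sinh t" unfolding sinh_field_def using e by blast
  show "t \<le> sinh t"
  proof -
    have "((\<lambda>s. sinh s - s) has_real_derivative cosh s - 1) (at s)" for s :: real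
      by (auto intro!: derivative_eq_intros)
    then have "sinh 0 - 0 \<le> sinh t - t"
      using assms by (intro DERIV_nonneg_imp_nondecreasing[of 0 t "\<lambda>s. sinh s - s"]) (metis cosh_real_ge_1 diff_ge_0_iff_ge)+
    then show ?thesis by simp
  qed
qed

lemma norm_sin_square: "(norm (sin z))\<^sup>2 = (sin (Re z))\<^sup>2 + (sinh (Im z))\<^sup>2"
proof -
  have "(norm (sin z))\<^sup>2 = (sin (Re z) * cosh (Im z))\<^sup>2 + (cos (Re z) * sinh (Im z))\<^sup>2"
    unfolding cmod_power2 Re_sin Im_sin by (simp add: cosh_field_def sinh_field_def)
  also have "\<dots> = (sin (Re z))\<^sup>2 * ((sinh (Im z))\<^sup>2 + 1) + (1 - (sin (Re z))\<^sup>2) * (sinh (Im z))\<^sup>2"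
    using cosh_square_eq[of "Im z"] by (simp add: power_mult_distrib cos_squared_eq)
  finally show ?thesis by (simp add: algebra_simps)
qed

lemma norm_cos_le: "norm (cos z) \<le> cosh (Im z)"
proof (rule power2_le_imp_le)
  have "(norm (cos z))\<^sup>2 = (cos (Re z))\<^sup>2 + (sinh (Im z))\<^sup>2"
    unfolding norm_cos_squared by (simp add: sinh_field_def exp_minus power_divide)
  moreover have "(cos (Re z))\<^sup>2 \<le> 1" by (simp add: abs_square_le_1)
  ultimately show "(norm (cos z))\<^sup>2 \<le> (cosh (Im z))\<^sup>2" by (simp add: cosh_square_eq)
qed simp

lemma sin_ge_quarter:
  fixes x :: real
  assumes "0 \<le> x" "x \<le> pi / 2"
  shows "x / 4 \<le> sin x"
proof (cases "x \<le> pi / 6")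
  case True
  show ?thesis
  proof (cases "x = 0")
    case False
    then have "\<exists>z. 0 < z \<and> z < x \<and> sin x - sin 0 = (x - 0) * cos z"
      using assms by (intro MVT2) (auto intro!: derivative_eq_intros)
    then obtain z where z: "0 < z" "z < x" "sin x = x * cos z" by auto
    have "cos (pi / 3) \<le> cos z" using z True by (intro cos_monotone_0_pi_le) auto
    then have "1 / 2 \<le> cos z" by (simp add: cos_60)
    then have "x * (1 / 4) \<le> x * cos z" using assms by (intro mult_left_mono) auto
    then show ?thesis using z by simp
  qed simp
next
  case False
  have "sin (pi / 6) \<le> sin x" using False assms by (intro sin_monotone_2pi_le) auto
  then show ?thesis using assms pi_less_4 by (simp add: sin_30)
qed

lemma sin_square_ge:
  fixes x :: real
  assumes "\<bar>x\<bar> \<le> pi / 2"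
  shows "x\<^sup>2 \<le> 16 * (sin x)\<^sup>2"
proof -
  have "\<bar>x\<bar> / 4 \<le> sin \<bar>x\<bar>" using assms by (intro sin_ge_quarter) auto
  then have "(\<bar>x\<bar> / 4)\<^sup>2 \<le> (sin \<bar>x\<bar>)\<^sup>2" by (intro power_mono) auto
  also have "(sin \<bar>x\<bar>)\<^sup>2 = (sin x)\<^sup>2" by (cases "x \<ge> 0") auto
  finally show ?thesis by (simp add: power_divide)
qed

lemma cos_over_sin_square_bound:
  fixes s :: complex
  assumes "\<bar>Re s\<bar> \<le> pi / 2"
  shows "(norm s)\<^sup>2 * exp (\<bar>Im s\<bar> / 2) * norm (cos s) \<le> 640 * (norm (sin s))\<^sup>2"
proof -
  define X Y where "X = \<bar>Re s\<bar>" and "Y = \<bar>Im s\<bar>"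
  have Y0: "0 \<le> Y" by (simp add: Y_def)
  have ns: "(norm s)\<^sup>2 = X\<^sup>2 + Y\<^sup>2" by (simp add: cmod_power2 X_def Y_def)
  have sinS: "(norm (sin s))\<^sup>2 = (sin X)\<^sup>2 + (sinh Y)\<^sup>2"
    unfolding norm_sin_square X_def Y_def by (auto simp: abs_if)
  have X2: "X\<^sup>2 \<le> 16 * (sin X)\<^sup>2" using assms by (intro sin_square_ge) (simp add: X_def)
  have X2': "X\<^sup>2 \<le> 4"
  proof -
    have "X \<le> 2" using assms pi_less_4 by (simp add: X_def)
    then have "X\<^sup>2 \<le> 2\<^sup>2" by (intro power_mono) (auto simp: X_def)
    then show ?thesis by simp
  qed
  have Y2: "Y\<^sup>2 \<le> (sinh Y)\<^sup>2" using sinh_ge_square(2)[OF Y0] Y0 by (intro power_mono) auto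
  have cosS: "norm (cos s) \<le> exp Y"
  proof -
    have "norm (cos s) \<le> cosh Y" using norm_cos_le[of s] by (auto simp: Y_def abs_if)
    also have "\<dots> \<le> exp Y"
    proof -
      have "exp (- Y) \<le> exp Y" using Y0 by simp
      then show ?thesis by (simp add: cosh_field_def)
    qed
    finally show ?thesis .
  qed
  have "(norm s)\<^sup>2 * exp (Y / 2) * norm (cos s) \<le> (X\<^sup>2 + Y\<^sup>2) * exp (Y / 2) * exp Y"
    unfolding ns using cosS by (intro mult_left_mono) auto
  also have "\<dots> \<le> 640 * ((sin X)\<^sup>2 + (sinh Y)\<^sup>2)"
  proof (cases "Y \<le> 1")
    case True
    have "exp (Y / 2) * exp Y = exp (3 / 2 * Y)" by (simp add: exp_add[symmetric])
    also have "\<dots> \<le> exp (3 / 2)" using True by simp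
    also have "\<dots> \<le> exp 2" by simp
    also have "\<dots> = exp 1 * exp (1::real)" by (simp add: exp_add[symmetric])
    also have "\<dots> \<le> 3 * 3" using exp_le by (intro mult_mono) auto
    finally have e9: "exp (Y / 2) * exp Y \<le> 9" by simp
    have "(X\<^sup>2 + Y\<^sup>2) * (exp (Y / 2) * exp Y) \<le> (16 * (sin X)\<^sup>2 + 16 * (sinh Y)\<^sup>2) * 9"
      using X2 Y2 e9 by (intro mult_mono add_mono) (auto intro: order_trans)
    also have "\<dots> \<le> 640 * ((sin X)\<^sup>2 + (sinh Y)\<^sup>2)" by (simp add: algebra_simps)
    finally show ?thesis by (simp only: mult.assoc)
  next
    case False
    define E where "E = exp (Y / 2)"
    have EE: "E * E = exp Y" by (simp add: E_def exp_add[symmetric])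
    have E: "Y\<^sup>2 \<le> 8 * E"
      using exp_lower_Taylor_quadratic[of "Y / 2"] Y0 by (simp add: E_def power_divide)
    have e2: "2 \<le> exp Y" using exp_ge_add_one_self[of Y] False by linarith
    have "exp (- Y) \<le> 1" using Y0 by simp
    moreover have "a / 4 \<le> (a - s) / 2" if "2 \<le> a" "s \<le> 1" for a s :: real
      using that by (simp add: field_simps)
    ultimately have "exp Y / 4 \<le> sinh Y" unfolding sinh_field_def using e2 by blast
    then have "(exp Y / 4)\<^sup>2 \<le> (sinh Y)\<^sup>2" by (intro power_mono) auto
    then have sh: "(E * E) * (E * E) \<le> 16 * (sinh Y)\<^sup>2" by (simp add: EE power_divide power2_eq_square)
    have "1 \<le> Y\<^sup>2" using False by (simp add: one_le_power)
    then have "X\<^sup>2 + Y\<^sup>2 \<le> 40 * E" using X2' E by linarith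
    then have "(X\<^sup>2 + Y\<^sup>2) * E * exp Y \<le> 40 * E * E * exp Y"
      by (intro mult_right_mono) (auto simp: E_def)
    also have "\<dots> = 40 * ((E * E) * (E * E))" by (simp add: EE)
    also have "\<dots> \<le> 640 * (sinh Y)\<^sup>2" using sh by simp
    finally have "(X\<^sup>2 + Y\<^sup>2) * E * exp Y \<le> 640 * (sinh Y)\<^sup>2" .
    moreover have "0 \<le> (sin X)\<^sup>2" by simp
    ultimately show ?thesis unfolding E_def distrib_left by linarith
  qed
  finally show ?thesis by (simp add: sinS Y_def)
qed

definition cosec :: "real \<Rightarrow> complex \<Rightarrow> complex" where
  "cosec k z = of_real k / sin (of_real k * z)"

definition cosec' :: "real \<Rightarrow> complex \<Rightarrow> complex" where
  "cosec' k z = - (of_real k)\<^sup>2 * cos (of_real k * z) / (sin (of_real k * z))\<^sup>2"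

lemma sin_scaled_nonzero:
  assumes "0 < k" "\<bar>Re z\<bar> < pi / k" "z \<noteq> 0"
  shows "sin (of_real k * z) \<noteq> 0"
proof
  assume "sin (of_real k * z) = 0"
  then obtain n :: int where n: "of_real k * z = of_real (n * pi)" by (auto simp: sin_eq_0)
  have re: "k * Re z = n * pi" and im: "k * Im z = 0"
    using arg_cong[OF n, of Re] arg_cong[OF n, of Im] by simp_all
  have "\<bar>k * Re z\<bar> < pi" using assms by (simp add: abs_mult field_simps)
  then have "\<bar>real_of_int n\<bar> * pi < 1 * pi" unfolding re by (simp add: abs_mult)
  then have "\<bar>real_of_int n\<bar> < 1" using pi_gt_zero mult_less_cancel_right_pos by blast
  then have "n = 0" by linarith
  then show False using re im assms by (auto simp: complex_eq_iff)
qed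

lemma cosec_has_derivative:
  assumes "sin (of_real k * z) \<noteq> 0"
  shows "(cosec k has_field_derivative cosec' k z) (at z)"
  unfolding cosec_def[abs_def] cosec'_def using assms
  by (auto intro!: derivative_eq_intros simp: power2_eq_square)

lemma cosec'_bound:
  assumes "0 < k" "\<bar>Re z\<bar> \<le> pi / (2 * k)" "z \<noteq> 0"
  shows "norm (cosec' k z) \<le> 640 * exp (- (k * \<bar>Im z\<bar> / 2)) / (norm z)\<^sup>2"
proof -
  define s where "s = of_real k * z"
  have "pi / (2 * k) < pi / k" using assms(1) by (simp add: field_simps)
  then have "sin s \<noteq> 0" unfolding s_def using assms by (intro sin_scaled_nonzero) auto
  then have sin: "0 < (norm (sin s))\<^sup>2" by simp
  have "\<bar>Re s\<bar> \<le> pi / 2" using assms by (simp add: s_def abs_mult field_simps)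
  from cos_over_sin_square_bound[OF this]
  have "(k\<^sup>2 * (norm z)\<^sup>2) * exp (k * \<bar>Im z\<bar> / 2) * norm (cos s) \<le> 640 * (norm (sin s))\<^sup>2"
    using assms(1) by (simp add: s_def norm_mult power_mult_distrib abs_mult)
  then have "k\<^sup>2 * norm (cos s) / (norm (sin s))\<^sup>2 \<le> 640 / (exp (k * \<bar>Im z\<bar> / 2) * (norm z)\<^sup>2)"
    using sin assms(3) by (simp add: field_simps)
  moreover have "norm (cosec' k z) = k\<^sup>2 * norm (cos s) / (norm (sin s))\<^sup>2"
    by (simp add: cosec'_def s_def norm_mult norm_divide norm_power)
  ultimately show ?thesis by (simp add: exp_minus field_simps)
qed

lemma cosec_bound:
  assumes "1 \<le> k" "Im z \<noteq> 0"
  shows "norm (cosec k z) \<le> 4 / (Im z)\<^sup>2"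
proof -
  define t where "t = \<bar>Im (of_real k * z)\<bar>"
  have t: "t = k * \<bar>Im z\<bar>" using assms by (simp add: t_def abs_mult)
  have tp: "0 < t" using assms t by simp
  have "t\<^sup>2 / 4 \<le> norm (sin (of_real k * z))"
  proof -
    have "(sinh t)\<^sup>2 \<le> (norm (sin (of_real k * z)))\<^sup>2"
      unfolding norm_sin_square t_def by (auto simp: abs_if)
    then have "sinh t \<le> norm (sin (of_real k * z))" by (rule power2_le_imp_le) simp
    then show ?thesis using sinh_ge_square(1)[of t] tp by simp
  qed
  moreover have "0 < t\<^sup>2 / 4" using tp by simp
  ultimately have "norm (cosec k z) \<le> k / (t\<^sup>2 / 4)"
    unfolding cosec_def norm_divide using assms by (intro frac_le) auto
  also have "\<dots> = 4 / (k * (Im z)\<^sup>2)" using assms by (simp add: t power_mult_distrib power2_eq_square)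
  also have "\<dots> \<le> 4 / (1 * (Im z)\<^sup>2)"
    using assms by (intro divide_left_mono mult_right_mono mult_pos_pos) auto
  finally show ?thesis by simp
qed

definition shift :: "nat \<Rightarrow> complex" where
  "shift n = 2 * of_real pi * \<i> * of_nat (Suc n)"

definition cosec_pair :: "real \<Rightarrow> nat \<Rightarrow> complex \<Rightarrow> complex" where
  "cosec_pair k n z = cosec k (z + shift n) + cosec k (z - shift n)"

definition cosec_tail :: "real \<Rightarrow> complex \<Rightarrow> complex" where
  "cosec_tail k z = (\<Sum>n. cosec_pair k n z)"

definition cosec_tail' :: "real \<Rightarrow> complex \<Rightarrow> complex" where
  "cosec_tail' k z = (\<Sum>n. cosec' k (z + shift n) + cosec' k (z - shift n))"

definition cosec_sum :: "real \<Rightarrow> complex \<Rightarrow> complex" where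
  "cosec_sum k z = cosec k z + cosec_tail k z"

text \<open>The unit ball is included because only the unshifted cosecant is singular at the origin.\<close>

definition tail_domain :: "real \<Rightarrow> complex set" where
  "tail_domain k = {z. \<bar>Re z\<bar> < pi / k} \<inter> ({z. exp z \<noteq> 1} \<union> ball 0 1)"

lemma Re_shift [simp]: "Re (shift n) = 0" and Im_shift [simp]: "Im (shift n) = 2 * pi * (real n + 1)"
  by (simp_all add: shift_def)

lemma open_tail_domain: "open (tail_domain k)"
proof -
  have "open {z::complex. \<bar>Re z\<bar> < pi / k}" "open {z::complex. exp z \<noteq> 1}"
    by (auto intro!: open_Collect_less open_Collect_neq continuous_intros)
  then show ?thesis unfolding tail_domain_def by (intro open_Int open_Un) auto
qed

lemma exp_shift [simp]: "exp (z + shift n) = exp z" "exp (z - shift n) = exp z"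
proof -
  have "exp (shift n) = 1"
    unfolding shift_def exp_eq_1 by (auto intro!: exI[of _ "int (Suc n)"])
  then show "exp (z + shift n) = exp z" "exp (z - shift n) = exp z"
    by (simp_all add: exp_add exp_diff)
qed

lemma tail_domain_nonzero:
  assumes "z \<in> tail_domain k"
  shows "z + shift n \<noteq> 0" "z - shift n \<noteq> 0"
proof -
  have far: "1 < norm (shift n)"
  proof -
    have "1 * 1 < (2 * pi) * (real n + 1)" using pi_gt3 by (intro mult_less_le_imp_less) auto
    also have "\<dots> = \<bar>Im (shift n)\<bar>" by simp
    also have "\<dots> \<le> norm (shift n)" by (rule abs_Im_le_cmod)
    finally show ?thesis by simp
  qed
  have "z \<noteq> shift n" "z \<noteq> - shift n"
    using assms far exp_shift(1)[of 0 n] exp_shift(2)[of 0 n] unfolding tail_domain_def by auto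
  then show "z + shift n \<noteq> 0" "z - shift n \<noteq> 0" by (auto simp: add_eq_0_iff2)
qed

lemma cosec_shift_bound:
  assumes "1 \<le> k" "\<bar>Im z\<bar> \<le> Y" "Y \<le> real n"
  shows "norm (cosec k (z + shift n)) \<le> 4 / (real n + 1)\<^sup>2"
    and "norm (cosec k (z - shift n)) \<le> 4 / (real n + 1)\<^sup>2"
proof -
  have "2 * (real n + 1) \<le> 2 * pi * (real n + 1)" using pi_gt3 by (intro mult_right_mono) auto
  then have b: "real n + 1 \<le> \<bar>Im (z + shift n)\<bar>" "real n + 1 \<le> \<bar>Im (z - shift n)\<bar>"
    using assms by auto
  have main: "norm (cosec k w) \<le> 4 / (real n + 1)\<^sup>2" if w: "real n + 1 \<le> \<bar>Im w\<bar>" for w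
  proof -
    have "Im w \<noteq> 0" using w by auto
    then have "norm (cosec k w) \<le> 4 / \<bar>Im w\<bar>\<^sup>2" using cosec_bound[OF assms(1)] by simp
    also have "\<dots> \<le> 4 / (real n + 1)\<^sup>2"
      using w by (intro divide_left_mono power_mono mult_pos_pos) auto
    finally show ?thesis .
  qed
  show "norm (cosec k (z + shift n)) \<le> 4 / (real n + 1)\<^sup>2" by (rule main[OF b(1)])
  show "norm (cosec k (z - shift n)) \<le> 4 / (real n + 1)\<^sup>2" by (rule main[OF b(2)])
qed

lemma summable_inverse_squares: "summable (\<lambda>n. c / (real n + 1)\<^sup>2)"
proof -
  have "summable (\<lambda>n. inverse ((real (Suc n))\<^sup>2))"
    using inverse_power_summable[of 2] by (subst summable_Suc_iff) simp
  from summable_mult[OF this, of c] show ?thesis by (simp add: divide_inverse add.commute)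
qed

lemma cosec_tail_properties:
  assumes k: "1 \<le> k" and z: "z \<in> tail_domain k"
  shows "(\<lambda>n. cosec_pair k n z) sums cosec_tail k z"
    and "(\<lambda>n. cosec' k (z + shift n) + cosec' k (z - shift n)) sums cosec_tail' k z"
    and "(cosec_tail k has_field_derivative cosec_tail' k z) (at z)"
proof -
  have der: "(cosec_pair k n has_field_derivative cosec' k (z + shift n) + cosec' k (z - shift n)) (at z)"
    if "z \<in> tail_domain k" for n z
  proof -
    have nz: "sin (of_real k * (z + shift n)) \<noteq> 0" "sin (of_real k * (z - shift n)) \<noteq> 0"
      using k that tail_domain_nonzero[OF that, of n]
      by (intro sin_scaled_nonzero; simp add: tail_domain_def)+
    have "((\<lambda>z. cosec k (z + shift n)) has_field_derivative cosec' k (z + shift n)) (at z)"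
      "((\<lambda>z. cosec k (z - shift n)) has_field_derivative cosec' k (z - shift n)) (at z)"
      using DERIV_shift[of "cosec k" _ z "shift n"] DERIV_shift[of "cosec k" _ z "- shift n"]
        cosec_has_derivative[OF nz(1)] cosec_has_derivative[OF nz(2)] by simp_all
    then show ?thesis unfolding cosec_pair_def[abs_def] by (rule DERIV_add)
  qed
  have cmp: "\<exists>d h. 0 < d \<and> summable h \<and>
      (\<forall>\<^sub>F n in sequentially. \<forall>y\<in>ball x d \<inter> tail_domain k. norm (cosec_pair k n y) \<le> h n)"
    if "x \<in> tail_domain k" for x
  proof (intro exI[of _ 1] exI[of _ "\<lambda>n. 8 / (real n + 1)\<^sup>2"] conjI)
    obtain N :: nat where N: "\<bar>Im x\<bar> + 1 \<le> real N" using real_arch_simple by blast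
    show "\<forall>\<^sub>F n in sequentially. \<forall>y\<in>ball x 1 \<inter> tail_domain k. norm (cosec_pair k n y) \<le> 8 / (real n + 1)\<^sup>2"
      unfolding eventually_sequentially
    proof (intro exI[of _ N] allI impI ballI)
      fix n y assume n: "N \<le> n" and y: "y \<in> ball x 1 \<inter> tail_domain k"
      have "\<bar>Im (y - x)\<bar> \<le> norm (y - x)" by (rule abs_Im_le_cmod)
      moreover have "norm (y - x) < 1" using y by (simp add: dist_norm norm_minus_commute)
      ultimately have "\<bar>Im y\<bar> \<le> \<bar>Im x\<bar> + 1" by simp
      then have "norm (cosec_pair k n y) \<le> 4 / (real n + 1)\<^sup>2 + 4 / (real n + 1)\<^sup>2"
        unfolding cosec_pair_def using N n
        by (intro norm_triangle_le add_mono cosec_shift_bound[OF k]) auto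
      then show "norm (cosec_pair k n y) \<le> 8 / (real n + 1)\<^sup>2" by simp
    qed
  qed (auto intro: summable_inverse_squares)
  obtain g g' where g: "\<And>x. x \<in> tail_domain k \<Longrightarrow> (\<lambda>n. cosec_pair k n x) sums g x \<and>
      (\<lambda>n. cosec' k (x + shift n) + cosec' k (x - shift n)) sums g' x \<and>
      (g has_field_derivative g' x) (at x)"
    using series_and_derivative_comparison_local[OF open_tail_domain der cmp] by blast
  have eq: "cosec_tail k x = g x" "cosec_tail' k x = g' x" if "x \<in> tail_domain k" for x
    using g[OF that] unfolding cosec_tail_def cosec_tail'_def by (auto simp: sums_iff)
  show "(\<lambda>n. cosec_pair k n z) sums cosec_tail k z"
    "(\<lambda>n. cosec' k (z + shift n) + cosec' k (z - shift n)) sums cosec_tail' k z"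
    using g[OF z] eq[OF z] by auto
  show "(cosec_tail k has_field_derivative cosec_tail' k z) (at z)"
    unfolding eq(2)[OF z]
    by (rule has_field_derivative_transform_within_open[OF _ open_tail_domain z])
      (use g[OF z] eq(1) in auto)
qed

lemma cosec_sum_has_derivative:
  assumes "1 \<le> k" "\<bar>Re z\<bar> < pi / k" "exp z \<noteq> 1"
  shows "(cosec_sum k has_field_derivative cosec' k z + cosec_tail' k z) (at z)"
proof -
  have "z \<noteq> 0" using assms(3) by auto
  then have "sin (of_real k * z) \<noteq> 0" using assms by (intro sin_scaled_nonzero) auto
  moreover have "z \<in> tail_domain k" using assms by (simp add: tail_domain_def)
  ultimately show ?thesis unfolding cosec_sum_def[abs_def]
    by (intro DERIV_add cosec_has_derivative cosec_tail_properties(3) assms)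
qed

lemma cosec_sum_shift:
  assumes k: "1 \<le> k" and z: "\<bar>Re z\<bar> < pi / k" "exp z \<noteq> 1"
  shows "cosec_sum k (z + 2 * of_real pi * \<i>) = cosec_sum k z"
proof -
  define w where "w = z + 2 * of_real pi * \<i>"
  have w0: "w = z + shift 0" by (simp add: w_def shift_def)
  have dom: "z \<in> tail_domain k" "w \<in> tail_domain k"
    using z unfolding tail_domain_def by (auto simp: w0)
  have step: "shift (Suc n) = shift n + shift 0" for n by (simp add: shift_def algebra_simps)
  have partial: "(cosec k w + (\<Sum>n<N. cosec_pair k n w)) - (cosec k z + (\<Sum>n<N. cosec_pair k n z))
      = cosec k (z + shift N) - cosec k (z + shift 0 - shift N)" for N
  proof (induction N)
    case 0
    then show ?case by (simp add: w0)
  next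
    case (Suc N)
    have "(cosec k w + (\<Sum>n<Suc N. cosec_pair k n w)) - (cosec k z + (\<Sum>n<Suc N. cosec_pair k n z))
        = (cosec k (z + shift N) - cosec k (z + shift 0 - shift N)) + cosec_pair k N w - cosec_pair k N z"
      using Suc by (simp add: algebra_simps)
    also have "\<dots> = cosec k (w + shift N) - cosec k (z - shift N)"
      by (simp add: cosec_pair_def w0)
    also have "w + shift N = z + shift (Suc N)" by (simp add: w0 step algebra_simps)
    also have "z - shift N = z + shift 0 - shift (Suc N)" by (simp add: step)
    finally show ?case .
  qed
  have lim0: "(\<lambda>n. 4 / (real n + 1)\<^sup>2) \<longlonglongrightarrow> 0"
    by (rule summable_LIMSEQ_zero[OF summable_inverse_squares])
  have ev: "\<forall>\<^sub>F n in sequentially. \<bar>Im z\<bar> + 2 * pi \<le> real n"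
    using eventually_ge_at_top real_arch_simple
    by (metis (mono_tags, lifting) eventually_sequentially of_nat_le_iff order_trans)
  have l1: "(\<lambda>N. cosec k (z + shift N)) \<longlonglongrightarrow> 0"
  proof (rule Lim_null_comparison[OF eventually_mono[OF ev] lim0])
    show "norm (cosec k (z + shift n)) \<le> 4 / (real n + 1)\<^sup>2" if "\<bar>Im z\<bar> + 2 * pi \<le> real n" for n
      using that pi_gt_zero by (intro cosec_shift_bound(1)[OF k order_refl]) linarith
  qed
  have l2: "(\<lambda>N. cosec k (z + shift 0 - shift N)) \<longlonglongrightarrow> 0"
  proof (rule Lim_null_comparison[OF eventually_mono[OF ev] lim0])
    show "norm (cosec k (z + shift 0 - shift n)) \<le> 4 / (real n + 1)\<^sup>2"
      if n: "\<bar>Im z\<bar> + 2 * pi \<le> real n" for n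
    proof (rule cosec_shift_bound(2)[OF k _ n])
      have "Im (z + shift 0) = Im z + 2 * pi" by simp
      then show "\<bar>Im (z + shift 0)\<bar> \<le> \<bar>Im z\<bar> + 2 * pi" using pi_gt_zero by linarith
    qed
  qed
  have sums: "(\<lambda>N. \<Sum>n<N. cosec_pair k n y) \<longlonglongrightarrow> cosec_tail k y" if "y \<in> tail_domain k" for y
    using cosec_tail_properties(1)[OF k that] by (simp add: sums_def)
  have "(\<lambda>N. (cosec k w + (\<Sum>n<N. cosec_pair k n w)) - (cosec k z + (\<Sum>n<N. cosec_pair k n z)))
      \<longlonglongrightarrow> cosec_sum k w - cosec_sum k z"
    unfolding cosec_sum_def by (intro tendsto_intros sums dom)
  moreover have "(\<lambda>N. (cosec k w + (\<Sum>n<N. cosec_pair k n w)) - (cosec k z + (\<Sum>n<N. cosec_pair k n z)))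
      \<longlonglongrightarrow> 0 - 0"
    unfolding partial by (intro tendsto_diff l1 l2)
  ultimately have "cosec_sum k w - cosec_sum k z = 0 - 0" by (rule LIMSEQ_unique)
  then show ?thesis by (simp add: w_def)
qed

lemma cosec_sum_periodic:
  assumes k: "1 \<le> k" and z: "\<bar>Re z\<bar> < pi / k" "exp z \<noteq> 1" and e: "exp w = exp z"
  shows "cosec_sum k w = cosec_sum k z"
proof -
  have nat: "cosec_sum k (y + 2 * of_real pi * \<i> * of_nat n) = cosec_sum k y"
    if y: "\<bar>Re y\<bar> < pi / k" "exp y \<noteq> 1" for y n
  proof (induction n)
    case (Suc n)
    let ?v = "y + 2 * of_real pi * \<i> * of_nat n"
    have "exp ?v = exp y" by (simp add: exp_eq) (metis of_int_of_nat_eq mult.commute mult.assoc)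
    then have "cosec_sum k (?v + 2 * of_real pi * \<i>) = cosec_sum k ?v"
      using y by (intro cosec_sum_shift[OF k]) auto
    then show ?case using Suc by (simp add: algebra_simps)
  qed simp
  obtain n :: int where n: "w = z + (of_int (2 * n) * pi) * \<i>" using e exp_eq by blast
  show ?thesis
  proof (cases "0 \<le> n")
    case True
    then obtain j where j: "n = int j" using nonneg_int_cases by blast
    have "w = z + 2 * of_real pi * \<i> * of_nat j" by (simp add: n j)
    then show ?thesis using nat[OF z] by simp
  next
    case False
    then obtain j where j: "n = - int j" by (metis int_cases2 nonneg_int_cases of_nat_0_le_iff)
    have zw: "z = w + 2 * of_real pi * \<i> * of_nat j" by (simp add: n j)
    have "\<bar>Re w\<bar> < pi / k" "exp w \<noteq> 1" using z e by (auto simp: n)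
    then show ?thesis using nat[of w j] unfolding zw[symmetric] by simp
  qed
qed

lemma cosec_sum_derivative_bound:
  "\<exists>C>0. \<forall>k z. 1 \<le> k \<and> \<bar>Re z\<bar> \<le> pi / (2 * k) \<and> \<bar>Im z\<bar> \<le> pi \<and> exp z \<noteq> 1 \<longrightarrow>
     norm (cosec' k z + cosec_tail' k z) * (norm z)\<^sup>2 \<le> C * exp (- (k * \<bar>Im z\<bar> / 2))"
proof -
  define S where "S = (\<Sum>n. 1280 / (real n + 1)\<^sup>2)"
  have S0: "0 \<le> S" unfolding S_def by (rule suminf_nonneg[OF summable_inverse_squares]) simp
  have "norm (cosec' k z + cosec_tail' k z) * (norm z)\<^sup>2 \<le> (640 + 36 * S) * exp (- (k * \<bar>Im z\<bar> / 2))"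
    if k: "1 \<le> k" and re: "\<bar>Re z\<bar> \<le> pi / (2 * k)" and im: "\<bar>Im z\<bar> \<le> pi" and e: "exp z \<noteq> 1" for k z
  proof -
    define E where "E = exp (- (k * \<bar>Im z\<bar> / 2))"
    have E0: "0 \<le> E" by (simp add: E_def)
    have z0: "z \<noteq> 0" using e by auto
    have "pi / (2 * k) < pi / k" using k by (simp add: field_simps)
    then have dom: "z \<in> tail_domain k" using re e by (simp add: tail_domain_def)
    have sums: "(\<lambda>n. cosec' k (z + shift n) + cosec' k (z - shift n)) sums cosec_tail' k z"
      by (rule cosec_tail_properties(2)[OF k dom])
    have one: "norm (cosec' k w) \<le> 640 / (real n + 1)\<^sup>2 * E"
      if w: "Re w = Re z" "pi * (real n + 1) \<le> \<bar>Im w\<bar>" for w n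
    proof -
      have nn: "1 \<le> real n + 1" by simp
      have p1: "pi * 1 \<le> pi * (real n + 1)" by (intro mult_left_mono nn) simp
      have p2: "1 * (real n + 1) \<le> pi * (real n + 1)" using pi_gt3 by (intro mult_right_mono) auto
      have "Im w \<noteq> 0" using w(2) p1 pi_gt3 by linarith
      then have w0: "w \<noteq> 0" by auto
      have "norm (cosec' k w) \<le> 640 * exp (- (k * \<bar>Im w\<bar> / 2)) / (norm w)\<^sup>2"
        using k re w w0 by (intro cosec'_bound) auto
      also have "\<dots> \<le> 640 * E / (real n + 1)\<^sup>2"
      proof (rule frac_le)
        have "\<bar>Im z\<bar> \<le> \<bar>Im w\<bar>" using im w(2) p1 by linarith
        then have "k * \<bar>Im z\<bar> \<le> k * \<bar>Im w\<bar>" using k by (intro mult_left_mono) auto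
        then show "640 * exp (- (k * \<bar>Im w\<bar> / 2)) \<le> 640 * E" by (simp add: E_def)
        have "real n + 1 \<le> norm w"
          using order_trans[OF order_trans[OF p2 w(2)] abs_Im_le_cmod] by simp
        then show "(real n + 1)\<^sup>2 \<le> (norm w)\<^sup>2" by (intro power_mono) auto
      qed (auto simp: E_def)
      finally show ?thesis by (simp add: field_simps)
    qed
    have pair: "norm (cosec' k (z + shift n) + cosec' k (z - shift n)) \<le> 1280 / (real n + 1)\<^sup>2 * E" for n
    proof -
      have "pi * 1 \<le> pi * (real n + 1)" by (intro mult_left_mono) auto
      moreover have "Im (z + shift n) = Im z + 2 * (pi * (real n + 1))"
        "Im (z - shift n) = Im z - 2 * (pi * (real n + 1))" by simp_all
      ultimately have "pi * (real n + 1) \<le> \<bar>Im (z + shift n)\<bar>" "pi * (real n + 1) \<le> \<bar>Im (z - shift n)\<bar>"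
        using im by linarith+
      then have "norm (cosec' k (z + shift n) + cosec' k (z - shift n))
          \<le> 640 / (real n + 1)\<^sup>2 * E + 640 / (real n + 1)\<^sup>2 * E"
        by (intro norm_triangle_le add_mono one) auto
      then show ?thesis by (simp add: field_simps)
    qed
    have summ: "summable (\<lambda>n. 1280 / (real n + 1)\<^sup>2 * E)"
      by (intro summable_mult2 summable_inverse_squares)
    have tail: "norm (cosec_tail' k z) \<le> S * E"
    proof -
      have "norm (\<Sum>n. cosec' k (z + shift n) + cosec' k (z - shift n)) \<le> (\<Sum>n. 1280 / (real n + 1)\<^sup>2 * E)"
        by (rule norm_suminf_le[OF pair summ])
      also have "\<dots> = S * E" unfolding S_def by (rule suminf_mult2[OF summable_inverse_squares, symmetric])
      finally show ?thesis by (simp add: cosec_tail'_def)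
    qed
    have nz: "(norm z)\<^sup>2 \<le> 36"
    proof -
      have "pi / (2 * k) \<le> pi / (2 * 1)" using k by (intro divide_left_mono mult_left_mono mult_pos_pos) auto
      then have "norm z \<le> 6" using cmod_le[of z] re im pi_less_4 by linarith
      then have "(norm z)\<^sup>2 \<le> 6\<^sup>2" by (intro power_mono) auto
      then show ?thesis by simp
    qed
    have "norm (cosec' k z) * (norm z)\<^sup>2 \<le> 640 * E"
      using cosec'_bound[of k z] k re z0 by (simp add: E_def field_simps)
    moreover have "norm (cosec_tail' k z) * (norm z)\<^sup>2 \<le> (S * E) * 36"
      using tail nz S0 E0 by (intro mult_mono) auto
    moreover have "norm (cosec' k z + cosec_tail' k z) * (norm z)\<^sup>2
        \<le> (norm (cosec' k z) + norm (cosec_tail' k z)) * (norm z)\<^sup>2"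
      by (intro mult_right_mono norm_triangle_ineq) auto
    moreover have "(640 + 36 * S) * E = 640 * E + (S * E) * 36" by (simp add: algebra_simps)
    ultimately show ?thesis unfolding E_def[symmetric] distrib_right by linarith
  qed
  moreover have "0 < 640 + 36 * S" using S0 by simp
  ultimately show ?thesis by blast
qed

lemma Im_cosec_sum_boundary:
  assumes k: "1 \<le> k" and re: "\<bar>Re z\<bar> = pi / (2 * k)"
  shows "Im (cosec_sum k z) = 0"
proof -
  have "pi / (2 * k) < pi / k" using k by (simp add: field_simps)
  moreover have "exp z \<noteq> 1"
  proof
    assume "exp z = 1"
    then have "Re z = 0" using norm_exp_eq_Re[of z] by (metis exp_eq_one_iff norm_one)
    then show False using re k by simp
  qed
  ultimately have dom: "z \<in> tail_domain k" using re by (simp add: tail_domain_def)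
  have real: "Im (cosec k w) = 0" if "\<bar>Re w\<bar> = pi / (2 * k)" for w
  proof -
    have "k * Re w = pi / 2 \<or> k * Re w = - (pi / 2)"
      using that k by (auto simp: abs_if field_simps split: if_splits)
    then have "cos (k * Re w) = 0" by (elim disjE) (simp_all only: cos_minus cos_pi_half)
    then have "Im (sin (of_real k * w)) = 0" by (simp add: Im_sin)
    then show ?thesis by (simp add: cosec_def Im_divide)
  qed
  have "Im (cosec_pair k n z) = 0" for n
    using re by (simp add: cosec_pair_def real)
  then have "(\<lambda>n. 0) sums Im (cosec_tail k z)"
    using sums_Im[OF cosec_tail_properties(1)[OF k dom]] by simp
  then have "Im (cosec_tail k z) = 0" using sums_unique2 sums_zero by blast
  then show ?thesis using real[OF re] by (simp add: cosec_sum_def)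
qed

section \<open>The complex potential\<close>

lemma cosec_sum_Ln_has_derivative:
  assumes k: "1 \<le> k" and T: "T \<noteq> 0" "T \<noteq> 1" "\<bar>ln (norm T)\<bar> < pi / k"
  shows "((\<lambda>T. cosec_sum k (Ln T)) has_field_derivative
    (cosec' k (Ln T) + cosec_tail' k (Ln T)) / T) (at T)"
proof -
  define S where "S = {w::complex. w \<noteq> 0 \<and> w \<noteq> 1 \<and> \<bar>ln (norm w)\<bar> < pi / k}"
  have "open S"
  proof -
    have op: "open ({w::complex. w \<noteq> 0} \<inter> {w. w \<noteq> 1})" by (intro open_Int open_Collect_neq continuous_intros)
    moreover have "continuous_on ({w::complex. w \<noteq> 0} \<inter> {w. w \<noteq> 1}) (\<lambda>w. \<bar>ln (norm w)\<bar>)"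
      by (intro continuous_intros) auto
    ultimately have "open (({w::complex. w \<noteq> 0} \<inter> {w. w \<noteq> 1}) \<inter> (\<lambda>w. \<bar>ln (norm w)\<bar>) -` {..<pi / k})"
      by (intro continuous_open_preimage) auto
    moreover have "S = ({w::complex. w \<noteq> 0} \<inter> {w. w \<noteq> 1}) \<inter> (\<lambda>w. \<bar>ln (norm w)\<bar>) -` {..<pi / k}"
      by (auto simp: S_def)
    ultimately show ?thesis by simp
  qed
  define L where "L = (\<lambda>w. Ln (w / T) + Ln T)"
  have "((\<lambda>w. w / T) has_field_derivative 1 / T) (at T)"
    by (intro DERIV_cdivide DERIV_ident)
  moreover have "(Ln has_field_derivative inverse (T / T)) (at (T / T))"
    using T by (intro has_field_derivative_Ln) simp
  ultimately have "((\<lambda>w. Ln (w / T)) has_field_derivative inverse (T / T) * (1 / T)) (at T)"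
    by (rule DERIV_chain2[rotated])
  then have dL: "(L has_field_derivative 1 / T) (at T)"
    unfolding L_def using T by (auto intro!: derivative_eq_intros)
  have LT: "L T = Ln T" using T by (simp add: L_def)
  have "(cosec_sum k has_field_derivative cosec' k (L T) + cosec_tail' k (L T)) (at (L T))"
    unfolding LT using T by (intro cosec_sum_has_derivative[OF k]) auto
  from DERIV_chain2[OF this dL]
  have "((\<lambda>w. cosec_sum k (L w)) has_field_derivative (cosec' k (Ln T) + cosec_tail' k (Ln T)) * (1 / T)) (at T)"
    by (simp add: LT)
  then have "((\<lambda>w. cosec_sum k (Ln w)) has_field_derivative (cosec' k (Ln T) + cosec_tail' k (Ln T)) * (1 / T)) (at T)"
  proof (rule has_field_derivative_transform_within_open[OF _ \<open>open S\<close>])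
    show "T \<in> S" using T by (simp add: S_def)
    show "cosec_sum k (L w) = cosec_sum k (Ln w)" if "w \<in> S" for w
    proof (rule cosec_sum_periodic[OF k])
      show "\<bar>Re (Ln w)\<bar> < pi / k" "exp (Ln w) \<noteq> 1" using that by (auto simp: S_def)
      show "exp (L w) = exp (Ln w)" using that T by (simp add: S_def L_def exp_add)
    qed
  qed
  then show ?thesis by simp
qed

lemma reciprocal_simple_zero:
  assumes r: "0 < r" and h: "h holomorphic_on ball z0 r" "h z0 = 0"
    and \<mu>: "(h has_field_derivative \<mu>) (at z0)" "\<mu> \<noteq> 0"
  shows "\<exists>\<rho>>0. \<exists>B. \<forall>z. 0 < dist z z0 \<and> dist z z0 < \<rho> \<longrightarrow> norm (\<mu> / h z - 1 / (z - z0)) \<le> B"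
proof -
  have dm: "deriv h z0 = \<mu>" using \<mu>(1) by (rule DERIV_imp_deriv)
  define q where "q = (\<lambda>z. if z = z0 then deriv h z0 else (h z - h z0) / (z - z0))"
  have q: "q holomorphic_on ball z0 r" unfolding q_def by (rule pole_lemma[OF h(1)]) (use r in simp)
  have q0: "q z0 = \<mu>" by (simp add: q_def dm)
  have "isCont q z0" using q r by (meson centre_in_ball continuous_on_eq_continuous_at holomorphic_on_imp_continuous_on open_ball)
  then obtain s where s: "0 < s" "\<And>z. dist z z0 < s \<Longrightarrow> q z \<noteq> 0"
    using continuous_at_avoid[of z0 q 0] q0 \<mu>(2) by (metis dist_commute)
  define t where "t = min r s"
  have t: "0 < t" using r s by (simp add: t_def)
  define g where "g = (\<lambda>z. \<mu> / q z - 1)"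
  have g: "g holomorphic_on ball z0 t" unfolding g_def
    by (intro holomorphic_intros holomorphic_on_subset[OF q]) (use s in \<open>auto simp: t_def dist_commute\<close>)
  define G where "G = (\<lambda>z. if z = z0 then deriv g z0 else (g z - g z0) / (z - z0))"
  have "G holomorphic_on ball z0 t" unfolding G_def by (rule pole_lemma[OF g]) (use t in simp)
  then have "continuous_on (ball z0 t) G" by (rule holomorphic_on_imp_continuous_on)
  then have "continuous_on (cball z0 (t / 2)) G"
    by (rule continuous_on_subset) (use t in auto)
  then have "compact (G ` cball z0 (t / 2))" by (intro compact_continuous_image) auto
  then obtain B where B: "\<And>w. w \<in> cball z0 (t / 2) \<Longrightarrow> norm (G w) \<le> B"
    using compact_imp_bounded bounded_iff by (metis imageI)
  have "norm (\<mu> / h z - 1 / (z - z0)) \<le> B" if z: "0 < dist z z0" "dist z z0 < t / 2" for z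
  proof -
    have zz: "z \<noteq> z0" using z by auto
    have "q z \<noteq> 0" using s(2)[of z] z t by (simp add: t_def)
    moreover have "h z = q z * (z - z0)" using zz h(2) by (simp add: q_def)
    moreover have "g z0 = 0" using q0 \<mu>(2) by (simp add: g_def)
    ultimately have "\<mu> / h z - 1 / (z - z0) = G z"
      using zz by (simp add: G_def g_def diff_divide_distrib)
    then show ?thesis using B[of z] z by (simp add: dist_commute)
  qed
  then show ?thesis using t by (intro exI[of _ "t / 2"]) auto
qed

text \<open>
  The points \<open>\<plusminus>foc \<epsilon>\<close> are the foci of the bipolar coordinates in which both circles are coordinate
  lines; \<open>cross \<epsilon> p z\<close> is the exponential of the bipolar coordinate of \<open>z\<close> relative to the emitter.
\<close>

definition foc :: "real \<Rightarrow> real" where "foc \<epsilon> = sqrt (\<epsilon> + \<epsilon>\<^sup>2 / 4)"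
definition cen :: "real \<Rightarrow> real" where "cen \<epsilon> = 1 + \<epsilon> / 2"
definition hw :: "real \<Rightarrow> real" where "hw \<epsilon> = ln (cen \<epsilon> + foc \<epsilon>)"
definition freq :: "real \<Rightarrow> real" where "freq \<epsilon> = pi / (2 * hw \<epsilon>)"

definition cross :: "real \<Rightarrow> real \<Rightarrow> complex \<Rightarrow> complex" where
  "cross \<epsilon> p z = (of_real (foc \<epsilon>) - \<i> * of_real p) / (of_real (foc \<epsilon>) + \<i> * of_real p)
     * ((of_real (foc \<epsilon>) + z) / (of_real (foc \<epsilon>) - z))"

definition pot :: "real \<Rightarrow> real \<Rightarrow> complex \<Rightarrow> complex" where
  "pot \<epsilon> p z = cosec_sum (freq \<epsilon>) (Ln (cross \<epsilon> p z))"

definition pot_domain :: "real \<Rightarrow> real \<Rightarrow> complex set" where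
  "pot_domain \<epsilon> p = {z. z \<noteq> of_real (foc \<epsilon>) \<and> z \<noteq> - of_real (foc \<epsilon>) \<and>
     \<bar>ln (norm (cross \<epsilon> p z))\<bar> < pi / freq \<epsilon> \<and> z \<noteq> \<i> * of_real p}"

locale gap =
  fixes \<epsilon> :: real
  assumes eps: "0 < \<epsilon>" "\<epsilon> \<le> 1/10"
begin

abbreviation "\<alpha> \<equiv> foc \<epsilon>"
abbreviation "a \<equiv> cen \<epsilon>"

lemma foc_square: "\<alpha>\<^sup>2 = \<epsilon> + \<epsilon>\<^sup>2 / 4"
  using eps by (simp add: foc_def)

lemma foc_pos: "0 < \<alpha>"
  using eps by (simp add: foc_def add_pos_pos)

lemma cen_gt_1: "1 < a"
  using eps by (simp add: cen_def)

lemma cen_foc: "(a + \<alpha>) * (a - \<alpha>) = 1" "a\<^sup>2 = 1 + \<alpha>\<^sup>2"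
  using foc_square by (simp_all add: cen_def power2_eq_square algebra_simps)

lemma foc_less_cen: "\<alpha> < a"
proof -
  have "\<alpha>\<^sup>2 < a\<^sup>2" unfolding cen_foc(2) by simp
  then show ?thesis by (rule power2_less_imp_less) (use cen_gt_1 in simp)
qed

lemma foc_bounds: "sqrt \<epsilon> \<le> \<alpha>" "\<alpha> \<le> 2 * sqrt \<epsilon>" "\<alpha> \<le> 1/2" "\<epsilon> \<le> sqrt \<epsilon>"
proof -
  show "sqrt \<epsilon> \<le> \<alpha>" using eps by (simp add: foc_def)
  have e2: "\<epsilon>\<^sup>2 \<le> \<epsilon>" using eps by (simp add: power2_eq_square mult_left_le_one_le)
  have "\<alpha> \<le> sqrt (4 * \<epsilon>)" unfolding foc_def using e2 eps by (intro real_sqrt_le_mono) simp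
  then show "\<alpha> \<le> 2 * sqrt \<epsilon>" by (simp add: real_sqrt_mult)
  have "\<alpha>\<^sup>2 \<le> 1/4" unfolding foc_square using e2 eps by linarith
  then have "\<alpha>\<^sup>2 \<le> (1/2)\<^sup>2" by (simp add: power_divide)
  then show "\<alpha> \<le> 1/2" by (rule power2_le_imp_le) simp
  have "sqrt (\<epsilon>\<^sup>2) \<le> sqrt \<epsilon>" using e2 by (rule real_sqrt_le_mono)
  then show "\<epsilon> \<le> sqrt \<epsilon>" using eps by simp
qed

lemma hw_pos: "0 < hw \<epsilon>"
  unfolding hw_def using cen_gt_1 foc_pos by (intro ln_gt_zero) simp

lemma hw_bounds: "hw \<epsilon> \<le> 3 * sqrt \<epsilon>" "hw \<epsilon> \<le> 1"
proof -
  have "hw \<epsilon> \<le> a + \<alpha> - 1" unfolding hw_def using cen_gt_1 foc_pos by (intro ln_le_minus_one) simp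
  then have le: "hw \<epsilon> \<le> \<epsilon> / 2 + \<alpha>" by (simp add: cen_def)
  show "hw \<epsilon> \<le> 3 * sqrt \<epsilon>" using le foc_bounds eps by linarith
  show "hw \<epsilon> \<le> 1" using le foc_bounds eps by linarith
qed

lemma freq_facts: "1 \<le> freq \<epsilon>" "pi / freq \<epsilon> = 2 * hw \<epsilon>" "pi / (2 * freq \<epsilon>) = hw \<epsilon>" "1 / (2 * sqrt \<epsilon>) \<le> freq \<epsilon>"
proof -
  have "2 * hw \<epsilon> \<le> pi" using hw_bounds(2) pi_gt3 by linarith
  then show "1 \<le> freq \<epsilon>" using hw_pos by (simp add: freq_def)
  show "pi / freq \<epsilon> = 2 * hw \<epsilon>" "pi / (2 * freq \<epsilon>) = hw \<epsilon>" by (simp_all add: freq_def)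
  have "1 / (2 * sqrt \<epsilon>) = 3 / (2 * (3 * sqrt \<epsilon>))" by simp
  also have "\<dots> \<le> pi / (2 * hw \<epsilon>)"
    using pi_gt3 hw_pos hw_bounds(1) by (intro frac_le) auto
  finally show "1 / (2 * sqrt \<epsilon>) \<le> freq \<epsilon>" by (simp add: freq_def)
qed

lemma foc_ip_nonzero: "of_real \<alpha> + \<i> * of_real p \<noteq> (0::complex)" "of_real \<alpha> - \<i> * of_real p \<noteq> (0::complex)"
  using foc_pos by (auto simp: complex_eq_iff)

lemma norm_foc_ip: "norm (of_real \<alpha> - \<i> * of_real p :: complex) = norm (of_real \<alpha> + \<i> * of_real p :: complex)"
  by (simp add: cmod_def)

lemma norm_cross: "norm (cross \<epsilon> p z) = norm (of_real \<alpha> + z) / norm (of_real \<alpha> - z)"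
  using foc_ip_nonzero[of p] by (simp add: cross_def norm_mult norm_divide norm_foc_ip)

lemma Apollonius:
  fixes z :: complex
  shows
  "(a + \<alpha>)\<^sup>2 * (norm (of_real \<alpha> - z))\<^sup>2 - (norm (of_real \<alpha> + z))\<^sup>2 = ((a + \<alpha>)\<^sup>2 - 1) * ((norm (z - of_real a))\<^sup>2 - 1)"
  "(a + \<alpha>)\<^sup>2 * (norm (of_real \<alpha> + z))\<^sup>2 - (norm (of_real \<alpha> - z))\<^sup>2 = ((a + \<alpha>)\<^sup>2 - 1) * ((norm (z + of_real a))\<^sup>2 - 1)"
proof -
  have poly: "(a + \<alpha>)\<^sup>2 * ((\<alpha> - x)\<^sup>2 + y) - ((\<alpha> + x)\<^sup>2 + y) = ((a + \<alpha>)\<^sup>2 - 1) * ((x - a)\<^sup>2 + y - 1)" for x y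
    using cen_foc(2) by algebra
  show "(a + \<alpha>)\<^sup>2 * (norm (of_real \<alpha> - z))\<^sup>2 - (norm (of_real \<alpha> + z))\<^sup>2 = ((a + \<alpha>)\<^sup>2 - 1) * ((norm (z - of_real a))\<^sup>2 - 1)"
    using poly[of "Re z" "(Im z)\<^sup>2"] by (simp add: cmod_power2)
  show "(a + \<alpha>)\<^sup>2 * (norm (of_real \<alpha> + z))\<^sup>2 - (norm (of_real \<alpha> - z))\<^sup>2 = ((a + \<alpha>)\<^sup>2 - 1) * ((norm (z + of_real a))\<^sup>2 - 1)"
    using poly[of "- Re z" "(Im z)\<^sup>2"] by (simp add: cmod_power2 power2_commute algebra_simps)
qed

lemma outside_not_foc:
  fixes z :: complex
  assumes "1 \<le> norm (z - of_real a)" "1 \<le> norm (z + of_real a)"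
  shows "of_real \<alpha> - z \<noteq> 0" "of_real \<alpha> + z \<noteq> 0" "z \<noteq> of_real \<alpha>" "z \<noteq> - of_real \<alpha>"
proof -
  have "a - \<alpha> < 1"
  proof -
    have "1 < a + \<alpha>" using cen_gt_1 foc_pos by simp
    then have "1 * (a - \<alpha>) < (a + \<alpha>) * (a - \<alpha>)" using foc_less_cen by (intro mult_strict_right_mono) auto
    then show ?thesis unfolding cen_foc(1) by simp
  qed
  then have "norm (of_real \<alpha> - of_real a :: complex) < 1" "norm (- of_real \<alpha> + of_real a :: complex) < 1"
    using foc_less_cen by (simp_all flip: of_real_diff of_real_minus of_real_add)
  then show "z \<noteq> of_real \<alpha>" "z \<noteq> - of_real \<alpha>" using assms by auto
  then show "of_real \<alpha> - z \<noteq> 0" "of_real \<alpha> + z \<noteq> 0" by (auto simp: add_eq_0_iff)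
qed

lemma ln_cross_outside:
  assumes "1 \<le> norm (z - of_real a)" "1 \<le> norm (z + of_real a)"
  shows "ln (norm (cross \<epsilon> p z)) \<le> hw \<epsilon>" "- hw \<epsilon> \<le> ln (norm (cross \<epsilon> p z))"
    and "norm (z - of_real a) = 1 \<Longrightarrow> ln (norm (cross \<epsilon> p z)) = hw \<epsilon>"
    and "norm (z + of_real a) = 1 \<Longrightarrow> ln (norm (cross \<epsilon> p z)) = - hw \<epsilon>"
proof -
  define s t where "s = norm (of_real \<alpha> - z)" and "t = norm (of_real \<alpha> + z)"
  have st: "0 < s" "0 < t" using outside_not_foc[OF assms] by (simp_all add: s_def t_def)
  have n: "norm (cross \<epsilon> p z) = t / s" by (simp add: norm_cross s_def t_def)
  have ap: "1 < a + \<alpha>" using cen_gt_1 foc_pos by simp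
  then have q: "0 < (a + \<alpha>)\<^sup>2 - 1" by simp
  have A1: "((a + \<alpha>) * s)\<^sup>2 - t\<^sup>2 = ((a + \<alpha>)\<^sup>2 - 1) * ((norm (z - of_real a))\<^sup>2 - 1)"
    using Apollonius(1)[of z] by (simp add: s_def t_def power_mult_distrib)
  have A2: "((a + \<alpha>) * t)\<^sup>2 - s\<^sup>2 = ((a + \<alpha>)\<^sup>2 - 1) * ((norm (z + of_real a))\<^sup>2 - 1)"
    using Apollonius(2)[of z] by (simp add: s_def t_def power_mult_distrib)
  have "0 \<le> ((a + \<alpha>)\<^sup>2 - 1) * ((norm (z - of_real a))\<^sup>2 - 1)" "0 \<le> ((a + \<alpha>)\<^sup>2 - 1) * ((norm (z + of_real a))\<^sup>2 - 1)"
    using q assms by (auto intro!: mult_nonneg_nonneg simp: one_le_power)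
  then have "t\<^sup>2 \<le> ((a + \<alpha>) * s)\<^sup>2" "s\<^sup>2 \<le> ((a + \<alpha>) * t)\<^sup>2" using A1 A2 by linarith+
  then have le: "t \<le> (a + \<alpha>) * s" "s \<le> (a + \<alpha>) * t"
    using st ap by (auto intro: power2_le_imp_le)
  have lt: "ln t \<le> hw \<epsilon> + ln s"
    using le(1) st ap by (simp add: hw_def flip: ln_mult_pos)
  have ls: "ln s \<le> hw \<epsilon> + ln t"
    using le(2) st ap by (simp add: hw_def flip: ln_mult_pos)
  have lnn: "ln (norm (cross \<epsilon> p z)) = ln t - ln s" unfolding n using st by (simp add: ln_div)
  show "ln (norm (cross \<epsilon> p z)) \<le> hw \<epsilon>" "- hw \<epsilon> \<le> ln (norm (cross \<epsilon> p z))"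
    unfolding lnn using lt ls by linarith+
  show "ln (norm (cross \<epsilon> p z)) = hw \<epsilon>" if "norm (z - of_real a) = 1"
  proof -
    have "t\<^sup>2 = ((a + \<alpha>) * s)\<^sup>2" using A1 that by simp
    then have "t = (a + \<alpha>) * s" using st ap by (simp add: power2_eq_iff_nonneg)
    then show ?thesis using st ap by (simp add: n hw_def)
  qed
  show "ln (norm (cross \<epsilon> p z)) = - hw \<epsilon>" if "norm (z + of_real a) = 1"
  proof -
    have "s\<^sup>2 = ((a + \<alpha>) * t)\<^sup>2" using A2 that by simp
    then have "s = (a + \<alpha>) * t" using st ap by (simp add: power2_eq_iff_nonneg)
    then show ?thesis unfolding lnn using st ap by (simp add: hw_def ln_mult_pos)
  qed
qed

lemma outside_pot_domain:
  assumes "1 \<le> norm (z - of_real a)" "1 \<le> norm (z + of_real a)" "z \<noteq> \<i> * of_real p"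
  shows "z \<in> pot_domain \<epsilon> p"
  unfolding pot_domain_def
  using outside_not_foc[OF assms(1,2)] ln_cross_outside(1,2)[OF assms(1,2), of p] hw_pos assms(3) freq_facts(2)
  by (auto simp: abs_if)

lemma cross_minus_1:
  assumes "z \<noteq> of_real \<alpha>"
  shows "cross \<epsilon> p z - 1 = 2 * of_real \<alpha> * (z - \<i> * of_real p) / ((of_real \<alpha> - z) * (of_real \<alpha> + \<i> * of_real p))"
proof -
  define A B D where "A = of_real \<alpha> + \<i> * of_real p" and "B = of_real \<alpha> - \<i> * of_real p"
    and "D = of_real \<alpha> - z"
  have nz: "D * A \<noteq> 0" using assms foc_ip_nonzero(1)[of p] by (simp add: A_def D_def)
  have "cross \<epsilon> p z = B * (of_real \<alpha> + z) / (D * A)"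
    by (simp add: cross_def A_def B_def D_def mult.commute)
  then have "cross \<epsilon> p z - 1 = (B * (of_real \<alpha> + z) - D * A) / (D * A)"
    using nz by (simp add: diff_divide_distrib)
  also have "B * (of_real \<alpha> + z) - D * A = 2 * of_real \<alpha> * (z - \<i> * of_real p)"
    by (simp add: A_def B_def D_def algebra_simps)
  finally show ?thesis by (simp add: A_def D_def)
qed

lemma cross_eq_1_iff: "z \<noteq> of_real \<alpha> \<Longrightarrow> cross \<epsilon> p z = 1 \<longleftrightarrow> z = \<i> * of_real p"
  using cross_minus_1[of z p] foc_ip_nonzero(1)[of p] foc_pos
  by (metis (no_types, lifting) divide_eq_0_iff eq_iff_diff_eq_0 mult_eq_0_iff of_real_eq_0_iff order_less_irrefl zero_neq_numeral)

lemma cross_nonzero: "z \<noteq> of_real \<alpha> \<Longrightarrow> z \<noteq> - of_real \<alpha> \<Longrightarrow> cross \<epsilon> p z \<noteq> 0"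
  using foc_ip_nonzero[of p] by (auto simp: cross_def add_eq_0_iff)

lemma cross_has_derivative:
  assumes "z \<noteq> of_real \<alpha>" "z \<noteq> - of_real \<alpha>"
  shows "(cross \<epsilon> p has_field_derivative cross \<epsilon> p z * (2 * of_real \<alpha> / ((of_real \<alpha>)\<^sup>2 - z\<^sup>2))) (at z)"
proof -
  define c where "c = (of_real \<alpha> - \<i> * of_real p) / (of_real \<alpha> + \<i> * of_real p)"
  have nz: "of_real \<alpha> - z \<noteq> 0" "of_real \<alpha> + z \<noteq> 0" using assms by (auto simp: add_eq_0_iff)
  have "((\<lambda>z. c * ((of_real \<alpha> + z) / (of_real \<alpha> - z))) has_field_derivative
      c * ((1 * (of_real \<alpha> - z) - (of_real \<alpha> + z) * (- 1)) / ((of_real \<alpha> - z) * (of_real \<alpha> - z)))) (at z)"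
    by (intro DERIV_cmult DERIV_divide nz) (auto intro!: derivative_eq_intros)
  moreover have "c * ((1 * (of_real \<alpha> - z) - (of_real \<alpha> + z) * (- 1)) / ((of_real \<alpha> - z) * (of_real \<alpha> - z)))
      = c * ((of_real \<alpha> + z) / (of_real \<alpha> - z)) * (2 * of_real \<alpha> / ((of_real \<alpha>)\<^sup>2 - z\<^sup>2))"
  proof -
    have "(of_real \<alpha>)\<^sup>2 - z\<^sup>2 = (of_real \<alpha> + z) * (of_real \<alpha> - z)" by (simp add: power2_eq_square algebra_simps)
    then show ?thesis using nz by simp
  qed
  ultimately show ?thesis unfolding cross_def c_def[symmetric] by simp
qed

lemma cross_holomorphic: "cross \<epsilon> p holomorphic_on {z. z \<noteq> of_real \<alpha> \<and> z \<noteq> - of_real \<alpha>}"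
  using cross_has_derivative has_field_derivative_at_within unfolding holomorphic_on_def field_differentiable_def by blast

lemma open_not_foc: "open {z::complex. z \<noteq> of_real \<alpha> \<and> z \<noteq> - of_real \<alpha>}"
  by (intro open_Collect_conj open_Collect_neq continuous_intros)

lemma pot_has_derivative:
  assumes "z \<in> pot_domain \<epsilon> p"
  defines "\<zeta> \<equiv> Ln (cross \<epsilon> p z)"
  shows "(pot \<epsilon> p has_field_derivative
    (cosec' (freq \<epsilon>) \<zeta> + cosec_tail' (freq \<epsilon>) \<zeta>) * (2 * of_real \<alpha> / ((of_real \<alpha>)\<^sup>2 - z\<^sup>2))) (at z)"
proof -
  have z: "z \<noteq> of_real \<alpha>" "z \<noteq> - of_real \<alpha>" "\<bar>ln (norm (cross \<epsilon> p z))\<bar> < pi / freq \<epsilon>" "z \<noteq> \<i> * of_real p"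
    using assms(1) by (auto simp: pot_domain_def)
  have T: "cross \<epsilon> p z \<noteq> 0" "cross \<epsilon> p z \<noteq> 1" using cross_nonzero cross_eq_1_iff z by auto
  have "((\<lambda>z. cosec_sum (freq \<epsilon>) (Ln (cross \<epsilon> p z))) has_field_derivative
      (cosec' (freq \<epsilon>) \<zeta> + cosec_tail' (freq \<epsilon>) \<zeta>) / cross \<epsilon> p z * (cross \<epsilon> p z * (2 * of_real \<alpha> / ((of_real \<alpha>)\<^sup>2 - z\<^sup>2)))) (at z)"
    unfolding \<zeta>_def
    by (rule DERIV_chain2[OF cosec_sum_Ln_has_derivative[OF freq_facts(1) T z(3)] cross_has_derivative[OF z(1,2)]])
  then show ?thesis unfolding pot_def using T(1) by simp
qed

lemma open_pot_domain: "open (pot_domain \<epsilon> p)"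
proof -
  let ?N = "{z::complex. z \<noteq> of_real \<alpha> \<and> z \<noteq> - of_real \<alpha>} \<inter> {z. z \<noteq> \<i> * of_real p}"
  have op: "open ?N" by (intro open_Int open_not_foc open_Collect_neq continuous_intros)
  have "continuous_on ?N (cross \<epsilon> p)"
    by (rule continuous_on_subset[OF holomorphic_on_imp_continuous_on[OF cross_holomorphic]]) auto
  then have "continuous_on ?N (\<lambda>z. \<bar>ln (norm (cross \<epsilon> p z))\<bar>)"
    using cross_nonzero by (intro continuous_intros) auto
  then have "open (?N \<inter> (\<lambda>z. \<bar>ln (norm (cross \<epsilon> p z))\<bar>) -` {..<pi / freq \<epsilon>})"
    using op by (intro continuous_open_preimage) auto
  moreover have "pot_domain \<epsilon> p = ?N \<inter> (\<lambda>z. \<bar>ln (norm (cross \<epsilon> p z))\<bar>) -` {..<pi / freq \<epsilon>}"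
    by (auto simp: pot_domain_def)
  ultimately show ?thesis by simp
qed

lemma pot_holomorphic: "pot \<epsilon> p holomorphic_on pot_domain \<epsilon> p"
  using pot_has_derivative has_field_derivative_at_within unfolding holomorphic_on_def field_differentiable_def by blast

lemma Im_pot_boundary:
  assumes "1 \<le> norm (z - of_real a)" "1 \<le> norm (z + of_real a)"
    and "norm (z - of_real a) = 1 \<or> norm (z + of_real a) = 1"
  shows "Im (pot \<epsilon> p z) = 0"
  unfolding pot_def
proof (rule Im_cosec_sum_boundary[OF freq_facts(1)])
  have "\<bar>ln (norm (cross \<epsilon> p z))\<bar> = hw \<epsilon>"
    using assms(3) ln_cross_outside(3,4)[OF assms(1,2), of p] hw_pos by auto
  then show "\<bar>Re (Ln (cross \<epsilon> p z))\<bar> = pi / (2 * freq \<epsilon>)"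
    using cross_nonzero outside_not_foc[OF assms(1,2)] by (simp add: freq_facts(3))
qed

lemma pot_bounded_at_infinity: "\<exists>R B. \<forall>z. R \<le> norm z \<longrightarrow> norm (pot \<epsilon> p z) \<le> B"
proof -
  define c where "c = (of_real \<alpha> - \<i> * of_real p) / (of_real \<alpha> + \<i> * of_real p)"
  have nc: "norm c = 1" using foc_ip_nonzero[of p] by (simp add: c_def norm_divide norm_foc_ip)
  have "((\<lambda>z::complex. 2 * of_real \<alpha> / (of_real \<alpha> - z)) \<longlongrightarrow> 0) at_infinity"
  proof (rule tendsto_divide_0[OF tendsto_const])
    have "filterlim (\<lambda>z. of_real \<alpha> + (- z)) at_infinity (at_infinity :: complex filter)"
      by (rule tendsto_add_filterlim_at_infinity[OF tendsto_const])
        (simp add: filterlim_at_infinity_conv_norm_at_top filterlim_norm_at_top)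
    then show "filterlim (\<lambda>z. of_real \<alpha> - z) at_infinity (at_infinity :: complex filter)" by simp
  qed
  then have l1: "((\<lambda>z. c * (2 * of_real \<alpha> / (of_real \<alpha> - z) - 1)) \<longlongrightarrow> c * (0 - 1)) at_infinity"
    by (intro tendsto_intros)
  have ev: "\<forall>\<^sub>F z in at_infinity. c * (2 * of_real \<alpha> / (of_real \<alpha> - z) - 1) = cross \<epsilon> p z"
    unfolding eventually_at_infinity
  proof (intro exI[of _ "\<alpha> + 1"] allI impI)
    fix z :: complex assume "\<alpha> + 1 \<le> norm z"
    then have "z \<noteq> of_real \<alpha>" using foc_pos by auto
    then have "2 * of_real \<alpha> / (of_real \<alpha> - z) - 1 = (of_real \<alpha> + z) / (of_real \<alpha> - z)"
      by (simp add: field_simps)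
    then show "c * (2 * of_real \<alpha> / (of_real \<alpha> - z) - 1) = cross \<epsilon> p z"
      by (simp only: cross_def c_def)
  qed
  have lim: "(cross \<epsilon> p \<longlongrightarrow> - c) at_infinity"
    using Lim_transform_eventually[OF l1 ev] by simp
  have c1: "- c \<noteq> 1"
  proof
    assume "- c = 1"
    then have "- (of_real \<alpha> - \<i> * of_real p) = (of_real \<alpha> + \<i> * of_real p :: complex)"
      using foc_ip_nonzero(1)[of p] by (simp add: c_def field_simps)
    then show False using foc_pos by (simp add: complex_eq_iff)
  qed
  have c0: "- c \<noteq> 0" using nc by auto
  have ln_c: "\<bar>ln (norm (- c))\<bar> < pi / freq \<epsilon>" using nc freq_facts(2) hw_pos by simp
  define g l where "g = (\<lambda>T. cosec_sum (freq \<epsilon>) (Ln T))" and "l = g (- c)"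
  have "isCont g (- c)"
    unfolding g_def by (rule DERIV_isCont[OF cosec_sum_Ln_has_derivative[OF freq_facts(1) c0 c1 ln_c]])
  from isCont_tendsto_compose[OF this lim] have "(pot \<epsilon> p \<longlongrightarrow> l) at_infinity"
    by (simp add: g_def l_def pot_def[abs_def])
  then have "\<forall>\<^sub>F z in at_infinity. dist (pot \<epsilon> p z) l < 1" by (rule tendstoD) simp
  then obtain R where R: "\<forall>z. R \<le> norm z \<longrightarrow> dist (pot \<epsilon> p z) l < 1"
    unfolding eventually_at_infinity by (rule exE)
  have "norm (pot \<epsilon> p z) \<le> norm l + 1" if "R \<le> norm z" for z
    using R[rule_format, OF that] norm_triangle_sub[of "pot \<epsilon> p z" l] by (simp add: dist_norm)
  then show ?thesis by blast
qed

definition slope :: "real \<Rightarrow> real" where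
  "slope p = 2 * \<alpha> / (\<alpha>\<^sup>2 + p\<^sup>2)"

lemma slope_pos: "0 < slope p"
  unfolding slope_def using foc_pos by (simp add: add_pos_nonneg)

lemma pot_singular_part:
  "\<exists>\<rho>>0. \<exists>B. \<forall>z. 0 < dist z (\<i> * of_real p) \<and> dist z (\<i> * of_real p) < \<rho> \<longrightarrow>
     norm (of_real (slope p) * pot \<epsilon> p z - 1 / (z - \<i> * of_real p)) \<le> B"
proof -
  define k where "k = freq \<epsilon>"
  define z0 where "z0 = \<i> * of_real p"
  have k: "1 \<le> k" using freq_facts by (simp add: k_def)
  have z0: "z0 \<noteq> of_real \<alpha>" "z0 \<noteq> - of_real \<alpha>" using foc_pos by (auto simp: z0_def complex_eq_iff)
  have c0: "cross \<epsilon> p z0 = 1" using cross_eq_1_iff[of z0 p] z0 by (simp add: z0_def)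
  let ?N = "{z::complex. z \<noteq> of_real \<alpha> \<and> z \<noteq> - of_real \<alpha>}"
  have contc: "continuous_on ?N (cross \<epsilon> p)" by (rule holomorphic_on_imp_continuous_on[OF cross_holomorphic])
  have "open (?N \<inter> cross \<epsilon> p -` (- \<real>\<^sub>\<le>\<^sub>0))"
    by (rule continuous_open_preimage[OF contc open_not_foc]) (simp add: open_Compl)
  moreover have "z0 \<in> ?N \<inter> cross \<epsilon> p -` (- \<real>\<^sub>\<le>\<^sub>0)" using z0 c0 by simp
  ultimately obtain r where r: "0 < r" "ball z0 r \<subseteq> ?N \<inter> cross \<epsilon> p -` (- \<real>\<^sub>\<le>\<^sub>0)"
    using open_contains_ball by blast
  define l where "l = (\<lambda>z. Ln (cross \<epsilon> p z))"
  have l: "l holomorphic_on ball z0 r" unfolding l_def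
    by (intro holomorphic_intros holomorphic_on_subset[OF cross_holomorphic]) (use r in auto)
  have l0: "l z0 = 0" by (simp add: l_def c0)
  have sq: "(of_real \<alpha>)\<^sup>2 - z0\<^sup>2 = of_real (\<alpha>\<^sup>2 + p\<^sup>2)" by (simp add: z0_def power_mult_distrib)
  have dc: "(cross \<epsilon> p has_field_derivative of_real (slope p)) (at z0)"
    using cross_has_derivative[OF z0, of p] unfolding sq c0 by (simp add: slope_def)
  have "(Ln has_field_derivative inverse (cross \<epsilon> p z0)) (at (cross \<epsilon> p z0))"
    by (rule has_field_derivative_Ln) (simp add: c0)
  from DERIV_chain2[OF this dc] have dl: "(l has_field_derivative of_real (slope p)) (at z0)"
    by (simp add: l_def c0)
  define h where "h = (\<lambda>z. sin (of_real k * l z) / of_real k)"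
  have hh: "h holomorphic_on ball z0 r" unfolding h_def by (intro holomorphic_intros l) (use k in auto)
  have h0: "h z0 = 0" by (simp add: h_def l0)
  have dh: "(h has_field_derivative of_real (slope p)) (at z0)"
    unfolding h_def using k by (auto intro!: derivative_eq_intros dl simp: l0)
  have mu: "of_real (slope p) \<noteq> (0::complex)" using slope_pos[of p] by simp
  obtain \<rho>1 B1 where \<rho>1: "0 < \<rho>1" "\<And>z. 0 < dist z z0 \<Longrightarrow> dist z z0 < \<rho>1 \<Longrightarrow>
      norm (of_real (slope p) / h z - 1 / (z - z0)) \<le> B1"
    using reciprocal_simple_zero[OF r(1) hh h0 dh mu] by blast
  have dom0: "0 \<in> tail_domain k" using k by (simp add: tail_domain_def)
  have "isCont (cosec_tail k) (l z0)"
    unfolding l0 by (rule DERIV_isCont[OF cosec_tail_properties(3)[OF k dom0]])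
  from isCont_o2[OF DERIV_isCont[OF dl] this]
  have "\<exists>\<rho>>0. \<forall>z. dist z z0 < \<rho> \<longrightarrow> dist (cosec_tail k (l z)) (cosec_tail k (l z0)) < 1"
    unfolding continuous_at_eps_delta by (elim allE[of _ 1]) simp
  then obtain \<rho>2 where \<rho>2: "0 < \<rho>2" "\<And>z. dist z z0 < \<rho>2 \<Longrightarrow> dist (cosec_tail k (l z)) (cosec_tail k (l z0)) < 1"
    by blast
  define B where "B = B1 + slope p * (norm (cosec_tail k (l z0)) + 1)"
  have "norm (of_real (slope p) * pot \<epsilon> p z - 1 / (z - z0)) \<le> B"
    if z: "0 < dist z z0" "dist z z0 < min \<rho>1 \<rho>2" for z
  proof -
    have "pot \<epsilon> p z = 1 / h z + cosec_tail k (l z)"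
      by (simp add: pot_def cosec_sum_def cosec_def h_def l_def k_def)
    then have eq: "of_real (slope p) * pot \<epsilon> p z - 1 / (z - z0)
        = (of_real (slope p) / h z - 1 / (z - z0)) + of_real (slope p) * cosec_tail k (l z)"
      by (simp add: algebra_simps)
    have "norm (cosec_tail k (l z)) \<le> norm (cosec_tail k (l z0)) + 1"
      using \<rho>2(2)[of z] z norm_triangle_sub[of "cosec_tail k (l z)" "cosec_tail k (l z0)"] by (simp add: dist_norm)
    then have "norm (of_real (slope p) * cosec_tail k (l z)) \<le> slope p * (norm (cosec_tail k (l z0)) + 1)"
      using slope_pos[of p] by (simp add: norm_mult)
    then show ?thesis unfolding eq B_def using \<rho>1(2)[of z] z
      by (intro norm_triangle_le add_mono) auto
  qed
  then show ?thesis using \<rho>1(1) \<rho>2(1) unfolding z0_def by (intro exI[of _ "min \<rho>1 \<rho>2"]) auto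
qed

end

section \<open>Uniqueness\<close>

lemma cpx_real [simp]: "cpx (c, 0) = of_real c" and cpx_imag [simp]: "cpx (0, c) = \<i> * of_real c"
  by (simp_all add: complex_eq_iff)

context gap
begin

lemma disk_centers: "disk_center \<epsilon> 1 = (- a, 0)" "disk_center \<epsilon> 2 = (a, 0)"
  by (simp_all add: disk_center_def cen_def)

lemma dist_centers:
  "dist (- a, 0) x = norm (cpx x + of_real a)" "dist (a, 0) x = norm (cpx x - of_real a)"
proof -
  have "dist (- a, 0) x = norm (x - (- a, 0))" "dist (a, 0) x = norm (x - (a, 0))"
    by (simp_all add: dist_norm norm_minus_commute)
  then show "dist (- a, 0) x = norm (cpx x + of_real a)" "dist (a, 0) x = norm (cpx x - of_real a)"
    unfolding norm_cpx[symmetric] cpx_diff by simp_all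
qed

lemma complement_disks:
  "UNIV - (disk \<epsilon> 1 \<union> disk \<epsilon> 2) = {x. 1 \<le> norm (cpx x - of_real a) \<and> 1 \<le> norm (cpx x + of_real a)}"
  unfolding disk_def disk_centers by (auto simp: dist_centers)

lemma closure_disks:
  "closure (disk \<epsilon> 1 \<union> disk \<epsilon> 2) = {x. norm (cpx x - of_real a) \<le> 1 \<or> norm (cpx x + of_real a) \<le> 1}"
  unfolding disk_def disk_centers by (auto simp: closure_Un dist_centers)

lemma exterior_domain_eq:
  "exterior_domain \<epsilon> = {x. 1 < norm (cpx x - of_real a) \<and> 1 < norm (cpx x + of_real a)}"
  unfolding exterior_domain_def closure_disks by auto

lemma open_exterior_domain: "open (exterior_domain \<epsilon>)"
  unfolding exterior_domain_def by (intro open_Diff open_UNIV closed_closure)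

lemma frontier_disks:
  "frontier (disk \<epsilon> 1) = {x. norm (cpx x + of_real a) = 1}"
  "frontier (disk \<epsilon> 2) = {x. norm (cpx x - of_real a) = 1}"
  unfolding disk_def disk_centers by (auto simp: frontier_ball dist_centers sphere_def)

definition profile :: "real \<Rightarrow> real \<Rightarrow> real \<times> real \<Rightarrow> real" where
  "profile c p x = - c * slope p * Im (pot \<epsilon> p (cpx x))"

definition barrier :: "real \<Rightarrow> real \<times> real \<Rightarrow> real" where
  "barrier p x = 2 * ln (norm (cpx x - of_real a)) + (- 1) * ln (norm (cpx x - \<i> * of_real p))
     + ln (1 + norm (of_real a - \<i> * of_real p))"

lemma cpx_in_pot_domain:
  assumes "1 \<le> norm (cpx x - of_real a)" "1 \<le> norm (cpx x + of_real a)" "x \<noteq> (0, p)"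
  shows "cpx x \<in> pot_domain \<epsilon> p"
proof -
  have "cpx x \<noteq> \<i> * of_real p" using assms(3) cpx_eq_iff[of x "(0, p)"] by simp
  then show ?thesis by (rule outside_pot_domain[OF assms(1,2)])
qed

lemma harm_at_profile:
  assumes "cpx x \<in> pot_domain \<epsilon> p"
  shows "harm_at (profile c p) x"
proof -
  have "harm_at (\<lambda>y. Re (\<i> * pot \<epsilon> p (cpx y))) x"
    by (rule harm_at_Re[OF open_pot_domain _ assms]) (intro holomorphic_intros pot_holomorphic)
  from harm_at_cmult[OF this, of "c * slope p"] show ?thesis
    by (simp add: profile_def[abs_def])
qed

lemma harm_at_ln_cross:
  assumes "cpx x \<in> pot_domain \<epsilon> p"
  shows "harm_at (\<lambda>y. ln (norm (cross \<epsilon> p (cpx y)))) x"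
  using assms
  by (intro harm_at_ln_norm[OF open_not_foc cross_holomorphic] cross_nonzero) (auto simp: pot_domain_def)

lemma barrier_ge:
  assumes "1 \<le> norm (cpx x - of_real a)" "x \<noteq> (0, p)"
  shows "ln (norm (cpx x - of_real a)) \<le> barrier p x" "0 \<le> barrier p x"
    "- ln (norm (cpx x - \<i> * of_real p)) \<le> barrier p x"
proof -
  define s t n where "s = norm (cpx x - of_real a)" and "t = norm (cpx x - \<i> * of_real p)"
    and "n = norm (of_real a - \<i> * of_real p :: complex)"
  have s: "1 \<le> s" using assms by (simp add: s_def)
  have "cpx x \<noteq> \<i> * of_real p" using assms(2) cpx_eq_iff[of x "(0, p)"] by simp
  then have t: "0 < t" by (simp add: t_def)
  have n: "0 \<le> n" by (simp add: n_def)
  have "t \<le> s + n" unfolding s_def t_def n_def 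
    using norm_triangle_ineq[of "cpx x - of_real a" "of_real a - \<i> * of_real p"] by simp
  also have "\<dots> \<le> s * (1 + n)" using s n mult_right_mono[of 1 s n] by (simp add: algebra_simps)
  finally have "ln t \<le> ln (s * (1 + n))" using t by simp
  also have "\<dots> = ln s + ln (1 + n)" using s n by (simp add: ln_mult_pos)
  finally have l: "ln t \<le> ln s + ln (1 + n)" .
  have ls: "0 \<le> ln s" using s by simp
  have ln0: "0 \<le> ln (1 + n)" using n by simp
  have b: "barrier p x = 2 * ln s + (- 1) * ln t + ln (1 + n)" by (simp add: barrier_def s_def t_def n_def)
  show "ln (norm (cpx x - of_real a)) \<le> barrier p x" "0 \<le> barrier p x"
    "- ln (norm (cpx x - \<i> * of_real p)) \<le> barrier p x"
    unfolding b s_def[symmetric] t_def[symmetric] using l ls ln0 by linarith+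
qed

lemma harm_at_barrier:
  assumes "1 < norm (cpx x - of_real a)" "x \<noteq> (0, p)"
  shows "harm_at (barrier p) x"
proof -
  have "cpx x \<noteq> \<i> * of_real p" using assms(2) cpx_eq_iff[of x "(0, p)"] by simp
  moreover have "cpx x \<noteq> of_real a" using assms(1) by auto
  moreover have "(\<lambda>z. z - of_real a) holomorphic_on UNIV" "(\<lambda>z. z - \<i> * of_real p) holomorphic_on UNIV"
    by (intro holomorphic_intros)+
  ultimately show ?thesis unfolding barrier_def[abs_def]
    by (intro harm_at_add harm_at_cmult harm_at_const
        harm_at_ln_norm[OF open_UNIV, of "\<lambda>z. z - of_real a"]
        harm_at_ln_norm[OF open_UNIV, of "\<lambda>z. z - \<i> * of_real p"]) auto
qed

end

locale comparison = gap + radial_profile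
begin

text \<open>Phragmen--Lindelof: \<open>barrier p\<close> tends to infinity both at the emitter and at infinity.\<close>

lemma comparison:
  fixes v W :: "real \<times> real \<Rightarrow> real"
  defines "E \<equiv> UNIV - (disk \<epsilon> 1 \<union> disk \<epsilon> 2)"
  assumes cv: "continuous_on (E - {(0, p)}) v" and cW: "continuous_on (E - {(0, p)}) W"
    and mv: "\<And>x. x \<in> exterior_domain \<epsilon> \<Longrightarrow> x \<noteq> (0, p) \<Longrightarrow> mean_value v x"
    and harm: "\<And>x. x \<in> exterior_domain \<epsilon> \<Longrightarrow> x \<noteq> (0, p) \<Longrightarrow> harm_at W x"
    and bd: "\<And>x. x \<in> E \<Longrightarrow> x \<notin> exterior_domain \<epsilon> \<Longrightarrow> v x \<le> W x"
    and near: "0 < r" "\<And>x. 0 < dist x (0, p) \<Longrightarrow> dist x (0, p) < r \<Longrightarrow> v x - W x \<le> B1"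
    and far: "\<And>x. x \<in> E \<Longrightarrow> R \<le> norm x \<Longrightarrow> v x - W x \<le> B2"
    and x: "x \<in> E" "x \<noteq> (0, p)"
  shows "v x \<le> W x"
proof -
  have Eeq: "E = {x. 1 \<le> norm (cpx x - of_real a) \<and> 1 \<le> norm (cpx x + of_real a)}"
    unfolding E_def by (rule complement_disks)
  have main: "v x \<le> W x + \<eta> * barrier p x" if \<eta>: "0 < \<eta>" for \<eta>
  proof -
    define r0 where "r0 = Min {r / 2, dist x (0, p), exp (- (B1 / \<eta>))}"
    have r0: "0 < r0" "r0 < r" "r0 \<le> dist x (0, p)" "r0 \<le> exp (- (B1 / \<eta>))"
      using near(1) x(2) by (auto simp: r0_def min_less_iff_disj)
    define R0 where "R0 = Max {R, norm x, a + exp (B2 / \<eta>)}"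
    have R0: "R \<le> R0" "norm x \<le> R0" "a + exp (B2 / \<eta>) \<le> R0" by (auto simp: R0_def)
    define K where "K = E \<inter> {y. r0 \<le> dist y (0, p)} \<inter> cball 0 R0"
    define U where "U = exterior_domain \<epsilon> \<inter> {y. r0 < dist y (0, p)} \<inter> ball 0 R0"
    have sub: "K \<subseteq> E - {(0, p)}" using r0(1) by (auto simp: K_def)
    have "closed E" unfolding Eeq
      by (intro closed_Collect_conj closed_Collect_le continuous_intros)
    then have K: "compact K" unfolding K_def
      by (intro closed_Int_compact closed_Int closed_Collect_le continuous_intros compact_cball)
    have U: "open U" unfolding U_def
      by (intro open_Int open_exterior_domain open_ball open_Collect_less continuous_intros)
    have UK: "U \<subseteq> K" by (auto simp: U_def K_def Eeq exterior_domain_eq)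
    have cpxne: "cpx y \<noteq> \<i> * of_real p" if "y \<noteq> (0, p)" for y
      using that cpx_eq_iff[of y "(0, p)"] by simp
    have cb: "continuous_on K (barrier p)"
      unfolding barrier_def
    proof (intro continuous_intros)
      show "\<forall>y\<in>K. norm (cpx y - of_real a) \<noteq> 0" by (auto simp: K_def Eeq)
      show "\<forall>y\<in>K. norm (cpx y - \<i> * of_real p) \<noteq> 0" using sub cpxne by auto
    qed
    show ?thesis
    proof (rule maximum_principle[OF K _ _ U UK, where W = "\<lambda>y. W y + \<eta> * barrier p y"])
      show "continuous_on K v" by (rule continuous_on_subset[OF cv sub])
      show "continuous_on K (\<lambda>y. W y + \<eta> * barrier p y)"
        by (intro continuous_intros cb continuous_on_subset[OF cW sub])
      show "x \<in> K" using x r0 R0 by (simp add: K_def)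
      show "mean_value v y" if "y \<in> U" for y
        using that r0(1) by (intro mv) (auto simp: U_def)
      show "harm_at (\<lambda>y. W y + \<eta> * barrier p y) y" if "y \<in> U" for y
        using that r0(1) by (intro harm_at_add harm_at_cmult harm harm_at_barrier)
          (auto simp: U_def exterior_domain_eq)
      show "v y \<le> W y + \<eta> * barrier p y" if y: "y \<in> K - U" for y
      proof -
        have yE: "y \<in> E" and yp: "y \<noteq> (0, p)" using y sub by auto
        then have out: "1 \<le> norm (cpx y - of_real a)" by (simp add: Eeq)
        note bg = barrier_ge[OF out yp]
        have pos: "0 \<le> \<eta> * barrier p y" using bg(2) \<eta> by simp
        consider "y \<notin> exterior_domain \<epsilon>" | "dist y (0, p) = r0" | "norm y = R0"
          using y by (auto simp: K_def U_def)
        then show ?thesis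
        proof cases
          case 1
          then show ?thesis using bd[OF yE] pos by linarith
        next
          case 2
          have "norm (cpx y - \<i> * of_real p) = r0"
            using 2 dist_cpx[of y "(0, p)"] by (simp add: dist_norm)
          then have "- ln r0 \<le> barrier p y" using bg(3) by simp
          moreover have "ln r0 \<le> - (B1 / \<eta>)" using ln_mono[OF r0(4,1)] by simp
          ultimately have "B1 / \<eta> \<le> barrier p y" by linarith
          then have "B1 \<le> \<eta> * barrier p y" using \<eta> by (simp add: field_simps)
          moreover have "v y - W y \<le> B1" using near(2)[of y] 2 r0 by simp
          ultimately show ?thesis by linarith
        next
          case 3
          have "norm y - a \<le> norm (cpx y - of_real a)"
            using norm_triangle_ineq2[of "cpx y" "of_real a"] cen_gt_1 by simp
          then have "exp (B2 / \<eta>) \<le> norm (cpx y - of_real a)" using 3 R0(3) by linarith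
          then have "B2 / \<eta> \<le> ln (norm (cpx y - of_real a))"
            using out by (subst ln_ge_iff) auto
          then have "B2 / \<eta> \<le> barrier p y" using bg(1) by linarith
          then have "B2 \<le> \<eta> * barrier p y" using \<eta> by (simp add: field_simps)
          moreover have "v y - W y \<le> B2" using far[OF yE] 3 R0 by simp
          ultimately show ?thesis by linarith
        qed
      qed
    qed
  qed
  show ?thesis
  proof (rule field_le_epsilon)
    fix e :: real assume e: "0 < e"
    have b0: "0 \<le> barrier p x" using barrier_ge(2) x by (simp add: Eeq)
    have "v x \<le> W x + e / (barrier p x + 1) * barrier p x" using e b0 by (intro main) simp
    also have "e / (barrier p x + 1) * barrier p x \<le> e * 1"
    proof -
      have "e * (barrier p x / (barrier p x + 1)) \<le> e * 1" using e b0 by (intro mult_left_mono) auto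
      then show ?thesis by simp
    qed
    finally show "v x \<le> W x + e" by simp
  qed
qed

end

locale emitter = comparison +
  fixes p :: real and u :: "real \<times> real \<Rightarrow> real"
  assumes sol: "dipole_solution \<epsilon> (0, 1) (0, p) u"
begin

text \<open>The value of \<open>strength\<close> is \<open>1 / (2 pi)\<close>, but only its independence of \<open>\<epsilon>\<close>, \<open>p\<close> and \<open>u\<close> matters.\<close>

definition strength :: real where "strength = M / (2 * mass)"

lemma emitter_in_domain: "(0, p) \<in> exterior_domain \<epsilon>"
proof -
  have "a \<le> norm (\<i> * of_real p - of_real a :: complex)" "a \<le> norm (\<i> * of_real p + of_real a :: complex)"
    using abs_Re_le_cmod[of "\<i> * of_real p - of_real a"] abs_Re_le_cmod[of "\<i> * of_real p + of_real a"] cen_gt_1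
    by simp_all
  then show ?thesis using cen_gt_1 by (simp add: exterior_domain_eq)
qed

lemma u_li: "locally_integrable_on u (exterior_domain \<epsilon>)"
  and u_cont: "continuous_on (UNIV - (disk \<epsilon> 1 \<union> disk \<epsilon> 2) - {(0, p)}) u"
  and u_distr: "distr_eq (exterior_domain \<epsilon>)
       (distr_laplacian (distr_of (exterior_domain \<epsilon>) u)) (distr_dderiv (0, 1) (dirac (0, p)))"
  and u_const: "j \<in> {1, 2} \<Longrightarrow> \<exists>c. \<forall>x\<in>frontier (disk \<epsilon> j). u x = c"
  and u_flux: "j \<in> {1, 2} \<Longrightarrow> \<exists>g. (\<forall>x\<in>frontier (disk \<epsilon> j). has_normal_derivative u \<epsilon> j x (g x)) \<and>
        ((\<lambda>\<theta>. g (disk_center \<epsilon> j + (cos \<theta>, sin \<theta>))) has_integral 0) {0..2 * pi}"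
  and u_decay: "u \<in> O[at_infinity](\<lambda>x. 1 / norm x)"
  using sol unfolding dipole_solution_def by blast+

lemma u_isCont:
  assumes "x \<in> exterior_domain \<epsilon>" "x \<noteq> (0, p)"
  shows "isCont u x"
proof -
  have "open (exterior_domain \<epsilon> - {(0, p)})" by (intro open_Diff open_exterior_domain) auto
  moreover have "continuous_on (exterior_domain \<epsilon> - {(0, p)}) u"
    by (rule continuous_on_subset[OF u_cont]) (unfold complement_disks exterior_domain_eq, auto)
  ultimately show ?thesis using assms by (simp add: continuous_on_eq_continuous_at)
qed

lemma u_mean_value: "x \<in> exterior_domain \<epsilon> \<Longrightarrow> x \<noteq> (0, p) \<Longrightarrow> mean_value u x"
  using mean_value_solution[OF u_li u_distr open_exterior_domain] u_isCont by metis

lemma u_near: "\<exists>r>0. \<exists>B. \<forall>x. 0 < dist x (0, p) \<and> dist x (0, p) < r \<longrightarrow> \<bar>u x - profile strength p x\<bar> \<le> B"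
proof -
  obtain r B where r: "0 < r" "\<And>x. 0 < dist x (0, p) \<Longrightarrow> dist x (0, p) < r \<Longrightarrow>
      \<bar>u x - strength * ((0, 1) \<bullet> (x - (0, p))) / (norm (x - (0, p)))\<^sup>2\<bar> \<le> B"
    using singular_part[OF u_li u_distr open_exterior_domain emitter_in_domain u_isCont]
    unfolding strength_def by blast
  obtain s B' where s: "0 < s" "\<And>z. 0 < dist z (\<i> * of_real p) \<Longrightarrow> dist z (\<i> * of_real p) < s \<Longrightarrow>
      norm (of_real (slope p) * pot \<epsilon> p z - 1 / (z - \<i> * of_real p)) \<le> B'"
    using pot_singular_part[of p] by blast
  have st: "0 < strength" unfolding strength_def using M_pos mass_pos by simp
  have "\<bar>u x - profile strength p x\<bar> \<le> B + strength * B'"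
    if x: "0 < dist x (0, p)" "dist x (0, p) < min r s" for x
  proof -
    define z where "z = cpx x"
    have dz: "dist z (\<i> * of_real p) = dist x (0, p)" using dist_cpx[of x "(0, p)"] by (simp add: z_def)
    define q where "q = of_real (slope p) * pot \<epsilon> p z - 1 / (z - \<i> * of_real p)"
    have nq: "norm q \<le> B'" unfolding q_def using x dz by (intro s(2)) auto
    have nx: "(norm (x - (0, p)))\<^sup>2 = (fst x)\<^sup>2 + (snd x - p)\<^sup>2"
      unfolding norm_cpx[symmetric] cmod_power2 by simp
    have "Im (1 / (z - \<i> * of_real p)) = - ((snd x - p) / (norm (x - (0, p)))\<^sup>2)"
      unfolding nx by (simp add: Im_divide z_def minus_divide_left)
    then have "strength * ((0, 1) \<bullet> (x - (0, p))) / (norm (x - (0, p)))\<^sup>2 = - strength * Im (1 / (z - \<i> * of_real p))"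
      by (simp add: inner_prod_def)
    moreover have "profile strength p x = - strength * (Im q + Im (1 / (z - \<i> * of_real p)))"
      by (simp add: profile_def q_def z_def)
    ultimately have "profile strength p x - strength * ((0, 1) \<bullet> (x - (0, p))) / (norm (x - (0, p)))\<^sup>2 = - strength * Im q"
      by (simp add: algebra_simps)
    moreover have "\<bar>- strength * Im q\<bar> \<le> strength * B'"
    proof -
      have "\<bar>Im q\<bar> \<le> B'" using abs_Im_le_cmod[of q] nq by linarith
      then show ?thesis using st by (simp add: abs_mult)
    qed
    moreover have "\<bar>u x - strength * ((0, 1) \<bullet> (x - (0, p))) / (norm (x - (0, p)))\<^sup>2\<bar> \<le> B"
      using x by (intro r(2)) auto
    ultimately show ?thesis by linarith
  qed
  then show ?thesis using r(1) s(1) by (intro exI[of _ "min r s"]) auto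
qed

lemma u_far: "\<exists>R B. \<forall>x. R \<le> norm x \<longrightarrow> \<bar>u x - profile strength p x\<bar> \<le> B"
proof -
  obtain c where c: "0 < c" "\<forall>\<^sub>F x in at_infinity. norm (u x) \<le> c * norm (1 / norm x)"
    using u_decay by (rule landau_o.bigE)
  then obtain R1 where R1: "\<And>x. R1 \<le> norm x \<Longrightarrow> norm (u x) \<le> c * norm (1 / norm x)"
    unfolding eventually_at_infinity by blast
  obtain R2 B where R2: "\<And>z. R2 \<le> norm z \<Longrightarrow> norm (pot \<epsilon> p z) \<le> B"
    using pot_bounded_at_infinity[of p] by blast
  have "\<bar>u x - profile strength p x\<bar> \<le> c + \<bar>strength\<bar> * slope p * B"
    if x: "Max {R1, R2, 1} \<le> norm x" for x
  proof -
    have "1 / norm x \<le> 1" using x by (simp add: divide_le_eq)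
    then have "c * norm (1 / norm x) \<le> c * 1" using c(1) by (intro mult_left_mono) auto
    then have "\<bar>u x\<bar> \<le> c" using R1[of x] x by simp
    moreover have "\<bar>Im (pot \<epsilon> p (cpx x))\<bar> \<le> B"
      using abs_Im_le_cmod[of "pot \<epsilon> p (cpx x)"] R2[of "cpx x"] x by simp
    then have "\<bar>profile strength p x\<bar> \<le> \<bar>strength\<bar> * slope p * B"
      unfolding profile_def using slope_pos[of p] by (simp add: abs_mult mult_left_mono)
    ultimately show ?thesis by linarith
  qed
  then show ?thesis by blast
qed

lemma u_eq_profile_plus_log:
  "\<exists>A B. \<forall>x \<in> UNIV - (disk \<epsilon> 1 \<union> disk \<epsilon> 2) - {(0, p)}.
     u x = A + B * ln (norm (cross \<epsilon> p (cpx x))) + profile strength p x"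
proof -
  define E where "E = UNIV - (disk \<epsilon> 1 \<union> disk \<epsilon> 2)"
  have Eeq: "E = {x. 1 \<le> norm (cpx x - of_real a) \<and> 1 \<le> norm (cpx x + of_real a)}"
    unfolding E_def by (rule complement_disks)
  obtain c1 where c1: "\<And>x. norm (cpx x + of_real a) = 1 \<Longrightarrow> u x = c1"
    using u_const[of 1] frontier_disks(1) by auto
  obtain c2 where c2: "\<And>x. norm (cpx x - of_real a) = 1 \<Longrightarrow> u x = c2"
    using u_const[of 2] frontier_disks(2) by auto
  define A where "A = (c1 + c2) / 2"
  define B where "B = (c2 - c1) / (2 * hw \<epsilon>)"
  define l where "l = (\<lambda>x. ln (norm (cross \<epsilon> p (cpx x))))"
  define W where "W = (\<lambda>x. A + B * l x + profile strength p x)"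
  have Bh: "B * hw \<epsilon> = (c2 - c1) / 2" using hw_pos by (simp add: B_def)
  have bdry: "u x = W x" if x: "x \<in> E" "x \<notin> exterior_domain \<epsilon>" for x
  proof -
    have o: "1 \<le> norm (cpx x - of_real a)" "1 \<le> norm (cpx x + of_real a)" using x(1) by (auto simp: Eeq)
    have cases: "norm (cpx x - of_real a) = 1 \<or> norm (cpx x + of_real a) = 1"
      using x o by (auto simp: exterior_domain_eq)
    have P0: "profile strength p x = 0" using Im_pot_boundary[OF o cases] by (simp add: profile_def)
    from cases show ?thesis
    proof
      assume h: "norm (cpx x - of_real a) = 1"
      have "l x = hw \<epsilon>" unfolding l_def by (rule ln_cross_outside(3)[OF o h])
      then show ?thesis using c2[OF h] Bh P0 by (simp add: W_def A_def field_simps)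
    next
      assume h: "norm (cpx x + of_real a) = 1"
      have "l x = - hw \<epsilon>" unfolding l_def by (rule ln_cross_outside(4)[OF o h])
      then show ?thesis using c1[OF h] Bh P0 by (simp add: W_def A_def field_simps)
    qed
  qed
  have dom: "cpx x \<in> pot_domain \<epsilon> p" if "x \<in> E - {(0, p)}" for x
    using that by (intro cpx_in_pot_domain) (auto simp: Eeq)
  have harm: "harm_at W x" if "x \<in> E - {(0, p)}" for x
    unfolding W_def l_def
    by (intro harm_at_add harm_at_const harm_at_cmult harm_at_ln_cross harm_at_profile dom that)
  have cW: "continuous_on (E - {(0, p)}) W"
  proof -
    have "continuous_on (pot_domain \<epsilon> p) (\<lambda>z. ln (norm (cross \<epsilon> p z)))"
      using cross_nonzero
      by (intro continuous_intros continuous_on_subset[OF holomorphic_on_imp_continuous_on[OF cross_holomorphic]])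
        (auto simp: pot_domain_def)
    moreover have "continuous_on (pot_domain \<epsilon> p) (\<lambda>z. Im (pot \<epsilon> p z))"
      by (intro continuous_intros holomorphic_on_imp_continuous_on[OF pot_holomorphic])
    ultimately have "continuous_on (E - {(0, p)}) l" "continuous_on (E - {(0, p)}) (\<lambda>x. Im (pot \<epsilon> p (cpx x)))"
      unfolding l_def by (auto intro!: continuous_on_cpx_compose dom)
    then show ?thesis unfolding W_def profile_def
      by (intro continuous_on_add continuous_on_mult continuous_on_const)
  qed
  have lb: "\<bar>B * l x\<bar> \<le> \<bar>B\<bar> * hw \<epsilon>" if "x \<in> E" for x
  proof -
    have "1 \<le> norm (cpx x - of_real a)" "1 \<le> norm (cpx x + of_real a)" using that by (auto simp: Eeq)
    from ln_cross_outside(1,2)[OF this, of p] have "\<bar>l x\<bar> \<le> hw \<epsilon>" by (simp add: l_def abs_le_iff)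
    then show ?thesis by (simp add: abs_mult mult_left_mono)
  qed
  obtain r B1 where near: "0 < r" "\<And>x. 0 < dist x (0, p) \<Longrightarrow> dist x (0, p) < r \<Longrightarrow> \<bar>u x - profile strength p x\<bar> \<le> B1"
    using u_near by blast
  obtain r' where r': "0 < r'" "ball (0, p) r' \<subseteq> exterior_domain \<epsilon>"
    using open_exterior_domain emitter_in_domain open_contains_ball by blast
  obtain R B2 where far: "\<And>x. R \<le> norm x \<Longrightarrow> \<bar>u x - profile strength p x\<bar> \<le> B2"
    using u_far by blast
  define D where "D = \<bar>A\<bar> + \<bar>B\<bar> * hw \<epsilon>"
  have near': "\<bar>u x - W x\<bar> \<le> B1 + D" if x: "0 < dist x (0, p)" "dist x (0, p) < min r r'" for x
  proof -
    have "x \<in> ball (0, p) r'" using x by (simp add: dist_commute)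
    then have "x \<in> exterior_domain \<epsilon>" using r'(2) by blast
    then have xE: "x \<in> E" by (simp add: Eeq exterior_domain_eq)
    show ?thesis using lb[OF xE] near(2)[of x] x unfolding W_def D_def by simp
  qed
  have far': "\<bar>u x - W x\<bar> \<le> B2 + D" if "x \<in> E" "R \<le> norm x" for x
    using lb[OF that(1)] far[OF that(2)] unfolding W_def D_def by simp
  have Wm: "harm_at (\<lambda>y. - W y) x" if "x \<in> E - {(0, p)}" for x
    using harm_at_cmult[OF harm[OF that], of "-1"] by simp
  have extE: "x \<in> exterior_domain \<epsilon> \<Longrightarrow> x \<in> E" for x by (simp add: Eeq exterior_domain_eq)
  have r0: "0 < min r r'" using near(1) r'(1) by simp
  have "u x \<le> W x" if x: "x \<in> E - {(0, p)}" for x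
  proof (rule comparison[of p u W "min r r'" "B1 + D" R "B2 + D" x, folded E_def])
    show "u y - W y \<le> B1 + D" if "0 < dist y (0, p)" "dist y (0, p) < min r r'" for y
      using near'[OF that] by linarith
    show "u y - W y \<le> B2 + D" if "y \<in> E" "R \<le> norm y" for y using far'[OF that] by linarith
    show "u y \<le> W y" if "y \<in> E" "y \<notin> exterior_domain \<epsilon>" for y using bdry[OF that] by simp
    show "0 < min r r'" by (rule r0)
  qed (use x extE in \<open>auto intro: harm u_mean_value u_cont[folded E_def] cW\<close>)
  moreover have "- u x \<le> - W x" if x: "x \<in> E - {(0, p)}" for x
  proof (rule comparison[of p "\<lambda>x. - u x" "\<lambda>x. - W x" "min r r'" "B1 + D" R "B2 + D" x, folded E_def])
    show "- u y - - W y \<le> B1 + D" if "0 < dist y (0, p)" "dist y (0, p) < min r r'" for y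
      using near'[OF that] by linarith
    show "- u y - - W y \<le> B2 + D" if "y \<in> E" "R \<le> norm y" for y using far'[OF that] by linarith
    show "- u y \<le> - W y" if "y \<in> E" "y \<notin> exterior_domain \<epsilon>" for y using bdry[OF that] by simp
    show "0 < min r r'" by (rule r0)
  qed (use x extE in \<open>auto intro!: Wm mean_value_uminus u_mean_value continuous_intros u_cont[folded E_def] cW\<close>)
  ultimately have "u x = W x" if "x \<in> E - {(0, p)}" for x using that by fastforce
  then show ?thesis unfolding W_def l_def E_def by blast
qed

end

section \<open>The flux condition\<close>

context gap
begin

definition potd :: "real \<Rightarrow> complex \<Rightarrow> complex" where
  "potd p z = (cosec' (freq \<epsilon>) (Ln (cross \<epsilon> p z)) + cosec_tail' (freq \<epsilon>) (Ln (cross \<epsilon> p z)))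
     * (2 * of_real \<alpha> / ((of_real \<alpha>)\<^sup>2 - z\<^sup>2))"

lemma pot_DERIV: "z \<in> pot_domain \<epsilon> p \<Longrightarrow> (pot \<epsilon> p has_field_derivative potd p z) (at z)"
  unfolding potd_def by (rule pot_has_derivative)

lemma foc_inside: "norm (of_real \<alpha> - of_real a :: complex) < 1" "1 < norm (- of_real \<alpha> - of_real a :: complex)"
proof -
  have "1 < a + \<alpha>" using cen_gt_1 foc_pos by simp
  then have "1 * (a - \<alpha>) < (a + \<alpha>) * (a - \<alpha>)" using foc_less_cen by (intro mult_strict_right_mono) auto
  then have "a - \<alpha> < 1" unfolding cen_foc(1) by simp
  moreover have "norm (of_real \<alpha> - of_real a :: complex) = a - \<alpha>"
    using foc_less_cen by (simp flip: of_real_diff)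
  moreover have "norm (- of_real \<alpha> - of_real a :: complex) = a + \<alpha>"
    using cen_gt_1 foc_pos by (simp flip: of_real_minus of_real_diff)
  ultimately show "norm (of_real \<alpha> - of_real a :: complex) < 1" "1 < norm (- of_real \<alpha> - of_real a :: complex)"
    using \<open>1 < a + \<alpha>\<close> by simp_all
qed

lemma right_circle:
  fixes z :: complex
  assumes "norm (z - of_real a) = 1"
  shows "1 \<le> norm (z + of_real a)" "z \<noteq> \<i> * of_real p"
proof -
  have "norm (2 * of_real a :: complex) - norm (z - of_real a) \<le> norm (2 * of_real a + (z - of_real a))"
    by (rule norm_diff_ineq)
  then show "1 \<le> norm (z + of_real a)" using assms cen_gt_1 by (simp add: norm_mult algebra_simps)
  show "z \<noteq> \<i> * of_real p"
  proof
    assume z: "z = \<i> * of_real p"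
    have "a \<le> norm (z - of_real a)" using abs_Re_le_cmod[of "z - of_real a"] cen_gt_1 z by simp
    then show False using assms cen_gt_1 by simp
  qed
qed

lemma right_circle_pot_domain: "norm (z - of_real a) = 1 \<Longrightarrow> z \<in> pot_domain \<epsilon> p"
  using right_circle by (intro outside_pot_domain) auto

lemma flux_integral:
  fixes B c :: real
  shows "((\<lambda>\<theta>. Re ((of_real B * (2 * of_real \<alpha> / ((of_real \<alpha>)\<^sup>2 - (of_real a + cis \<theta>)\<^sup>2))
      + \<i> * of_real c * potd p (of_real a + cis \<theta>)) * cis \<theta>)) has_integral - (2 * pi * B)) {0..2 * pi}"
proof -
  let ?\<gamma> = "circlepath (of_real a) 1"
  define S where "S = {z::complex. norm (z - of_real a) = 1}"
  have dn: "dist (of_real a) z = norm (z - of_real a)" for z :: complex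
    by (metis dist_commute dist_norm)
  have "sphere (of_real a) 1 = S" unfolding S_def sphere_def dn ..
  then have img: "path_image ?\<gamma> = S" by simp
  have "(potd p has_contour_integral (pot \<epsilon> p (pathfinish ?\<gamma>) - pot \<epsilon> p (pathstart ?\<gamma>))) ?\<gamma>"
  proof (rule contour_integral_primitive[of S])
    show "(pot \<epsilon> p has_field_derivative potd p z) (at z within S)" if "z \<in> S" for z
      using that by (simp add: S_def has_field_derivative_at_within[OF pot_DERIV[OF right_circle_pot_domain]])
    show "path_image ?\<gamma> \<subseteq> S" unfolding img ..
  qed simp
  then have P: "(potd p has_contour_integral 0) ?\<gamma>" by simp
  have C1: "((\<lambda>z. 1 / (z - of_real \<alpha>)) has_contour_integral 2 * of_real pi * \<i> * 1) ?\<gamma>"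
    by (rule Cauchy_integral_circlepath_simple[OF holomorphic_on_const foc_inside(1)])
  have C2: "((\<lambda>z. 1 / (z + of_real \<alpha>)) has_contour_integral 0) ?\<gamma>"
  proof (rule Cauchy_theorem_convex_simple[of _ "cball (of_real a) 1"])
    have "z + of_real \<alpha> \<noteq> 0" if "z \<in> cball (of_real a) 1" for z :: complex
    proof
      assume "z + of_real \<alpha> = 0"
      then have "z = - of_real \<alpha>" by (simp add: eq_neg_iff_add_eq_0)
      then show False using that foc_inside(2) by (simp add: dist_norm norm_minus_commute)
    qed
    then show "(\<lambda>z. 1 / (z + of_real \<alpha>)) holomorphic_on cball (of_real a) 1" by (intro holomorphic_intros)
  qed auto
  define f where "f = (\<lambda>z. of_real B * (1 / (z + of_real \<alpha>) - 1 / (z - of_real \<alpha>)) + \<i> * of_real c * potd p z)"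
  have "(f has_contour_integral (of_real B * (0 - 2 * of_real pi * \<i> * 1) + \<i> * of_real c * 0)) ?\<gamma>"
    unfolding f_def
    by (intro has_contour_integral_add has_contour_integral_lmul has_contour_integral_diff P C1 C2)
  then have I: "((\<lambda>\<theta>. f (of_real a + of_real 1 * cis \<theta>) * of_real 1 * \<i> * cis \<theta>) has_integral
      (of_real B * (0 - 2 * of_real pi * \<i> * 1) + \<i> * of_real c * 0)) {0..2 * pi}"
    unfolding circlepath_def by (subst (asm) has_contour_integral_part_circlepath_iff) simp_all
  have feq: "f (of_real a + cis \<theta>) = of_real B * (2 * of_real \<alpha> / ((of_real \<alpha>)\<^sup>2 - (of_real a + cis \<theta>)\<^sup>2))
      + \<i> * of_real c * potd p (of_real a + cis \<theta>)" for \<theta>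
  proof -
    define z where "z = of_real a + cis \<theta>"
    have "z \<in> pot_domain \<epsilon> p" by (rule right_circle_pot_domain) (simp add: z_def)
    then have nz: "z - of_real \<alpha> \<noteq> 0" "z + of_real \<alpha> \<noteq> 0" "of_real \<alpha> - z \<noteq> 0"
      by (auto simp: pot_domain_def eq_neg_iff_add_eq_0)
    have fac: "(of_real \<alpha>)\<^sup>2 - z\<^sup>2 = - ((z + of_real \<alpha>) * (z - of_real \<alpha>))" by (simp add: power2_eq_square algebra_simps)
    have "1 / (z + of_real \<alpha>) - 1 / (z - of_real \<alpha>) = - (2 * of_real \<alpha>) / ((z + of_real \<alpha>) * (z - of_real \<alpha>))"
      using nz by (simp add: diff_frac_eq)
    then have "1 / (z + of_real \<alpha>) - 1 / (z - of_real \<alpha>) = 2 * of_real \<alpha> / ((of_real \<alpha>)\<^sup>2 - z\<^sup>2)"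
      unfolding fac by simp
    then show ?thesis unfolding f_def z_def[symmetric] by simp
  qed
  have I': "((\<lambda>\<theta>. Im (f (of_real a + of_real 1 * cis \<theta>) * of_real 1 * \<i> * cis \<theta>)) has_integral
      Im (of_real B * (0 - 2 * of_real pi * \<i> * 1) + \<i> * of_real c * 0)) {0..2 * pi}"
    using has_integral_linear[OF I bounded_linear_Im] by (simp add: o_def)
  have e1: "Im (f (of_real a + of_real 1 * cis \<theta>) * of_real 1 * \<i> * cis \<theta>)
      = Re ((of_real B * (2 * of_real \<alpha> / ((of_real \<alpha>)\<^sup>2 - (of_real a + cis \<theta>)\<^sup>2))
      + \<i> * of_real c * potd p (of_real a + cis \<theta>)) * cis \<theta>)" for \<theta>
    unfolding feq[symmetric] by (simp add: algebra_simps)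
  have e2: "Im (of_real B * (0 - 2 * of_real pi * \<i> * 1) + \<i> * of_real c * 0 :: complex) = - (2 * pi * B)"
    by simp
  show ?thesis using I' unfolding e1 e2 .
qed

end

context emitter
begin

lemma normal_derivative:
  assumes u: "\<And>x. x \<in> UNIV - (disk \<epsilon> 1 \<union> disk \<epsilon> 2) - {(0, p)} \<Longrightarrow>
      u x = A + B * ln (norm (cross \<epsilon> p (cpx x))) + profile strength p x"
    and d: "has_normal_derivative u \<epsilon> 2 (disk_center \<epsilon> 2 + (cos \<theta>, sin \<theta>)) d"
  shows "d = - Re ((of_real B * (2 * of_real \<alpha> / ((of_real \<alpha>)\<^sup>2 - (of_real a + cis \<theta>)\<^sup>2))
      + \<i> * of_real (strength * slope p) * potd p (of_real a + cis \<theta>)) * cis \<theta>)"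
proof -
  define z0 where "z0 = of_real a + cis \<theta>"
  define z where "z = (\<lambda>t::real. of_real a + of_real (1 - t) * cis \<theta>)"
  define x where "x = (\<lambda>t::real. disk_center \<epsilon> 2 + (cos \<theta>, sin \<theta>) + t *\<^sub>R (disk_center \<epsilon> 2 - (disk_center \<epsilon> 2 + (cos \<theta>, sin \<theta>))))"
  have xz: "cpx (x t) = z t" for t
    by (simp add: x_def z_def disk_centers complex_eq_iff algebra_simps)
  have z00: "z 0 = z0" by (simp add: z_def z0_def)
  have dom0: "z0 \<in> pot_domain \<epsilon> p" by (rule right_circle_pot_domain) (simp add: z0_def)
  then have nf: "z0 \<noteq> of_real \<alpha>" "z0 \<noteq> - of_real \<alpha>" by (auto simp: pot_domain_def)
  define c0 where "c0 = cross \<epsilon> p z0"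
  have c0: "c0 \<noteq> 0" unfolding c0_def by (rule cross_nonzero[OF nf])
  define S where "S = (\<lambda>w. of_real B * Ln (cross \<epsilon> p w / c0) + \<i> * of_real (strength * slope p) * pot \<epsilon> p w)"
  have "((\<lambda>w. cross \<epsilon> p w / c0) has_field_derivative c0 * (2 * of_real \<alpha> / ((of_real \<alpha>)\<^sup>2 - z0\<^sup>2)) / c0) (at z0)"
    unfolding c0_def by (intro DERIV_cdivide cross_has_derivative nf)
  moreover have "(Ln has_field_derivative inverse (cross \<epsilon> p z0 / c0)) (at (cross \<epsilon> p z0 / c0))"
    using c0 by (intro has_field_derivative_Ln) (simp add: c0_def[symmetric])
  ultimately have "((\<lambda>w. Ln (cross \<epsilon> p w / c0)) has_field_derivative
      inverse (cross \<epsilon> p z0 / c0) * (c0 * (2 * of_real \<alpha> / ((of_real \<alpha>)\<^sup>2 - z0\<^sup>2)) / c0)) (at z0)"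
    by (rule DERIV_chain2[rotated])
  then have dLn: "((\<lambda>w. Ln (cross \<epsilon> p w / c0)) has_field_derivative 2 * of_real \<alpha> / ((of_real \<alpha>)\<^sup>2 - z0\<^sup>2)) (at z0)"
    using c0 by (simp add: c0_def[symmetric])
  define D where "D = of_real B * (2 * of_real \<alpha> / ((of_real \<alpha>)\<^sup>2 - z0\<^sup>2)) + \<i> * of_real (strength * slope p) * potd p z0"
  have dS: "(S has_field_derivative D) (at (z 0))"
    unfolding S_def D_def z00 by (intro DERIV_add DERIV_cmult dLn pot_DERIV dom0)
  have dz: "(z has_vector_derivative - cis \<theta>) (at 0 within {..0})"
    unfolding z_def by (auto intro!: derivative_eq_intros)
  have "((S \<circ> z) has_vector_derivative - cis \<theta> * D) (at 0 within {..0})"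
    by (rule field_vector_diff_chain_within[OF dz has_field_derivative_at_within[OF dS]])
  then have "((\<lambda>t. Re ((S \<circ> z) t)) has_real_derivative Re (- cis \<theta> * D)) (at 0 within {..0})"
    by (rule has_field_derivative_Re)
  then have D1: "((\<lambda>t. A + B * ln (norm c0) + Re (S (z t))) has_real_derivative 0 + Re (- cis \<theta> * D)) (at 0 within {..0})"
    unfolding o_def by (intro DERIV_add DERIV_const)
  have D2: "A + B * ln (norm c0) + Re (S (z t)) = u (x t)" if t: "t \<in> {..0}" "dist t 0 < \<epsilon> / 2" for t
  proof -
    have t': "t \<le> 0" "- (\<epsilon> / 2) < t" using t by (auto simp: dist_real_def)
    have n1: "norm (z t - of_real a) = 1 - t" using t' by (simp add: z_def norm_mult del: of_real_diff)
    have "norm (2 * of_real a :: complex) - norm (z t - of_real a) \<le> norm (2 * of_real a + (z t - of_real a))"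
      by (rule norm_diff_ineq)
    then have "2 * a - (1 - t) \<le> norm (z t + of_real a)" using n1 cen_gt_1 by (simp add: norm_mult algebra_simps)
    then have o2: "1 \<le> norm (z t + of_real a)" using t' by (simp add: cen_def)
    have o1: "1 \<le> norm (z t - of_real a)" using n1 t' by simp
    have "x t \<noteq> (0, p)"
    proof
      assume "x t = (0, p)"
      then have "z t = \<i> * of_real p" using xz[of t] by simp
      then have "a \<le> norm (z t - of_real a)" using abs_Re_le_cmod[of "z t - of_real a"] cen_gt_1 by simp
      then show False using n1 t' by (simp add: cen_def)
    qed
    then have "x t \<in> UNIV - (disk \<epsilon> 1 \<union> disk \<epsilon> 2) - {(0, p)}"
      unfolding complement_disks using o1 o2 by (simp add: xz)
    from u[OF this] have ux: "u (x t) = A + B * ln (norm (cross \<epsilon> p (z t))) + profile strength p (x t)"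
      by (simp only: xz)
    have "cross \<epsilon> p (z t) \<noteq> 0" using outside_not_foc[OF o1 o2] by (intro cross_nonzero) auto
    then have "Re (Ln (cross \<epsilon> p (z t) / c0)) = ln (norm (cross \<epsilon> p (z t))) - ln (norm c0)"
      using c0 by (simp add: norm_divide ln_div)
    then have "Re (S (z t)) = B * (ln (norm (cross \<epsilon> p (z t))) - ln (norm c0)) - strength * slope p * Im (pot \<epsilon> p (z t))"
      by (simp add: S_def)
    then show ?thesis unfolding ux by (simp add: profile_def xz right_diff_distrib)
  qed
  have "((\<lambda>t. u (x t)) has_real_derivative 0 + Re (- cis \<theta> * D)) (at 0 within {..0})"
    by (rule has_field_derivative_transform_within[OF D1, of "\<epsilon> / 2"]) (use eps D2 in auto)
  then have d1: "((\<lambda>t. u (x t)) has_real_derivative - Re (D * cis \<theta>)) (at 0 within {..<0})"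
    by (rule has_field_derivative_subset[THEN DERIV_cong]) (auto simp: mult.commute)
  have d2: "((\<lambda>t. u (x t)) has_real_derivative d) (at 0 within {..<0})"
    using d unfolding has_normal_derivative_def x_def by (rule has_field_derivative_subset) auto
  have "d = - Re (D * cis \<theta>)"
    using d1 d2 unfolding has_real_derivative_iff_has_vector_derivative
    by (intro vector_derivative_unique_within[of 0 "{..<0}"]) auto
  then show ?thesis unfolding D_def z0_def .
qed

lemma u_eq_profile:
  "\<exists>A. \<forall>x \<in> UNIV - (disk \<epsilon> 1 \<union> disk \<epsilon> 2) - {(0, p)}. u x = A + profile strength p x"
proof -
  obtain A B where AB: "\<And>x. x \<in> UNIV - (disk \<epsilon> 1 \<union> disk \<epsilon> 2) - {(0, p)} \<Longrightarrow>
      u x = A + B * ln (norm (cross \<epsilon> p (cpx x))) + profile strength p x"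
    using u_eq_profile_plus_log by blast
  obtain g where g: "\<And>x. x \<in> frontier (disk \<epsilon> 2) \<Longrightarrow> has_normal_derivative u \<epsilon> 2 x (g x)"
    and int: "((\<lambda>\<theta>. g (disk_center \<epsilon> 2 + (cos \<theta>, sin \<theta>))) has_integral 0) {0..2 * pi}"
    using u_flux[of 2] by blast
  let ?F = "\<lambda>\<theta>. Re ((of_real B * (2 * of_real \<alpha> / ((of_real \<alpha>)\<^sup>2 - (of_real a + cis \<theta>)\<^sup>2))
      + \<i> * of_real (strength * slope p) * potd p (of_real a + cis \<theta>)) * cis \<theta>)"
  have eq: "g (disk_center \<epsilon> 2 + (cos \<theta>, sin \<theta>)) = - ?F \<theta>" for \<theta>
  proof (rule normal_derivative[OF AB])
    have "cpx (disk_center \<epsilon> 2 + (cos \<theta>, sin \<theta>)) - of_real a = cis \<theta>"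
      by (simp add: disk_centers complex_eq_iff)
    then have "disk_center \<epsilon> 2 + (cos \<theta>, sin \<theta>) \<in> frontier (disk \<epsilon> 2)"
      unfolding frontier_disks by simp
    then show "has_normal_derivative u \<epsilon> 2 (disk_center \<epsilon> 2 + (cos \<theta>, sin \<theta>)) (g (disk_center \<epsilon> 2 + (cos \<theta>, sin \<theta>)))"
      by (rule g)
  qed
  have "((\<lambda>\<theta>. - ?F \<theta>) has_integral - (- (2 * pi * B))) {0..2 * pi}"
    by (intro has_integral_neg flux_integral)
  moreover have "((\<lambda>\<theta>. - ?F \<theta>) has_integral 0) {0..2 * pi}" using int unfolding eq .
  ultimately have "- (- (2 * pi * B)) = 0" by (rule has_integral_unique)
  then have "B = 0" by simp
  then show ?thesis using AB by auto
qed

lemma u_gradient: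
  assumes x: "x \<in> exterior_domain \<epsilon>" "x \<noteq> (0, p)"
  shows "\<exists>g. GDERIV u x :> g \<and> norm g = strength * slope p * norm (potd p (cpx x))"
proof -
  obtain A where A: "\<And>x. x \<in> UNIV - (disk \<epsilon> 1 \<union> disk \<epsilon> 2) - {(0, p)} \<Longrightarrow> u x = A + profile strength p x"
    using u_eq_profile by blast
  have st: "0 < strength" unfolding strength_def using M_pos mass_pos by simp
  define D where "D = \<i> * of_real (strength * slope p) * potd p (cpx x)"
  have dom: "cpx x \<in> pot_domain \<epsilon> p"
    using x by (intro cpx_in_pot_domain) (auto simp: exterior_domain_eq)
  have "((\<lambda>z. \<i> * of_real (strength * slope p) * pot \<epsilon> p z) has_field_derivative D) (at (cpx x))"
    unfolding D_def by (intro DERIV_cmult pot_DERIV dom)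
  then have d1: "((\<lambda>z. \<i> * of_real (strength * slope p) * pot \<epsilon> p z) has_derivative (\<lambda>h. D * h)) (at (cpx x))"
    by (simp add: has_field_derivative_def)
  have "bounded_linear cpx"
    by (rule bounded_linear_intro[of _ 1]) (auto simp: cpx_add cpx_scaleR scaleR_conv_of_real)
  then have d2: "(cpx has_derivative cpx) (at x)" by (rule bounded_linear_imp_has_derivative)
  have "((\<lambda>y. A + Re (\<i> * of_real (strength * slope p) * pot \<epsilon> p (cpx y))) has_derivative (\<lambda>h. 0 + Re (D * cpx h))) (at x)"
    by (intro has_derivative_add has_derivative_const has_derivative_Re has_derivative_compose[OF d2 d1])
  then have "((\<lambda>y. A + Re (\<i> * of_real (strength * slope p) * pot \<epsilon> p (cpx y))) has_derivative (\<lambda>h. inner h (Re D, - Im D))) (at x)"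
    by (rule has_derivative_eq_rhs) (auto simp: inner_prod_def mult.commute)
  then have "(u has_derivative (\<lambda>h. inner h (Re D, - Im D))) (at x)"
  proof (rule has_derivative_transform_within_open[of _ _ _ _ "exterior_domain \<epsilon> - {(0, p)}"])
    show "open (exterior_domain \<epsilon> - {(0, p)})" by (intro open_Diff open_exterior_domain) auto
    show "x \<in> exterior_domain \<epsilon> - {(0, p)}" using x by simp
    fix y assume y: "y \<in> exterior_domain \<epsilon> - {(0, p)}"
    then have "y \<in> UNIV - (disk \<epsilon> 1 \<union> disk \<epsilon> 2) - {(0, p)}"
      unfolding complement_disks exterior_domain_eq by auto
    from A[OF this] show "A + Re (\<i> * of_real (strength * slope p) * pot \<epsilon> p (cpx y)) = u y"
      by (simp add: profile_def)
  qed
  then have "GDERIV u x :> (Re D, - Im D)" by (simp add: gderiv_def)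
  moreover have "norm (Re D, - Im D) = norm D" by (simp add: norm_prod_def cmod_def)
  moreover have "norm D = strength * slope p * norm (potd p (cpx x))"
    unfolding D_def using st slope_pos[of p] by (simp add: norm_mult)
  ultimately show ?thesis by metis
qed

end

section \<open>The gradient bound\<close>

lemma norm_exp_minus_1_le:
  fixes z :: complex
  assumes "norm z \<le> r"
  shows "norm (exp z - 1) \<le> exp r * norm z"
proof -
  have "norm (exp z - exp 0) \<le> exp r * norm (z - 0)"
  proof (rule field_differentiable_bound[of "cball 0 r" exp exp])
    show "(exp has_field_derivative exp w) (at w within cball 0 r)" for w :: complex
      by (auto intro!: derivative_eq_intros)
    show "norm (exp w) \<le> exp r" if "w \<in> cball 0 r" for w :: complex
      using that complex_Re_le_cmod[of w] by simp
    show "z \<in> cball 0 r" using assms by simp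
    show "0 \<in> cball (0::complex) r" using assms norm_ge_zero[of z] by (simp del: norm_ge_zero)
  qed simp
  then show ?thesis by simp
qed

context gap
begin

lemma denominator_bound:
  fixes z :: complex and p :: real
  assumes z: "norm z < 1/2"
  defines "D \<equiv> sqrt \<epsilon> * norm (z - \<i> * of_real p) + norm (of_real p * z + \<i> * of_real \<epsilon>)"
  shows "norm (of_real \<alpha> - z) * norm (of_real \<alpha> + \<i> * of_real p) \<le> 4 * D"
proof -
  define w where "w = of_real p * z + \<i> * of_real \<epsilon>"
  have id: "(of_real \<alpha> - z) * (of_real \<alpha> + \<i> * of_real p)
      = (- \<i>) * w + of_real (\<epsilon>\<^sup>2 / 4) + (- of_real \<alpha>) * (z - \<i> * of_real p)"
  proof -
    have "\<alpha> * \<alpha> = \<epsilon> + \<epsilon>\<^sup>2 / 4" using foc_square by (simp only: power2_eq_square)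
    then have "of_real \<alpha> * of_real \<alpha> = of_real \<epsilon> + (of_real (\<epsilon>\<^sup>2 / 4) :: complex)"
      by (simp only: of_real_mult[symmetric] of_real_add[symmetric])
    then show ?thesis by (simp add: w_def algebra_simps)
  qed
  have "norm (of_real \<alpha> - z) * norm (of_real \<alpha> + \<i> * of_real p)
      \<le> norm ((- \<i>) * w) + norm (of_real (\<epsilon>\<^sup>2 / 4) :: complex) + norm ((- of_real \<alpha>) * (z - \<i> * of_real p))"
    unfolding norm_mult[symmetric] id by (intro norm_triangle_le add_mono order_refl)
  also have "\<dots> = norm w + \<epsilon>\<^sup>2 / 4 + \<alpha> * norm (z - \<i> * of_real p)"
    unfolding norm_mult norm_minus_cancel norm_of_real using foc_pos by simp
  also have "\<dots> \<le> norm w + \<epsilon>\<^sup>2 / 4 + 2 * sqrt \<epsilon> * norm (z - \<i> * of_real p)"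
    using foc_bounds(2) by (intro add_mono mult_right_mono) auto
  finally have le: "norm (of_real \<alpha> - z) * norm (of_real \<alpha> + \<i> * of_real p)
      \<le> norm w + \<epsilon>\<^sup>2 / 4 + 2 * (sqrt \<epsilon> * norm (z - \<i> * of_real p))" by (simp only: mult.assoc)
  have se: "0 < sqrt \<epsilon>" using eps by simp
  have e2: "\<epsilon>\<^sup>2 / 4 \<le> \<epsilon> / 2"
  proof -
    have "\<epsilon> * \<epsilon> \<le> 1 * \<epsilon>" using eps by (intro mult_right_mono) auto
    then show ?thesis using eps by (simp add: power2_eq_square)
  qed
  have "\<epsilon>\<^sup>2 / 4 \<le> sqrt \<epsilon> * norm (z - \<i> * of_real p) + norm w"
  proof (cases "\<epsilon> / 2 \<le> norm w")
    case True
    have "0 \<le> sqrt \<epsilon> * norm (z - \<i> * of_real p)" using se by simp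
    then show ?thesis using e2 True by linarith
  next
    case False
    have "\<bar>p * Im z + \<epsilon>\<bar> \<le> norm w" using abs_Im_le_cmod[of w] by (simp add: w_def)
    then have neg: "\<epsilon> / 2 < - (p * Im z)" using False by linarith
    have "\<bar>Im z\<bar> < 1/2" using abs_Im_le_cmod[of z] z by linarith
    then have "\<bar>p\<bar> * \<bar>Im z\<bar> \<le> \<bar>p\<bar> * (1/2)" by (intro mult_left_mono) auto
    moreover have "- (p * Im z) \<le> \<bar>p\<bar> * \<bar>Im z\<bar>" by (metis abs_ge_minus_self abs_mult)
    ultimately have p: "\<epsilon> < \<bar>p\<bar>" using neg by linarith
    have "p * Im z < 0" using neg eps by linarith
    then have "\<bar>p\<bar> \<le> \<bar>Im z - p\<bar>" by (auto simp: mult_less_0_iff)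
    also have "\<dots> \<le> norm (z - \<i> * of_real p)" using abs_Im_le_cmod[of "z - \<i> * of_real p"] by simp
    finally have "\<epsilon> \<le> norm (z - \<i> * of_real p)" using p by linarith
    then have "\<epsilon> * \<epsilon> \<le> sqrt \<epsilon> * norm (z - \<i> * of_real p)"
      using foc_bounds(4) eps by (intro mult_mono) auto
    moreover have "0 \<le> norm w" "0 \<le> \<epsilon> * \<epsilon>" by simp_all
    ultimately show ?thesis unfolding power2_eq_square by linarith
  qed
  moreover have "0 \<le> sqrt \<epsilon> * norm (z - \<i> * of_real p)" using se by simp
  moreover have "0 \<le> norm w" by simp
  moreover have "l \<le> 4 * (s + t)" if "e \<le> s + t" "0 \<le> s" "0 \<le> t" "l \<le> t + e + 2 * s" for e l s t :: real
    using that by (simp add: algebra_simps)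
  ultimately show ?thesis using le unfolding D_def w_def[symmetric] by blast
qed

lemma potd_bound:
  fixes z :: complex and p C :: real
  assumes C: "\<And>k \<zeta>. 1 \<le> k \<Longrightarrow> \<bar>Re \<zeta>\<bar> \<le> pi / (2 * k) \<Longrightarrow> \<bar>Im \<zeta>\<bar> \<le> pi \<Longrightarrow> exp \<zeta> \<noteq> 1 \<Longrightarrow>
      norm (cosec' k \<zeta> + cosec_tail' k \<zeta>) * (norm \<zeta>)\<^sup>2 \<le> C * exp (- (k * \<bar>Im \<zeta>\<bar> / 2))"
    and out: "1 \<le> norm (z - of_real a)" "1 \<le> norm (z + of_real a)"
    and z: "norm z < 1/2" "z \<noteq> \<i> * of_real p"
  defines "D \<equiv> sqrt \<epsilon> * norm (z - \<i> * of_real p) + norm (of_real p * z + \<i> * of_real \<epsilon>)"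
  shows "slope p * norm (potd p z) \<le>
    exp 11 * C * (1 / (norm (z - \<i> * of_real p))\<^sup>2 * exp (- (exp (-5) / 8) * (norm (z - \<i> * of_real p) / D)))"
proof -
  define k where "k = freq \<epsilon>"
  define X where "X = cross \<epsilon> p z"
  define \<zeta> where "\<zeta> = Ln X"
  define \<delta> where "\<delta> = norm (z - \<i> * of_real p)"
  define s t q where "s = norm (of_real \<alpha> - z)" and "t = norm (of_real \<alpha> + z)"
    and "q = norm (of_real \<alpha> + \<i> * of_real p)"
  note nf = outside_not_foc[OF out]
  have pos: "0 < s" "0 < t" "0 < q" "0 < \<delta>"
    using nf foc_ip_nonzero z(2) by (simp_all add: s_def t_def q_def \<delta>_def)
  have X0: "X \<noteq> 0" unfolding X_def by (rule cross_nonzero[OF nf(3,4)])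
  have X1: "X \<noteq> 1" unfolding X_def using cross_eq_1_iff[OF nf(3)] z(2) by simp
  have eX: "exp \<zeta> = X" using X0 by (simp add: \<zeta>_def)
  have k: "1 \<le> k" "pi / (2 * k) = hw \<epsilon>" "1 / (2 * sqrt \<epsilon>) \<le> k" using freq_facts by (simp_all add: k_def)
  have re: "\<bar>Re \<zeta>\<bar> \<le> pi / (2 * k)"
    using ln_cross_outside(1,2)[OF out, of p] X0 unfolding k(2) by (simp add: \<zeta>_def X_def abs_le_iff)
  have im: "\<bar>Im \<zeta>\<bar> \<le> pi"
    using mpi_less_Im_Ln[OF X0] Im_Ln_le_pi[OF X0] by (simp add: \<zeta>_def abs_le_iff)
  have n5: "norm \<zeta> \<le> 5"
    using cmod_le[of \<zeta>] re im hw_bounds(2) pi_less_4 unfolding k(2) by linarith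
  have nX1: "norm (X - 1) \<le> exp 5 * norm \<zeta>" using norm_exp_minus_1_le[OF n5] by (simp add: eX)
  have nX2: "norm (1 / X - 1) \<le> exp 5 * norm \<zeta>"
    using norm_exp_minus_1_le[of "- \<zeta>" 5] n5 by (simp add: exp_minus eX inverse_eq_divide)
  have Xm1: "norm (X - 1) = 2 * \<alpha> * \<delta> / (s * q)"
    unfolding X_def cross_minus_1[OF nf(3)] using foc_pos by (simp add: norm_mult norm_divide \<delta>_def s_def q_def)
  have nX: "norm X = t / s" by (simp add: X_def norm_cross s_def t_def)
  have "1 / X - 1 = - (X - 1) / X" using X0 by (simp add: field_simps)
  then have "norm (1 / X - 1) = norm (X - 1) / norm X" by (simp add: norm_divide norm_minus_commute)
  then have Xm2: "norm (1 / X - 1) = 2 * \<alpha> * \<delta> / (t * q)"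
    unfolding nX Xm1 using pos by (simp add: field_simps)
  define F where "F = norm (cosec' k \<zeta> + cosec_tail' k \<zeta>)"
  have F0: "0 \<le> F" by (simp add: F_def)
  have q2: "q * q = \<alpha>\<^sup>2 + p\<^sup>2"
    by (simp add: q_def cmod_def flip: power2_eq_square)
  have st: "norm ((of_real \<alpha>)\<^sup>2 - z\<^sup>2) = s * t"
  proof -
    have "(of_real \<alpha>)\<^sup>2 - z\<^sup>2 = (of_real \<alpha> - z) * (of_real \<alpha> + z)" by (simp add: power2_eq_square algebra_simps)
    then show ?thesis by (simp add: norm_mult s_def t_def)
  qed
  have "slope p * norm (potd p z) = 2 * \<alpha> / (q * q) * (F * (2 * \<alpha> / (s * t)))"
    unfolding slope_def potd_def norm_mult norm_divide st q2 using foc_pos by (simp add: F_def k_def \<zeta>_def X_def)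
  also have "\<dots> = F * (norm (X - 1) * norm (1 / X - 1)) / \<delta>\<^sup>2"
    unfolding Xm1 Xm2 using pos by (simp add: field_simps power2_eq_square)
  finally have main: "slope p * norm (potd p z) = F * (norm (X - 1) * norm (1 / X - 1)) / \<delta>\<^sup>2" .
  have "F * (norm (X - 1) * norm (1 / X - 1)) \<le> F * ((exp 5 * norm \<zeta>) * (exp 5 * norm \<zeta>))"
    using nX1 nX2 F0 by (intro mult_left_mono mult_mono) auto
  also have "\<dots> = exp 10 * (F * (norm \<zeta>)\<^sup>2)" by (simp add: power2_eq_square exp_add[symmetric, of 5 5, simplified])
  also have "\<dots> \<le> exp 10 * (C * exp (- (k * \<bar>Im \<zeta>\<bar> / 2)))"
    using C[OF k(1) re im] eX X1 unfolding F_def by (intro mult_left_mono) auto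
  finally have b1: "F * (norm (X - 1) * norm (1 / X - 1)) \<le> exp 10 * (C * exp (- (k * \<bar>Im \<zeta>\<bar> / 2)))" .
  have C0: "0 \<le> C"
  proof -
    have "0 \<le> C * exp (- (k * \<bar>Im \<zeta>\<bar> / 2))"
      using C[OF k(1) re im] eX X1 by (meson mult_nonneg_nonneg norm_ge_zero order_trans zero_le_power)
    then show ?thesis by (simp add: zero_le_mult_iff)
  qed
  have DD: "s * q \<le> 4 * D" unfolding s_def q_def D_def by (rule denominator_bound[OF z(1)])
  have D0: "0 < D" using DD pos mult_pos_pos[OF pos(1,3)] by linarith
  have kz: "exp (-5) * (\<delta> / (4 * D)) \<le> k * norm \<zeta>"
  proof -
    have "exp (-5) * norm (X - 1) \<le> exp (-5) * (exp 5 * norm \<zeta>)" using nX1 by (intro mult_left_mono) auto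
    also have "\<dots> = norm \<zeta>" by (simp add: exp_minus)
    finally have "k * (exp (-5) * norm (X - 1)) \<le> k * norm \<zeta>" using k(1) by (intro mult_left_mono) auto
    moreover have "exp (-5) * (\<delta> / (4 * D)) \<le> k * (exp (-5) * norm (X - 1))"
    proof -
      have "1 = 1 / (2 * sqrt \<epsilon>) * (2 * sqrt \<epsilon>)" using eps by simp
      also have "\<dots> \<le> k * (2 * \<alpha>)"
        using k foc_bounds(1) eps by (intro mult_mono) auto
      finally have one: "1 \<le> k * (2 * \<alpha>)" .
      have "\<delta> / (4 * D) \<le> \<delta> / (s * q)"
        using DD pos by (intro divide_left_mono mult_pos_pos D0) auto
      also have "\<dots> \<le> (k * (2 * \<alpha>)) * (\<delta> / (s * q))"
        using mult_right_mono[OF one, of "\<delta> / (s * q)"] pos by simp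
      also have "\<dots> = k * norm (X - 1)" unfolding Xm1 by simp
      finally have "exp (-5) * (\<delta> / (4 * D)) \<le> exp (-5) * (k * norm (X - 1))" by (intro mult_left_mono) auto
      then show ?thesis by (simp add: mult_ac)
    qed
    ultimately show ?thesis by linarith
  qed
  have kre: "k * \<bar>Re \<zeta>\<bar> \<le> pi / 2"
  proof -
    have "k * \<bar>Re \<zeta>\<bar> \<le> k * (pi / (2 * k))" using re k(1) by (intro mult_left_mono) auto
    also have "\<dots> = pi / 2" using k(1) by simp
    finally show ?thesis .
  qed
  have "k * norm \<zeta> \<le> k * (\<bar>Re \<zeta>\<bar> + \<bar>Im \<zeta>\<bar>)" using cmod_le k(1) by (intro mult_left_mono) auto
  then have kk: "k * norm \<zeta> \<le> pi / 2 + k * \<bar>Im \<zeta>\<bar>" using kre by (simp add: distrib_left)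
  have "- (k * \<bar>Im \<zeta>\<bar> / 2) \<le> 1 + - (exp (-5) / 8) * (\<delta> / D)"
  proof -
    have "exp (-5) * (\<delta> / (4 * D)) = 2 * ((exp (-5) / 8) * (\<delta> / D))" by simp
    then show ?thesis using kz kk pi_less_4 by linarith
  qed
  then have "exp (- (k * \<bar>Im \<zeta>\<bar> / 2)) \<le> exp (1 + - (exp (-5) / 8) * (\<delta> / D))" by simp
  also have "\<dots> = exp 1 * exp (- (exp (-5) / 8) * (\<delta> / D))" by (rule exp_add)
  finally have "exp 10 * (C * exp (- (k * \<bar>Im \<zeta>\<bar> / 2))) \<le> exp 10 * (C * (exp 1 * exp (- (exp (-5) / 8) * (\<delta> / D))))"
    using C0 by (intro mult_left_mono) auto
  also have "\<dots> = exp 11 * C * exp (- (exp (-5) / 8) * (\<delta> / D))"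
    using exp_add[of "10::real" 1] by simp
  finally have "F * (norm (X - 1) * norm (1 / X - 1)) \<le> exp 11 * C * exp (- (exp (-5) / 8) * (\<delta> / D))"
    using b1 by linarith
  then have "F * (norm (X - 1) * norm (1 / X - 1)) / \<delta>\<^sup>2 \<le> exp 11 * C * exp (- (exp (-5) / 8) * (\<delta> / D)) / \<delta>\<^sup>2"
    by (rule divide_right_mono) simp
  then show ?thesis unfolding main \<delta>_def by (simp add: mult_ac)
qed

end

theorem theorem1p2:
  shows "\<exists>A>0. \<exists>C>0. \<exists>\<epsilon>\<^sub>0>0. \<forall>\<epsilon> p :: real. \<forall>u x.
    0 < \<epsilon> \<and> \<epsilon> < \<epsilon>\<^sub>0 \<and> norm (0 :: real, p) < 1 / 2 \<and>
    dipole_solution \<epsilon> (0, 1) (0, p) u \<and>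
    x \<in> ball 0 (1 / 2) - closure (disk \<epsilon> 1 \<union> disk \<epsilon> 2) \<and> x \<noteq> (0, p) \<longrightarrow>
    (\<exists>g. GDERIV u x :> g \<and>
       norm g \<le> C * (1 / (norm (x - (0, p)))\<^sup>2 *
         exp (- A * (norm (x - (0, p)) /
           (sqrt \<epsilon> * norm (x - (0, p)) + norm (p *\<^sub>R x + (0, \<epsilon>)))))))"
proof -
  obtain b m M where profile: "radial_profile b m M" using ex_radial_profile by blast
  then interpret radial_profile b m M .
  obtain C where C: "0 < C" "\<And>k \<zeta>. 1 \<le> k \<Longrightarrow> \<bar>Re \<zeta>\<bar> \<le> pi / (2 * k) \<Longrightarrow> \<bar>Im \<zeta>\<bar> \<le> pi \<Longrightarrow> exp \<zeta> \<noteq> 1 \<Longrightarrow>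
      norm (cosec' k \<zeta> + cosec_tail' k \<zeta>) * (norm \<zeta>)\<^sup>2 \<le> C * exp (- (k * \<bar>Im \<zeta>\<bar> / 2))"
    using cosec_sum_derivative_bound by blast
  define \<kappa> where "\<kappa> = M / (2 * mass)"
  have \<kappa>: "0 < \<kappa>" using M_pos mass_pos by (simp add: \<kappa>_def)
  have "\<exists>g. GDERIV u x :> g \<and>
       norm g \<le> \<kappa> * (exp 11 * C) * (1 / (norm (x - (0, p)))\<^sup>2 *
         exp (- (exp (-5) / 8) * (norm (x - (0, p)) /
           (sqrt \<epsilon> * norm (x - (0, p)) + norm (p *\<^sub>R x + (0, \<epsilon>))))))"
    if h: "0 < \<epsilon>" "\<epsilon> < 1/10" "dipole_solution \<epsilon> (0, 1) (0, p) u"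
      "x \<in> ball 0 (1 / 2) - closure (disk \<epsilon> 1 \<union> disk \<epsilon> 2)" "x \<noteq> (0, p)" for \<epsilon> p u x
  proof -
    interpret emitter \<epsilon> b m M p u by unfold_locales (use h in auto)
    have xe: "x \<in> exterior_domain \<epsilon>" using h(4) by (simp add: exterior_domain_def)
    then have out: "1 \<le> norm (cpx x - of_real (cen \<epsilon>))" "1 \<le> norm (cpx x + of_real (cen \<epsilon>))"
      by (auto simp: exterior_domain_eq)
    have zp: "cpx x \<noteq> \<i> * of_real p" using h(5) cpx_eq_iff[of x "(0, p)"] by simp
    have nz: "norm (cpx x) < 1/2" using h(4) by simp
    have n1: "norm (cpx x - \<i> * of_real p) = norm (x - (0, p))"
      using norm_cpx[of "x - (0, p)"] by (simp add: cpx_diff)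
    have n2: "norm (of_real p * cpx x + \<i> * of_real \<epsilon>) = norm (p *\<^sub>R x + (0, \<epsilon>))"
      using norm_cpx[of "p *\<^sub>R x + (0, \<epsilon>)"] by (simp add: cpx_add cpx_scaleR)
    obtain g where g: "GDERIV u x :> g" "norm g = strength * slope p * norm (potd p (cpx x))"
      using u_gradient[OF xe h(5)] by blast
    have "norm g = \<kappa> * (slope p * norm (potd p (cpx x)))" using g(2) by (simp add: strength_def \<kappa>_def)
    also have "\<dots> \<le> \<kappa> * (exp 11 * C * (1 / (norm (x - (0, p)))\<^sup>2 *
         exp (- (exp (-5) / 8) * (norm (x - (0, p)) /
           (sqrt \<epsilon> * norm (x - (0, p)) + norm (p *\<^sub>R x + (0, \<epsilon>)))))))"
      using potd_bound[OF C(2) out nz zp] \<kappa> unfolding n1 n2 by (intro mult_left_mono) auto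
    finally show ?thesis using g(1) by (intro exI[of _ g]) (simp add: mult.assoc)
  qed
  then show ?thesis
    using \<kappa> C(1) by (intro exI[of _ "exp (-5) / 8"] exI[of _ "\<kappa> * (exp 11 * C)"] exI[of _ "1/10"] conjI) auto
qed

end
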